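(* Let $k$ be a commutative ring and let $A$ be a unital associative $k$-algebra. Let $P_*(A)$ be the chain complex with $P_n(A)=k[U_{n+1}]\otimes_k A^{\otimes(n+1)}$, $n\ge0$, where $U_{m}$ is the conjugacy class of the cyclic shift in the symmetric group $S_m$. Then $$H_*(P_*(A))\simeq HH_*(A),$$ where $HH_*(A)$ denotes Hochschild homology.
   Context: Tensor products are over $k$. $U_m\subset S_m$ is the conjugacy class of the $m$-cycle $(1,2,\ldots,m)$, i.e. the set of all $m$-cycles ($U_1=S_1$). $P_*(A)$ is the direct summand, corresponding to the classes $U_m$, of the complex $L_*(A)$ with terms $k[S_m]\otimes A^{\otimes m}$ whose differential corresponds to the Leibniz boundary $$d(x_1\otimes\cdots\otimes x_m)=\sum_{1\le i<j\le m}(-1)^{j}(x_1,\ldots,x_{i-1},[x_i,x_j],x_{i+1},\ldots,\widehat{x}_j,\ldots,x_m)$$ on $gl(A)^{\otimes m}$ under $E^{a_1}_{1\,\sigma(1)}\otimes\cdots\otimes E^{a_m}_{m\,\sigma(m)}\mapsto\sigma\otimes(a_1,\ldots,a_m)$, where $E^a_{ij}$ is the elementary matrix with entry $a$ in position $ij$. Explicitly, for $\sigma\in U_m$, $m\ge2$, and $1\le j\le m$, let $\sigma\setminus j\in U_{m-1}$ be the cycle obtained by deleting $j$ from the cycle $\sigma$ and relabelling $\{1,\ldots,m\}\setminus\{j\}$ as $\{1,\ldots,m-1\}$ by the order-preserving bijection. Then the boundary $k[U_m]\otimes A^{\otimes m}\to k[U_{m-1}]\otimes A^{\otimes(m-1)}$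 is $$d(\sigma\otimes(a_1,\ldots,a_m))=\sum_{\substack{1\le i<j\le m\\ \sigma(i)=j}}(-1)^j(\sigma\setminus j)\otimes(a_1,\ldots,a_{i-1},a_ia_j,a_{i+1},\ldots,\widehat{a}_j,\ldots,a_m)-\sum_{\substack{1\le i<j\le m\\ \sigma(j)=i}}(-1)^j(\sigma\setminus j)\otimes(a_1,\ldots,a_{i-1},a_ja_i,a_{i+1},\ldots,\widehat{a}_j,\ldots,a_m).$$ $HH_*(A)$ is the homology of $A^{\otimes(n+1)}$ in degree $n\ge0$ with $b=\sum_{i=0}^n(-1)^id_i$, $d_i(a_0,\ldots,a_n)=(a_0,\ldots,a_ia_{i+1},\ldots,a_n)$ for $0\le i<n$, $d_n(a_0,\ldots,a_n)=(a_na_0,a_1,\ldots,a_{n-1})$. *)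

theory Defs
  imports "HOL-Algebra.Module" "HOL-Algebra.AbelCoset" "HOL-Combinatorics.Cycles"
begin

section \<open>Algebras, module homomorphisms and quotient modules\<close>

text \<open>The library locale \<open>algebra\<close> is about commutative algebras.\<close>

locale assoc_algebra = module + ring M +
  assumes smult_mult_left:
      "\<lbrakk>a \<in> carrier R; x \<in> carrier M; y \<in> carrier M\<rbrakk> \<Longrightarrow>
        (a \<odot>\<^bsub>M\<^esub> x) \<otimes>\<^bsub>M\<^esub> y = a \<odot>\<^bsub>M\<^esub> (x \<otimes>\<^bsub>M\<^esub> y)"
    and smult_mult_right:
      "\<lbrakk>a \<in> carrier R; x \<in> carrier M; y \<in> carrier M\<rbrakk> \<Longrightarrow>
        x \<otimes>\<^bsub>M\<^esub> (a \<odot>\<^bsub>M\<^esub> y) = a \<odot>\<^bsub>M\<^esub> (x \<otimes>\<^bsub>M\<^esub> y)"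

definition module_hom ::
  "('k, 'r) ring_scheme \<Rightarrow> ('k, 'a, 's) module_scheme \<Rightarrow> ('k, 'b, 't) module_scheme \<Rightarrow> ('a \<Rightarrow> 'b) set"
  where "module_hom R M N =
    {f \<in> carrier M \<rightarrow> carrier N.
      (\<forall>x\<in>carrier M. \<forall>y\<in>carrier M. f (x \<oplus>\<^bsub>M\<^esub> y) = f x \<oplus>\<^bsub>N\<^esub> f y) \<and>
      (\<forall>r\<in>carrier R. \<forall>x\<in>carrier M. f (r \<odot>\<^bsub>M\<^esub> x) = r \<odot>\<^bsub>N\<^esub> f x)}"

definition module_isomorphic ::
  "('k, 'r) ring_scheme \<Rightarrow> ('k, 'a, 's) module_scheme \<Rightarrow> ('k, 'b, 't) module_scheme \<Rightarrow> bool"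
  where "module_isomorphic R M N \<longleftrightarrow>
    (\<exists>f \<in> module_hom R M N. bij_betw f (carrier M) (carrier N))"

text \<open>The record type of modules extends that of rings; for modules that carry no ring
  structure the fields \<open>mult\<close> and \<open>one\<close> are left undefined.\<close>

definition quot_module ::
  "('k, 'a, 's) module_scheme \<Rightarrow> 'a set \<Rightarrow> ('k, 'a set) module"
  where "quot_module M N =
    \<lparr>carrier = a_rcosets\<^bsub>M\<^esub> N, monoid.mult = undefined, one = undefined,
     zero = N, add = (<+>\<^bsub>M\<^esub>),
     smult = (\<lambda>r S. \<Union>x\<in>S. N +>\<^bsub>M\<^esub> (r \<odot>\<^bsub>M\<^esub> x))\<rparr>"

definition submodule_span ::
  "('k, 'r) ring_scheme \<Rightarrow> ('k, 'a, 's) module_scheme \<Rightarrow> 'a set \<Rightarrow> 'a set"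
  where "submodule_span R M S = \<Inter>{N. submodule N R M \<and> S \<subseteq> N}"

text \<open>The map on a quotient induced by a map \<open>f\<close> that is constant on cosets.\<close>

definition quot_lift :: "('a \<Rightarrow> 'b) \<Rightarrow> 'a set \<Rightarrow> 'b"
  where "quot_lift f S = the_elem (f ` S)"


section \<open>Free modules\<close>

definition free_module :: "('k, 'r) ring_scheme \<Rightarrow> 'x set \<Rightarrow> ('k, 'x \<Rightarrow> 'k) module"
  where "free_module R S =
    \<lparr>carrier = {f. (\<forall>x\<in>S. f x \<in> carrier R) \<and> (\<forall>x. x \<notin> S \<longrightarrow> f x = \<zero>\<^bsub>R\<^esub>) \<and>
                   finite {x. f x \<noteq> \<zero>\<^bsub>R\<^esub>}},
     monoid.mult = undefined, one = undefined,
     zero = (\<lambda>_. \<zero>\<^bsub>R\<^esub>), add = (\<lambda>f g x. f x \<oplus>\<^bsub>R\<^esub> g x),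
     smult = (\<lambda>r f x. r \<otimes>\<^bsub>R\<^esub> f x)\<rparr>"

definition free_gen :: "('k, 'r) ring_scheme \<Rightarrow> 'x \<Rightarrow> 'x \<Rightarrow> 'k"
  where "free_gen R x = (\<lambda>y. if y = x then \<one>\<^bsub>R\<^esub> else \<zero>\<^bsub>R\<^esub>)"

definition free_lift ::
  "('k, 'r) ring_scheme \<Rightarrow> ('k, 'b, 't) module_scheme \<Rightarrow> ('x \<Rightarrow> 'b) \<Rightarrow> ('x \<Rightarrow> 'k) \<Rightarrow> 'b"
  where "free_lift R Q \<phi> f = (\<Oplus>\<^bsub>Q\<^esub>x\<in>{x. f x \<noteq> \<zero>\<^bsub>R\<^esub>}. f x \<odot>\<^bsub>Q\<^esub> \<phi> x)"


section \<open>Tensor products and tensor powers\<close>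

definition tensor_rels ::
  "('k, 'r) ring_scheme \<Rightarrow> ('k, 'a, 's) module_scheme \<Rightarrow> ('k, 'b, 't) module_scheme
    \<Rightarrow> ('a \<times> 'b \<Rightarrow> 'k) set"
  where "tensor_rels R M N = (let F = free_module R (carrier M \<times> carrier N); g = free_gen R in
      {g (x \<oplus>\<^bsub>M\<^esub> x', y) \<ominus>\<^bsub>F\<^esub> (g (x, y) \<oplus>\<^bsub>F\<^esub> g (x', y)) |x x' y.
         x \<in> carrier M \<and> x' \<in> carrier M \<and> y \<in> carrier N} \<union>
      {g (x, y \<oplus>\<^bsub>N\<^esub> y') \<ominus>\<^bsub>F\<^esub> (g (x, y) \<oplus>\<^bsub>F\<^esub> g (x, y')) |x y y'.
         x \<in> carrier M \<and> y \<in> carrier N \<and> y' \<in> carrier N} \<union>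
      {g (r \<odot>\<^bsub>M\<^esub> x, y) \<ominus>\<^bsub>F\<^esub> (r \<odot>\<^bsub>F\<^esub> g (x, y)) |r x y.
         r \<in> carrier R \<and> x \<in> carrier M \<and> y \<in> carrier N} \<union>
      {g (x, r \<odot>\<^bsub>N\<^esub> y) \<ominus>\<^bsub>F\<^esub> (r \<odot>\<^bsub>F\<^esub> g (x, y)) |r x y.
         r \<in> carrier R \<and> x \<in> carrier M \<and> y \<in> carrier N})"

definition tensor_kernel ::
  "('k, 'r) ring_scheme \<Rightarrow> ('k, 'a, 's) module_scheme \<Rightarrow> ('k, 'b, 't) module_scheme
    \<Rightarrow> ('a \<times> 'b \<Rightarrow> 'k) set"
  where "tensor_kernel R M N =
    submodule_span R (free_module R (carrier M \<times> carrier N)) (tensor_rels R M N)"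

definition tensor ::
  "('k, 'r) ring_scheme \<Rightarrow> ('k, 'a, 's) module_scheme \<Rightarrow> ('k, 'b, 't) module_scheme
    \<Rightarrow> ('k, ('a \<times> 'b \<Rightarrow> 'k) set) module"
  where "tensor R M N =
    quot_module (free_module R (carrier M \<times> carrier N)) (tensor_kernel R M N)"

definition tensor_elem ::
  "('k, 'r) ring_scheme \<Rightarrow> ('k, 'a, 's) module_scheme \<Rightarrow> ('k, 'b, 't) module_scheme
    \<Rightarrow> 'a \<Rightarrow> 'b \<Rightarrow> ('a \<times> 'b \<Rightarrow> 'k) set"
  where "tensor_elem R M N x y =
    tensor_kernel R M N +>\<^bsub>free_module R (carrier M \<times> carrier N)\<^esub> free_gen R (x, y)"

text \<open>The linear map out of a tensor product induced by a bilinear map into \<open>Q\<close>.\<close>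

definition tensor_lift ::
  "('k, 'r) ring_scheme \<Rightarrow> ('k, 'c, 't) module_scheme \<Rightarrow> ('a \<Rightarrow> 'b \<Rightarrow> 'c)
    \<Rightarrow> ('a \<times> 'b \<Rightarrow> 'k) set \<Rightarrow> 'c"
  where "tensor_lift R Q \<beta> = quot_lift (free_lift R Q (\<lambda>(x, y). \<beta> x y))"

text \<open>The \<open>n\<close>-th tensor power is presented by the \<open>n\<close>-tuples (lists of length \<open>n\<close>) and the
  multilinearity relations.\<close>

definition tuples :: "('a, 's) partial_object_scheme \<Rightarrow> nat \<Rightarrow> 'a list set"
  where "tuples M n = {as. length as = n \<and> set as \<subseteq> carrier M}"

definition tpow_rels ::
  "('k, 'r) ring_scheme \<Rightarrow> ('k, 'a, 's) module_scheme \<Rightarrow> nat \<Rightarrow> ('a list \<Rightarrow> 'k) set"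
  where "tpow_rels R M n = (let F = free_module R (tuples M n); g = free_gen R in
      {g (as[i := x \<oplus>\<^bsub>M\<^esub> y]) \<ominus>\<^bsub>F\<^esub> (g (as[i := x]) \<oplus>\<^bsub>F\<^esub> g (as[i := y])) |as i x y.
         as \<in> tuples M n \<and> i < n \<and> x \<in> carrier M \<and> y \<in> carrier M} \<union>
      {g (as[i := r \<odot>\<^bsub>M\<^esub> x]) \<ominus>\<^bsub>F\<^esub> (r \<odot>\<^bsub>F\<^esub> g (as[i := x])) |as i r x.
         as \<in> tuples M n \<and> i < n \<and> r \<in> carrier R \<and> x \<in> carrier M})"

definition tpow_kernel ::
  "('k, 'r) ring_scheme \<Rightarrow> ('k, 'a, 's) module_scheme \<Rightarrow> nat \<Rightarrow> ('a list \<Rightarrow> 'k) set"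
  where "tpow_kernel R M n = submodule_span R (free_module R (tuples M n)) (tpow_rels R M n)"

definition tpow ::
  "('k, 'r) ring_scheme \<Rightarrow> ('k, 'a, 's) module_scheme \<Rightarrow> nat \<Rightarrow> ('k, ('a list \<Rightarrow> 'k) set) module"
  where "tpow R M n = quot_module (free_module R (tuples M n)) (tpow_kernel R M n)"

definition tpow_elem ::
  "('k, 'r) ring_scheme \<Rightarrow> ('k, 'a, 's) module_scheme \<Rightarrow> 'a list \<Rightarrow> ('a list \<Rightarrow> 'k) set"
  where "tpow_elem R M as =
    tpow_kernel R M (length as) +>\<^bsub>free_module R (tuples M (length as))\<^esub> free_gen R as"

text \<open>The linear map out of a tensor power induced by a multilinear map into \<open>Q\<close>.\<close>

definition tpow_lift ::
  "('k, 'r) ring_scheme \<Rightarrow> ('k, 'c, 't) module_scheme \<Rightarrow> ('a list \<Rightarrow> 'c)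
    \<Rightarrow> ('a list \<Rightarrow> 'k) set \<Rightarrow> 'c"
  where "tpow_lift R Q \<mu> = quot_lift (free_lift R Q \<mu>)"


section \<open>Homology\<close>

text \<open>Complexes are concentrated in degrees \<open>n \<ge> 0\<close>; \<open>d n\<close> is the differential from degree
  \<open>n + 1\<close> to degree \<open>n\<close>.\<close>

fun cycles_of :: "(nat \<Rightarrow> ('k, 'c, 's) module_scheme) \<Rightarrow> (nat \<Rightarrow> 'c \<Rightarrow> 'c) \<Rightarrow> nat \<Rightarrow> 'c set"
  where
    "cycles_of C d 0 = carrier (C 0)"
  | "cycles_of C d (Suc n) = a_kernel (C (Suc n)) (C n) (d n)"

definition boundaries_of ::
    "(nat \<Rightarrow> ('k, 'c, 's) module_scheme) \<Rightarrow> (nat \<Rightarrow> 'c \<Rightarrow> 'c) \<Rightarrow> nat \<Rightarrow> 'c set"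
  where "boundaries_of C d n = d n ` carrier (C (Suc n))"

definition homology ::
    "(nat \<Rightarrow> ('k, 'c, 's) module_scheme) \<Rightarrow> (nat \<Rightarrow> 'c \<Rightarrow> 'c) \<Rightarrow> nat \<Rightarrow> ('k, 'c set) module"
  where "homology C d n = quot_module ((C n)\<lparr>carrier := cycles_of C d n\<rparr>) (boundaries_of C d n)"

definition sign_smult ::
    "('k, 'r) ring_scheme \<Rightarrow> ('k, 'c, 's) module_scheme \<Rightarrow> nat \<Rightarrow> 'c \<Rightarrow> 'c"
  where "sign_smult R M i x = ((\<ominus>\<^bsub>R\<^esub> \<one>\<^bsub>R\<^esub>) [^]\<^bsub>R\<^esub> i) \<odot>\<^bsub>M\<^esub> x"


section \<open>Hochschild homology\<close>

definition hoch_chain ::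
    "('k, 'r) ring_scheme \<Rightarrow> ('k, 'a, 's) module_scheme \<Rightarrow> nat \<Rightarrow> ('k, ('a list \<Rightarrow> 'k) set) module"
  where "hoch_chain R A n = tpow R A (n + 1)"

text \<open>\<open>hoch_face A n i as\<close> is the face \<open>d\<^sub>i\<close> of the tuple \<open>as = (a\<^sub>0, \<dots>, a\<^sub>n)\<close>.\<close>

definition hoch_face :: "('a, 's) ring_scheme \<Rightarrow> nat \<Rightarrow> nat \<Rightarrow> 'a list \<Rightarrow> 'a list"
  where "hoch_face A n i as =
    (if i < n then take i as @ (as ! i \<otimes>\<^bsub>A\<^esub> as ! (i + 1)) # drop (i + 2) as
     else (as ! n \<otimes>\<^bsub>A\<^esub> as ! 0) # take (n - 1) (tl as))"

definition hoch_gen ::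
    "('k, 'r) ring_scheme \<Rightarrow> ('k, 'a, 's) module_scheme \<Rightarrow> nat \<Rightarrow> 'a list \<Rightarrow> ('a list \<Rightarrow> 'k) set"
  where "hoch_gen R A n as =
    (\<Oplus>\<^bsub>hoch_chain R A n\<^esub>i\<in>{0..n + 1}.
       sign_smult R (hoch_chain R A n) i (tpow_elem R A (hoch_face A (n + 1) i as)))"

definition hoch_boundary ::
    "('k, 'r) ring_scheme \<Rightarrow> ('k, 'a, 's) module_scheme \<Rightarrow> nat
      \<Rightarrow> ('a list \<Rightarrow> 'k) set \<Rightarrow> ('a list \<Rightarrow> 'k) set"
  where "hoch_boundary R A n = tpow_lift R (hoch_chain R A n) (hoch_gen R A n)"

definition HH ::
    "('k, 'r) ring_scheme \<Rightarrow> ('k, 'a, 's) module_scheme \<Rightarrow> nat \<Rightarrow> ('k, ('a list \<Rightarrow> 'k) set set) module"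
  where "HH R A = homology (hoch_chain R A) (hoch_boundary R A)"


section \<open>The complex \<open>P\<^sub>*(A)\<close>\<close>

definition U_class :: "nat \<Rightarrow> (nat \<Rightarrow> nat) set"
  where "U_class m = {\<tau> \<circ> cycle_of_list [1..<m + 1] \<circ> inv_into UNIV \<tau> |\<tau>. \<tau> permutes {1..m}}"

text \<open>\<open>skip j\<close> is the order-preserving bijection from \<open>{1,\<dots>,m-1}\<close> onto \<open>{1,\<dots>,m} - {j}\<close>,
  with inverse \<open>unskip j\<close>.\<close>

definition skip :: "nat \<Rightarrow> nat \<Rightarrow> nat"
  where "skip j x = (if x < j then x else x + 1)"

definition unskip :: "nat \<Rightarrow> nat \<Rightarrow> nat"
  where "unskip j x = (if x < j then x else x - 1)"

definition delete_from_cycle :: "(nat \<Rightarrow> nat) \<Rightarrow> nat \<Rightarrow> nat \<Rightarrow> nat"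
  where "delete_from_cycle \<sigma> j x =
    (let y = skip j x in unskip j (if \<sigma> y = j then \<sigma> j else \<sigma> y))"

definition P_chain ::
    "('k, 'r) ring_scheme \<Rightarrow> ('k, 'a, 's) module_scheme \<Rightarrow> nat
      \<Rightarrow> ('k, (((nat \<Rightarrow> nat) \<Rightarrow> 'k) \<times> ('a list \<Rightarrow> 'k) set \<Rightarrow> 'k) set) module"
  where "P_chain R A n = tensor R (free_module R (U_class (n + 1))) (tpow R A (n + 1))"

text \<open>\<open>\<sigma> \<otimes> (a\<^sub>1, \<dots>, a\<^sub>m)\<close>, where \<open>m\<close> is the length of the tuple.\<close>

definition P_elem ::
    "('k, 'r) ring_scheme \<Rightarrow> ('k, 'a, 's) module_scheme \<Rightarrow> (nat \<Rightarrow> nat) \<Rightarrow> 'a list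
      \<Rightarrow> (((nat \<Rightarrow> nat) \<Rightarrow> 'k) \<times> ('a list \<Rightarrow> 'k) set \<Rightarrow> 'k) set"
  where "P_elem R A \<sigma> as =
    tensor_elem R (free_module R (U_class (length as))) (tpow R A (length as))
      (free_gen R \<sigma>) (tpow_elem R A as)"

text \<open>\<open>replace_delete as i j c\<close> puts \<open>c\<close> in place \<open>i\<close> and drops place \<open>j\<close>. The places are
  counted from \<open>1\<close>, hence the shift against list indices.\<close>

definition replace_delete :: "'a list \<Rightarrow> nat \<Rightarrow> nat \<Rightarrow> 'a \<Rightarrow> 'a list"
  where "replace_delete as i j c = (let bs = as[i - 1 := c] in take (j - 1) bs @ drop j bs)"

definition P_gen ::
    "('k, 'r) ring_scheme \<Rightarrow> ('k, 'a, 's) module_scheme \<Rightarrow> nat \<Rightarrow> (nat \<Rightarrow> nat) \<Rightarrow> 'a list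
      \<Rightarrow> (((nat \<Rightarrow> nat) \<Rightarrow> 'k) \<times> ('a list \<Rightarrow> 'k) set \<Rightarrow> 'k) set"
  where "P_gen R A n \<sigma> as = (let m = n + 2; Q = P_chain R A n; a = (\<lambda>i. as ! (i - 1)) in
    finsum Q (\<lambda>(i, j). sign_smult R Q j
        (P_elem R A (delete_from_cycle \<sigma> j) (replace_delete as i j (a i \<otimes>\<^bsub>A\<^esub> a j))))
      {(i, j). 1 \<le> i \<and> i < j \<and> j \<le> m \<and> \<sigma> i = j}
    \<ominus>\<^bsub>Q\<^esub>
    finsum Q (\<lambda>(i, j). sign_smult R Q j
        (P_elem R A (delete_from_cycle \<sigma> j) (replace_delete as i j (a j \<otimes>\<^bsub>A\<^esub> a i))))
      {(i, j). 1 \<le> i \<and> i < j \<and> j \<le> m \<and> \<sigma> j = i})"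

definition P_boundary ::
    "('k, 'r) ring_scheme \<Rightarrow> ('k, 'a, 's) module_scheme \<Rightarrow> nat
      \<Rightarrow> (((nat \<Rightarrow> nat) \<Rightarrow> 'k) \<times> ('a list \<Rightarrow> 'k) set \<Rightarrow> 'k) set
      \<Rightarrow> (((nat \<Rightarrow> nat) \<Rightarrow> 'k) \<times> ('a list \<Rightarrow> 'k) set \<Rightarrow> 'k) set"
  where "P_boundary R A n = (let Q = P_chain R A n in
    tensor_lift R Q (\<lambda>f t. free_lift R Q (\<lambda>\<sigma>. tpow_lift R Q (P_gen R A n \<sigma>) t) f))"

section \<open>Well-definedness\<close>

text \<open>The maps \<open>quot_lift\<close>, \<open>tensor_lift\<close> and \<open>tpow_lift\<close> are meaningful only for maps that
  respect the relations. The theorems \<open>hoch_boundary\<close> and \<open>P_boundary\<close> show that this is the case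
  for both differentials: they are linear and have the prescribed values on elementary tensors.\<close>

lemma module_homD:
  assumes "f \<in> module_hom R M N"
  shows "x \<in> carrier M \<Longrightarrow> f x \<in> carrier N"
    "x \<in> carrier M \<Longrightarrow> y \<in> carrier M \<Longrightarrow> f (x \<oplus>\<^bsub>M\<^esub> y) = f x \<oplus>\<^bsub>N\<^esub> f y"
    "r \<in> carrier R \<Longrightarrow> x \<in> carrier M \<Longrightarrow> f (r \<odot>\<^bsub>M\<^esub> x) = r \<odot>\<^bsub>N\<^esub> f x"
  using assms by (auto simp: module_hom_def)

lemma module_homI:
  assumes "\<And>x. x \<in> carrier M \<Longrightarrow> f x \<in> carrier N"
    "\<And>x y. x \<in> carrier M \<Longrightarrow> y \<in> carrier M \<Longrightarrow> f (x \<oplus>\<^bsub>M\<^esub> y) = f x \<oplus>\<^bsub>N\<^esub> f y"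
    "\<And>r x. r \<in> carrier R \<Longrightarrow> x \<in> carrier M \<Longrightarrow> f (r \<odot>\<^bsub>M\<^esub> x) = r \<odot>\<^bsub>N\<^esub> f x"
  shows "f \<in> module_hom R M N"
  using assms by (auto simp: module_hom_def)

lemma module_hom_zero:
  assumes "module R M" "module R N" "f \<in> module_hom R M N"
  shows "f \<zero>\<^bsub>M\<^esub> = \<zero>\<^bsub>N\<^esub>"
proof -
  interpret M: module R M by fact
  interpret N: module R N by fact
  have "f (\<zero>\<^bsub>R\<^esub> \<odot>\<^bsub>M\<^esub> \<zero>\<^bsub>M\<^esub>) = \<zero>\<^bsub>R\<^esub> \<odot>\<^bsub>N\<^esub> f \<zero>\<^bsub>M\<^esub>"
    by (rule module_homD[OF assms(3)]) auto
  then show ?thesis using module_homD(1)[OF assms(3)] by simp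
qed

lemma module_hom_neg:
  assumes "module R M" "module R N" "f \<in> module_hom R M N" "x \<in> carrier M"
  shows "f (\<ominus>\<^bsub>M\<^esub> x) = \<ominus>\<^bsub>N\<^esub> f x"
proof -
  interpret M: module R M by fact
  interpret N: module R N by fact
  have "f (\<ominus>\<^bsub>M\<^esub> x) \<oplus>\<^bsub>N\<^esub> f x = \<zero>\<^bsub>N\<^esub>"
    using module_homD(2)[OF assms(3), of "\<ominus>\<^bsub>M\<^esub> x" x] module_hom_zero[OF assms(1-3)] assms(4)
    by (simp add: M.l_neg)
  then show ?thesis using module_homD(1)[OF assms(3)] assms(4)
    by (metis M.add.inv_closed N.minus_equality)
qed

lemma module_hom_minus:
  assumes "module R M" "module R N" "f \<in> module_hom R M N" "x \<in> carrier M" "y \<in> carrier M"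
  shows "f (x \<ominus>\<^bsub>M\<^esub> y) = f x \<ominus>\<^bsub>N\<^esub> f y"
proof -
  interpret M: module R M by fact
  show ?thesis unfolding a_minus_def
    using module_homD(2)[OF assms(3)] module_hom_neg[OF assms(1-3)] assms(4,5) by simp
qed

lemma module_hom_finsum:
  assumes "module R M" "module R N" "f \<in> module_hom R M N" "finite I" "g \<in> I \<rightarrow> carrier M"
  shows "f (finsum M g I) = finsum N (\<lambda>i. f (g i)) I"
proof -
  interpret M: module R M by fact
  interpret N: module R N by fact
  show ?thesis using assms(4,5)
  proof (induction I rule: finite_induct)
    case empty then show ?case using module_hom_zero[OF assms(1-3)] by simp
  next
    case (insert x F)
    then show ?case using module_homD(1,2)[OF assms(3)] by (simp add: Pi_def)
  qed
qed

lemma module_transport: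
  fixes Q :: "('k, 'b, 't) module_scheme"
  assumes "module R M"
    and c: "carrier Q = \<pi> ` carrier M"
    and z: "\<zero>\<^bsub>Q\<^esub> = \<pi> \<zero>\<^bsub>M\<^esub>"
    and a: "\<And>x y. x \<in> carrier M \<Longrightarrow> y \<in> carrier M \<Longrightarrow> \<pi> x \<oplus>\<^bsub>Q\<^esub> \<pi> y = \<pi> (x \<oplus>\<^bsub>M\<^esub> y)"
    and s: "\<And>r x. r \<in> carrier R \<Longrightarrow> x \<in> carrier M \<Longrightarrow> r \<odot>\<^bsub>Q\<^esub> \<pi> x = \<pi> (r \<odot>\<^bsub>M\<^esub> x)"
  shows "module R Q" "\<pi> \<in> module_hom R M Q"
proof -
  interpret M: module R M by fact
  show "module R Q"
  proof (rule moduleI)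
    show "cring R" by (rule M.R.is_cring)
    show "abelian_group Q"
    proof (rule abelian_groupI)
      fix x assume "x \<in> carrier Q"
      then obtain x' where x': "x' \<in> carrier M" "x = \<pi> x'" using c by auto
      show "\<exists>y\<in>carrier Q. y \<oplus>\<^bsub>Q\<^esub> x = \<zero>\<^bsub>Q\<^esub>"
        by (rule bexI[of _ "\<pi> (\<ominus>\<^bsub>M\<^esub> x')"]) (use x' in \<open>auto simp: c a z M.l_neg\<close>)
    qed (auto simp: c z a M.a_ac)
  qed (auto simp: c a s M.smult_l_distr M.smult_r_distr M.smult_assoc1)
  show "\<pi> \<in> module_hom R M Q"
    by (rule module_homI) (auto simp: c a s)
qed

lemma quot_module:
  assumes "module R M" "submodule N R M"
  shows "module R (quot_module M N)"
    and "(\<lambda>x. N +>\<^bsub>M\<^esub> x) \<in> module_hom R M (quot_module M N)"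
    and "carrier (quot_module M N) = (\<lambda>x. N +>\<^bsub>M\<^esub> x) ` carrier M"
proof -
  interpret M: module R M by fact
  interpret N: submodule N R M by fact
  interpret N: abelian_subgroup N M
    by (rule abelian_subgroupI3) (auto intro: additive_subgroup.intro N.subgroup_axioms M.abelian_group_axioms)
  let ?p = "\<lambda>x. N +>\<^bsub>M\<^esub> x" and ?Q = "quot_module M N"
  show c: "carrier ?Q = ?p ` carrier M"
    by (auto simp: quot_module_def A_RCOSETS_def')
  have z: "\<zero>\<^bsub>?Q\<^esub> = ?p \<zero>\<^bsub>M\<^esub>"
    using N.a_subset by (simp add: quot_module_def M.a_coset_add_zero)
  have a: "?p x \<oplus>\<^bsub>?Q\<^esub> ?p y = ?p (x \<oplus>\<^bsub>M\<^esub> y)" if "x \<in> carrier M" "y \<in> carrier M" for x y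
    using that by (simp add: quot_module_def N.a_rcos_sum)
  have s: "r \<odot>\<^bsub>?Q\<^esub> ?p x = ?p (r \<odot>\<^bsub>M\<^esub> x)" if "r \<in> carrier R" "x \<in> carrier M" for r x
  proof -
    have eq: "?p (r \<odot>\<^bsub>M\<^esub> y) = ?p (r \<odot>\<^bsub>M\<^esub> x)" if y: "y \<in> ?p x" for y
    proof -
      obtain h where h: "h \<in> N" "y = h \<oplus>\<^bsub>M\<^esub> x" using y by (auto simp: a_r_coset_def')
      have hM: "h \<in> carrier M" using h N.a_subset by auto
      have "r \<odot>\<^bsub>M\<^esub> y = (r \<odot>\<^bsub>M\<^esub> h) \<oplus>\<^bsub>M\<^esub> (r \<odot>\<^bsub>M\<^esub> x)"
        using h hM \<open>r \<in> carrier R\<close> \<open>x \<in> carrier M\<close> by (simp add: M.smult_r_distr)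
      moreover have "r \<odot>\<^bsub>M\<^esub> h \<in> N" using h \<open>r \<in> carrier R\<close> by simp
      ultimately have "r \<odot>\<^bsub>M\<^esub> y \<in> ?p (r \<odot>\<^bsub>M\<^esub> x)" by (auto simp: a_r_coset_def')
      then show ?thesis using that \<open>r \<in> carrier R\<close> \<open>x \<in> carrier M\<close>
        using N.a_repr_independence' by blast
    qed
    have "x \<in> ?p x" using that by (simp add: N.a_rcos_self)
    from UN_constant_eq[OF this, of "\<lambda>y. ?p (r \<odot>\<^bsub>M\<^esub> y)"] eq
    have "(\<Union>y\<in>?p x. ?p (r \<odot>\<^bsub>M\<^esub> y)) = ?p (r \<odot>\<^bsub>M\<^esub> x)" by blast
    then show ?thesis unfolding quot_module_def by simp
  qed
  show "module R ?Q" "?p \<in> module_hom R M ?Q"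
    using module_transport[OF assms(1), of ?Q ?p] c z a s by auto
qed

lemma submodule_span:
  assumes "module R M" "S \<subseteq> carrier M"
  shows "submodule (submodule_span R M S) R M" "S \<subseteq> submodule_span R M S"
proof -
  interpret M: module R M by fact
  have c: "submodule (carrier M) R M" by (rule M.carrier_is_submodule)
  show "submodule (submodule_span R M S) R M"
    unfolding submodule_span_def
  proof (rule M.submoduleI)
    show "\<Inter>{N. submodule N R M \<and> S \<subseteq> N} \<subseteq> carrier M" using c assms(2) by blast
    have "\<zero>\<^bsub>M\<^esub> \<in> N" if "submodule N R M" for N
      using subgroup.one_closed[OF submodule.axioms(1)[OF that]] by simp
    then show "\<zero>\<^bsub>M\<^esub> \<in> \<Inter>{N. submodule N R M \<and> S \<subseteq> N}" by blast
  next
    fix a assume "a \<in> \<Inter>{N. submodule N R M \<and> S \<subseteq> N}"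
    then show "\<ominus>\<^bsub>M\<^esub> a \<in> \<Inter>{N. submodule N R M \<and> S \<subseteq> N}" by (auto intro: M.submoduleE(3))
  next
    fix a b assume "a \<in> \<Inter>{N. submodule N R M \<and> S \<subseteq> N}" "b \<in> \<Inter>{N. submodule N R M \<and> S \<subseteq> N}"
    then show "a \<oplus>\<^bsub>M\<^esub> b \<in> \<Inter>{N. submodule N R M \<and> S \<subseteq> N}" by (auto intro: M.submoduleE(5))
  next
    fix a b assume "a \<in> carrier R" "b \<in> \<Inter>{N. submodule N R M \<and> S \<subseteq> N}"
    then show "a \<odot>\<^bsub>M\<^esub> b \<in> \<Inter>{N. submodule N R M \<and> S \<subseteq> N}" by (auto intro: M.submoduleE(4))
  qed
  show "S \<subseteq> submodule_span R M S" by (auto simp: submodule_span_def)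
qed

lemma submodule_span_vanish:
  assumes "module R M" "module R Q" "f \<in> module_hom R M Q" "S \<subseteq> carrier M"
    and "\<And>x. x \<in> S \<Longrightarrow> f x = \<zero>\<^bsub>Q\<^esub>" "x \<in> submodule_span R M S"
  shows "f x = \<zero>\<^bsub>Q\<^esub>"
proof -
  interpret M: module R M by fact
  interpret Q: module R Q by fact
  have "submodule {x \<in> carrier M. f x = \<zero>\<^bsub>Q\<^esub>} R M"
    by (rule M.submoduleI)
      (auto simp: module_homD[OF assms(3)] module_hom_neg[OF assms(1-3)] module_hom_zero[OF assms(1-3)])
  moreover have "S \<subseteq> {x \<in> carrier M. f x = \<zero>\<^bsub>Q\<^esub>}" using assms(4,5) by blast
  ultimately have "submodule_span R M S \<subseteq> {x \<in> carrier M. f x = \<zero>\<^bsub>Q\<^esub>}"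
    unfolding submodule_span_def by (intro Inter_lower CollectI conjI)
  then show ?thesis using assms(6) by blast
qed

lemma quot_lift:
  assumes "module R M" "module R Q" "f \<in> module_hom R M Q" "submodule N R M"
    and van: "\<And>x. x \<in> N \<Longrightarrow> f x = \<zero>\<^bsub>Q\<^esub>"
  shows "x \<in> carrier M \<Longrightarrow> quot_lift f (N +>\<^bsub>M\<^esub> x) = f x"
    and "quot_lift f \<in> module_hom R (quot_module M N) Q"
proof -
  interpret M: module R M by fact
  interpret Q: module R Q by fact
  interpret N: submodule N R M by fact
  have e: "quot_lift f (N +>\<^bsub>M\<^esub> x) = f x" if x: "x \<in> carrier M" for x
  proof -
    have "f (h \<oplus>\<^bsub>M\<^esub> x) = f x" if "h \<in> N" for h
    proof -
      have h: "h \<in> carrier M" using that N.subset by auto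
      show ?thesis using module_homD(2)[OF assms(3) h x] van[OF that] module_homD(1)[OF assms(3) x] by simp
    qed
    moreover have "\<zero>\<^bsub>M\<^esub> \<in> N" using N.one_closed by simp
    ultimately have "f ` (N +>\<^bsub>M\<^esub> x) = {f x}" unfolding a_r_coset_def' image_UN by auto
    then show ?thesis by (simp add: quot_lift_def)
  qed
  then show "x \<in> carrier M \<Longrightarrow> quot_lift f (N +>\<^bsub>M\<^esub> x) = f x" .
  note q = quot_module[OF assms(1,4)]
  show "quot_lift f \<in> module_hom R (quot_module M N) Q"
  proof (rule module_homI)
    fix u assume "u \<in> carrier (quot_module M N)"
    then obtain x where x: "x \<in> carrier M" "u = N +>\<^bsub>M\<^esub> x" using q(3) by auto
    show "quot_lift f u \<in> carrier Q" using x e module_homD(1)[OF assms(3)] by simp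
    show "quot_lift f (r \<odot>\<^bsub>quot_module M N\<^esub> u) = r \<odot>\<^bsub>Q\<^esub> quot_lift f u" if r: "r \<in> carrier R" for r
      using module_homD(3)[OF q(2) r x(1)] module_homD(3)[OF assms(3) r x(1)] e[OF x(1)]
        e[OF M.smult_closed[OF r x(1)]] x(2) by simp
    fix v assume "v \<in> carrier (quot_module M N)"
    then obtain y where y: "y \<in> carrier M" "v = N +>\<^bsub>M\<^esub> y" using q(3) by auto
    show "quot_lift f (u \<oplus>\<^bsub>quot_module M N\<^esub> v) = quot_lift f u \<oplus>\<^bsub>Q\<^esub> quot_lift f v"
      using module_homD(2)[OF q(2) x(1) y(1)] module_homD(2)[OF assms(3) x(1) y(1)] e[OF x(1)] e[OF y(1)]
        e[OF M.a_closed[OF x(1) y(1)]] x(2) y(2) by simp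
  qed
qed

lemma free_module_simps:
  "\<zero>\<^bsub>free_module R S\<^esub> = (\<lambda>_. \<zero>\<^bsub>R\<^esub>)"
  "f \<oplus>\<^bsub>free_module R S\<^esub> g = (\<lambda>x. f x \<oplus>\<^bsub>R\<^esub> g x)"
  "r \<odot>\<^bsub>free_module R S\<^esub> f = (\<lambda>x. r \<otimes>\<^bsub>R\<^esub> f x)"
  by (simp_all add: free_module_def)

lemma free_module_carrierI:
  assumes "\<And>x. x \<in> S \<Longrightarrow> f x \<in> carrier R" "\<And>x. x \<notin> S \<Longrightarrow> f x = \<zero>\<^bsub>R\<^esub>" "finite {x. f x \<noteq> \<zero>\<^bsub>R\<^esub>}"
  shows "f \<in> carrier (free_module R S)"
  using assms by (simp add: free_module_def)

lemma free_module_carrierD: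
  assumes "cring R" "f \<in> carrier (free_module R S)"
  shows "f x \<in> carrier R" "x \<notin> S \<Longrightarrow> f x = \<zero>\<^bsub>R\<^esub>" "finite {x. f x \<noteq> \<zero>\<^bsub>R\<^esub>}" "{x. f x \<noteq> \<zero>\<^bsub>R\<^esub>} \<subseteq> S"
proof -
  interpret R: cring R by fact
  show "x \<notin> S \<Longrightarrow> f x = \<zero>\<^bsub>R\<^esub>" "finite {x. f x \<noteq> \<zero>\<^bsub>R\<^esub>}" "{x. f x \<noteq> \<zero>\<^bsub>R\<^esub>} \<subseteq> S"
    using assms(2) unfolding free_module_def by auto
  show "f x \<in> carrier R"
    using assms(2) R.zero_closed unfolding free_module_def by (cases "x \<in> S") simp_all
qed

lemma free_module_module:
  assumes R: "cring R" shows "module R (free_module R S)"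
proof -
  interpret R: cring R by fact
  let ?F = "free_module R S"
  note D = free_module_carrierD[OF R]
  have add: "f \<oplus>\<^bsub>?F\<^esub> g \<in> carrier ?F" if f: "f \<in> carrier ?F" and g: "g \<in> carrier ?F" for f g
    unfolding free_module_simps
  proof (rule free_module_carrierI)
    show "finite {x. f x \<oplus>\<^bsub>R\<^esub> g x \<noteq> \<zero>\<^bsub>R\<^esub>}"
      by (rule finite_subset[OF _ finite_UnI[OF D(3)[OF f] D(3)[OF g]]]) auto
  qed (simp_all add: D(1,2)[OF f] D(1,2)[OF g])
  have smult: "r \<odot>\<^bsub>?F\<^esub> f \<in> carrier ?F" if f: "f \<in> carrier ?F" and r: "r \<in> carrier R" for r f
    unfolding free_module_simps
  proof (rule free_module_carrierI)
    show "finite {x. r \<otimes>\<^bsub>R\<^esub> f x \<noteq> \<zero>\<^bsub>R\<^esub>}"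
      by (rule finite_subset[OF _ D(3)[OF f]]) (use r in auto)
  qed (simp_all add: D(1,2)[OF f] r)
  have neg: "(\<lambda>x. \<ominus>\<^bsub>R\<^esub> f x) \<in> carrier ?F" if f: "f \<in> carrier ?F" for f
  proof (rule free_module_carrierI)
    show "finite {x. \<ominus>\<^bsub>R\<^esub> f x \<noteq> \<zero>\<^bsub>R\<^esub>}"
      by (rule finite_subset[OF _ D(3)[OF f]]) auto
  qed (simp_all add: D(1,2)[OF f])
  have ab: "abelian_group ?F"
  proof (rule abelian_groupI)
    show "\<zero>\<^bsub>?F\<^esub> \<in> carrier ?F" unfolding free_module_simps by (rule free_module_carrierI) simp_all
  next
    fix f assume f: "f \<in> carrier ?F"
    show "\<exists>g\<in>carrier ?F. g \<oplus>\<^bsub>?F\<^esub> f = \<zero>\<^bsub>?F\<^esub>"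
      by (rule bexI[OF _ neg[OF f]]) (simp add: free_module_simps R.l_neg D(1)[OF f])
    show "\<zero>\<^bsub>?F\<^esub> \<oplus>\<^bsub>?F\<^esub> f = f" by (simp add: free_module_simps D(1)[OF f])
    fix g assume g: "g \<in> carrier ?F"
    show "f \<oplus>\<^bsub>?F\<^esub> g = g \<oplus>\<^bsub>?F\<^esub> f"
      by (simp add: free_module_simps D(1)[OF f] D(1)[OF g] R.a_comm)
    fix h assume h: "h \<in> carrier ?F"
    show "f \<oplus>\<^bsub>?F\<^esub> g \<oplus>\<^bsub>?F\<^esub> h = f \<oplus>\<^bsub>?F\<^esub> (g \<oplus>\<^bsub>?F\<^esub> h)"
      by (simp add: free_module_simps D(1)[OF f] D(1)[OF g] D(1)[OF h] R.a_assoc)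
  qed (rule add)
  show ?thesis
  proof (rule moduleI)
    fix f assume f: "f \<in> carrier ?F"
    show "\<one>\<^bsub>R\<^esub> \<odot>\<^bsub>?F\<^esub> f = f" by (simp add: free_module_simps D(1)[OF f])
    fix a assume a: "a \<in> carrier R"
    show "a \<odot>\<^bsub>?F\<^esub> f \<in> carrier ?F" by (rule smult[OF f a])
    show "a \<odot>\<^bsub>?F\<^esub> (f \<oplus>\<^bsub>?F\<^esub> g) = a \<odot>\<^bsub>?F\<^esub> f \<oplus>\<^bsub>?F\<^esub> a \<odot>\<^bsub>?F\<^esub> g" if g: "g \<in> carrier ?F" for g
      by (simp add: free_module_simps D(1)[OF f] D(1)[OF g] a R.r_distr)
    fix b assume b: "b \<in> carrier R"
    show "(a \<oplus>\<^bsub>R\<^esub> b) \<odot>\<^bsub>?F\<^esub> f = a \<odot>\<^bsub>?F\<^esub> f \<oplus>\<^bsub>?F\<^esub> b \<odot>\<^bsub>?F\<^esub> f"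
      by (simp add: free_module_simps D(1)[OF f] a b R.l_distr)
    show "a \<otimes>\<^bsub>R\<^esub> b \<odot>\<^bsub>?F\<^esub> f = a \<odot>\<^bsub>?F\<^esub> (b \<odot>\<^bsub>?F\<^esub> f)"
      by (simp add: free_module_simps D(1)[OF f] a b R.m_assoc)
  qed (rule R ab)+
qed

lemma free_gen_closed:
  assumes "cring R" "x \<in> S" shows "free_gen R x \<in> carrier (free_module R S)"
proof -
  interpret R: cring R by fact
  show ?thesis
  proof (rule free_module_carrierI)
    have "{y. free_gen R x y \<noteq> \<zero>\<^bsub>R\<^esub>} \<subseteq> {x}"
      by (auto simp: free_gen_def split: if_splits)
    then show "finite {y. free_gen R x y \<noteq> \<zero>\<^bsub>R\<^esub>}" by (rule finite_subset) simp
  qed (use assms(2) in \<open>auto simp: free_gen_def\<close>)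
qed

lemma free_lift:
  assumes "module R Q" and \<phi>: "\<And>x. x \<in> S \<Longrightarrow> \<phi> x \<in> carrier Q"
  shows "x \<in> S \<Longrightarrow> free_lift R Q \<phi> (free_gen R x) = \<phi> x"
    and "free_lift R Q \<phi> \<in> module_hom R (free_module R S) Q"
proof -
  interpret Q: module R Q by fact
  let ?F = "free_module R S"
  have R: "cring R" by (rule Q.R.is_cring)
  note D = free_module_carrierD[OF R]
  have ft: "f x \<odot>\<^bsub>Q\<^esub> \<phi> x \<in> carrier Q" if "f \<in> carrier ?F" "x \<in> S" for f x
    using D(1)[OF that(1)] \<phi>[OF that(2)] by simp
  have sup: "free_lift R Q \<phi> f = (\<Oplus>\<^bsub>Q\<^esub>x\<in>T. f x \<odot>\<^bsub>Q\<^esub> \<phi> x)"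
    if f: "f \<in> carrier ?F" and T: "finite T" "T \<subseteq> S" "{x. f x \<noteq> \<zero>\<^bsub>R\<^esub>} \<subseteq> T" for f T
    unfolding free_lift_def
  proof (rule Q.add.finprod_mono_neutral_cong_left[OF T(1,3)])
    fix i assume "i \<in> T - {x. f x \<noteq> \<zero>\<^bsub>R\<^esub>}"
    then have "i \<in> S" "f i = \<zero>\<^bsub>R\<^esub>" using T(2) by blast+
    then show "f i \<odot>\<^bsub>Q\<^esub> \<phi> i = \<zero>\<^bsub>Q\<^esub>" using \<phi> by simp
  next
    show "(\<lambda>i. f i \<odot>\<^bsub>Q\<^esub> \<phi> i) \<in> T \<rightarrow> carrier Q" using T(2) ft[OF f] by blast
  qed (rule refl)
  interpret F: module R ?F by (rule free_module_module[OF R])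
  show "free_lift R Q \<phi> (free_gen R x) = \<phi> x" if x: "x \<in> S"
  proof -
    have "free_lift R Q \<phi> (free_gen R x) = (\<Oplus>\<^bsub>Q\<^esub>y\<in>{x}. free_gen R x y \<odot>\<^bsub>Q\<^esub> \<phi> y)"
      by (rule sup[OF free_gen_closed[OF R x]]) (use x in \<open>auto simp: free_gen_def split: if_splits\<close>)
    then show ?thesis using \<phi>[OF x] by (simp add: free_gen_def)
  qed
  show "free_lift R Q \<phi> \<in> module_hom R ?F Q"
  proof (rule module_homI)
    fix f assume f: "f \<in> carrier ?F"
    let ?T = "{x. f x \<noteq> \<zero>\<^bsub>R\<^esub>}"
    have ftT: "(\<lambda>x. f x \<odot>\<^bsub>Q\<^esub> \<phi> x) \<in> ?T \<rightarrow> carrier Q" using D(4)[OF f] ft[OF f] by blast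
    show "free_lift R Q \<phi> f \<in> carrier Q"
      unfolding free_lift_def by (rule Q.finsum_closed[OF ftT])
    fix r assume r: "r \<in> carrier R"
    have "free_lift R Q \<phi> (r \<odot>\<^bsub>?F\<^esub> f) = (\<Oplus>\<^bsub>Q\<^esub>x\<in>?T. (r \<odot>\<^bsub>?F\<^esub> f) x \<odot>\<^bsub>Q\<^esub> \<phi> x)"
      by (rule sup[OF F.smult_closed[OF r f] D(3)[OF f] D(4)[OF f]]) (use r in \<open>auto simp: free_module_simps\<close>)
    also have "\<dots> = (\<Oplus>\<^bsub>Q\<^esub>x\<in>?T. r \<odot>\<^bsub>Q\<^esub> (f x \<odot>\<^bsub>Q\<^esub> \<phi> x))"
    proof (rule Q.finsum_cong'[OF refl])
      show "(\<lambda>x. r \<odot>\<^bsub>Q\<^esub> (f x \<odot>\<^bsub>Q\<^esub> \<phi> x)) \<in> ?T \<rightarrow> carrier Q" using ftT r by (simp add: Pi_iff)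
      fix x assume "x \<in> ?T"
      then have "x \<in> S" using D(4)[OF f] by blast
      then show "(r \<odot>\<^bsub>?F\<^esub> f) x \<odot>\<^bsub>Q\<^esub> \<phi> x = r \<odot>\<^bsub>Q\<^esub> (f x \<odot>\<^bsub>Q\<^esub> \<phi> x)"
        by (simp add: free_module_simps Q.smult_assoc1 r D(1)[OF f] \<phi>)
    qed
    also have "\<dots> = r \<odot>\<^bsub>Q\<^esub> free_lift R Q \<phi> f"
      unfolding free_lift_def by (rule Q.finsum_smult_ldistr[symmetric, OF D(3)[OF f] r ftT])
    finally show "free_lift R Q \<phi> (r \<odot>\<^bsub>?F\<^esub> f) = r \<odot>\<^bsub>Q\<^esub> free_lift R Q \<phi> f" .
  next
    fix f g assume f: "f \<in> carrier ?F" and g: "g \<in> carrier ?F"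
    let ?T = "{x. f x \<noteq> \<zero>\<^bsub>R\<^esub>} \<union> {x. g x \<noteq> \<zero>\<^bsub>R\<^esub>}"
    have T: "finite ?T" "?T \<subseteq> S" using D(3,4)[OF f] D(3,4)[OF g] by blast+
    have fT: "(\<lambda>x. f x \<odot>\<^bsub>Q\<^esub> \<phi> x) \<in> ?T \<rightarrow> carrier Q" "(\<lambda>x. g x \<odot>\<^bsub>Q\<^esub> \<phi> x) \<in> ?T \<rightarrow> carrier Q"
      using T(2) ft[OF f] ft[OF g] by blast+
    have "free_lift R Q \<phi> (f \<oplus>\<^bsub>?F\<^esub> g) = (\<Oplus>\<^bsub>Q\<^esub>x\<in>?T. (f \<oplus>\<^bsub>?F\<^esub> g) x \<odot>\<^bsub>Q\<^esub> \<phi> x)"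
      by (rule sup[OF F.a_closed[OF f g] T]) (auto simp: free_module_simps)
    also have "\<dots> = (\<Oplus>\<^bsub>Q\<^esub>x\<in>?T. f x \<odot>\<^bsub>Q\<^esub> \<phi> x \<oplus>\<^bsub>Q\<^esub> g x \<odot>\<^bsub>Q\<^esub> \<phi> x)"
    proof (rule Q.finsum_cong'[OF refl])
      show "(\<lambda>x. f x \<odot>\<^bsub>Q\<^esub> \<phi> x \<oplus>\<^bsub>Q\<^esub> g x \<odot>\<^bsub>Q\<^esub> \<phi> x) \<in> ?T \<rightarrow> carrier Q"
        using fT by (simp add: Pi_iff)
      fix x assume "x \<in> ?T"
      then have "x \<in> S" using T(2) by blast
      then show "(f \<oplus>\<^bsub>?F\<^esub> g) x \<odot>\<^bsub>Q\<^esub> \<phi> x = f x \<odot>\<^bsub>Q\<^esub> \<phi> x \<oplus>\<^bsub>Q\<^esub> g x \<odot>\<^bsub>Q\<^esub> \<phi> x"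
        by (simp add: free_module_simps Q.smult_l_distr D(1)[OF f] D(1)[OF g] \<phi>)
    qed
    also have "\<dots> = (\<Oplus>\<^bsub>Q\<^esub>x\<in>?T. f x \<odot>\<^bsub>Q\<^esub> \<phi> x) \<oplus>\<^bsub>Q\<^esub> (\<Oplus>\<^bsub>Q\<^esub>x\<in>?T. g x \<odot>\<^bsub>Q\<^esub> \<phi> x)"
      by (rule Q.finsum_addf[OF fT])
    also have "\<dots> = free_lift R Q \<phi> f \<oplus>\<^bsub>Q\<^esub> free_lift R Q \<phi> g"
      using sup[OF f T] sup[OF g T] by simp
    finally show "free_lift R Q \<phi> (f \<oplus>\<^bsub>?F\<^esub> g) = free_lift R Q \<phi> f \<oplus>\<^bsub>Q\<^esub> free_lift R Q \<phi> g" .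
  qed
qed

lemma presented_lift:
  assumes Q: "module R Q" and \<phi>: "\<And>x. x \<in> S \<Longrightarrow> \<phi> x \<in> carrier Q"
    and T: "T \<subseteq> carrier (free_module R S)"
    and van: "\<And>t. t \<in> T \<Longrightarrow> free_lift R Q \<phi> t = \<zero>\<^bsub>Q\<^esub>"
  defines "K \<equiv> submodule_span R (free_module R S) T"
  shows "x \<in> S \<Longrightarrow> quot_lift (free_lift R Q \<phi>) (K +>\<^bsub>free_module R S\<^esub> free_gen R x) = \<phi> x"
    and "quot_lift (free_lift R Q \<phi>) \<in> module_hom R (quot_module (free_module R S) K) Q"
proof -
  interpret Q: module R Q by fact
  have R: "cring R" by (rule Q.R.is_cring)
  note F = free_module_module[OF R, of S]
  have hom: "free_lift R Q \<phi> \<in> module_hom R (free_module R S) Q"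
    by (rule free_lift(2)[OF Q \<phi>])
  note K = submodule_span(1)[OF F T, folded K_def]
  have vK: "free_lift R Q \<phi> t = \<zero>\<^bsub>Q\<^esub>" if "t \<in> K" for t
    using submodule_span_vanish[OF F Q hom T van] that unfolding K_def by blast
  show "quot_lift (free_lift R Q \<phi>) \<in> module_hom R (quot_module (free_module R S) K) Q"
    by (rule quot_lift(2)[OF F Q hom K vK])
  show "quot_lift (free_lift R Q \<phi>) (K +>\<^bsub>free_module R S\<^esub> free_gen R x) = \<phi> x" if x: "x \<in> S"
  proof -
    have "free_lift R Q \<phi> (free_gen R x) = \<phi> x" by (rule free_lift(1)[OF Q \<phi> x])
    then show ?thesis using quot_lift(1)[OF F Q hom K vK free_gen_closed[OF R x]] by simp
  qed
qed

lemma free_lift_rel: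
  assumes Q: "module R Q" and \<phi>: "\<And>x. x \<in> S \<Longrightarrow> \<phi> x \<in> carrier Q" and xyz: "x \<in> S" "y \<in> S"
  shows "z \<in> S \<Longrightarrow> \<phi> x = \<phi> y \<oplus>\<^bsub>Q\<^esub> \<phi> z \<Longrightarrow> free_lift R Q \<phi>
    (free_gen R x \<ominus>\<^bsub>free_module R S\<^esub> (free_gen R y \<oplus>\<^bsub>free_module R S\<^esub> free_gen R z)) = \<zero>\<^bsub>Q\<^esub>"
  and "r \<in> carrier R \<Longrightarrow> \<phi> x = r \<odot>\<^bsub>Q\<^esub> \<phi> y \<Longrightarrow> free_lift R Q \<phi>
    (free_gen R x \<ominus>\<^bsub>free_module R S\<^esub> (r \<odot>\<^bsub>free_module R S\<^esub> free_gen R y)) = \<zero>\<^bsub>Q\<^esub>"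
proof -
  interpret Q: module R Q by fact
  have R: "cring R" by (rule Q.R.is_cring)
  note FM = free_module_module[OF R, of S]
  interpret F: module R "free_module R S" by (rule FM)
  have hom: "free_lift R Q \<phi> \<in> module_hom R (free_module R S) Q"
    by (rule free_lift(2)[OF Q \<phi>])
  have v: "free_lift R Q \<phi> (free_gen R x) = \<phi> x" if "x \<in> S" for x
    by (rule free_lift(1)[OF Q \<phi> that])
  note g = free_gen_closed[OF R]
  note mm = module_hom_minus[OF FM Q hom]
  show "free_lift R Q \<phi>
    (free_gen R x \<ominus>\<^bsub>free_module R S\<^esub> (free_gen R y \<oplus>\<^bsub>free_module R S\<^esub> free_gen R z)) = \<zero>\<^bsub>Q\<^esub>"
    if z: "z \<in> S" and e: "\<phi> x = \<phi> y \<oplus>\<^bsub>Q\<^esub> \<phi> z"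
    using mm[OF g[OF xyz(1)] F.a_closed[OF g[OF xyz(2)] g[OF z]]]
      module_homD(2)[OF hom g[OF xyz(2)] g[OF z]] v[OF xyz(1)] v[OF xyz(2)] v[OF z] e
      \<phi>[OF xyz(1)] Q.r_neg by (simp add: a_minus_def)
  show "free_lift R Q \<phi>
    (free_gen R x \<ominus>\<^bsub>free_module R S\<^esub> (r \<odot>\<^bsub>free_module R S\<^esub> free_gen R y)) = \<zero>\<^bsub>Q\<^esub>"
    if r: "r \<in> carrier R" and e: "\<phi> x = r \<odot>\<^bsub>Q\<^esub> \<phi> y"
    using mm[OF g[OF xyz(1)] F.smult_closed[OF r g[OF xyz(2)]]]
      module_homD(3)[OF hom r g[OF xyz(2)]] v[OF xyz(1)] v[OF xyz(2)] e
      \<phi>[OF xyz(1)] Q.r_neg by (simp add: a_minus_def)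
qed

lemma free_rel_closed:
  assumes R: "cring R" and xyz: "x \<in> S" "y \<in> S"
  shows "z \<in> S \<Longrightarrow> free_gen R x \<ominus>\<^bsub>free_module R S\<^esub> (free_gen R y \<oplus>\<^bsub>free_module R S\<^esub> free_gen R z)
      \<in> carrier (free_module R S)"
    and "r \<in> carrier R \<Longrightarrow> free_gen R x \<ominus>\<^bsub>free_module R S\<^esub> (r \<odot>\<^bsub>free_module R S\<^esub> free_gen R y)
      \<in> carrier (free_module R S)"
proof -
  interpret F: module R "free_module R S" by (rule free_module_module[OF R])
  note g = free_gen_closed[OF R]
  show "z \<in> S \<Longrightarrow> free_gen R x \<ominus>\<^bsub>free_module R S\<^esub> (free_gen R y \<oplus>\<^bsub>free_module R S\<^esub> free_gen R z)
      \<in> carrier (free_module R S)"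
    by (intro F.minus_closed F.a_closed g xyz)
  show "r \<in> carrier R \<Longrightarrow> free_gen R x \<ominus>\<^bsub>free_module R S\<^esub> (r \<odot>\<^bsub>free_module R S\<^esub> free_gen R y)
      \<in> carrier (free_module R S)"
    by (intro F.minus_closed F.smult_closed g xyz)
qed

lemma tensor_rels_closed:
  assumes "module R M" "module R N"
  shows "tensor_rels R M N \<subseteq> carrier (free_module R (carrier M \<times> carrier N))"
proof -
  interpret M: module R M by fact
  interpret N: module R N by fact
  note R = M.R.is_cring
  show ?thesis
    unfolding tensor_rels_def Let_def
    by (intro Un_least subsetI; elim CollectE exE conjE; hypsubst;
        intro free_rel_closed[OF R] SigmaI M.a_closed N.a_closed M.smult_closed N.smult_closed)
qed

lemma tensor_module:
  assumes "module R M" "module R N"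
  shows "module R (tensor R M N)"
    and "x \<in> carrier M \<Longrightarrow> y \<in> carrier N \<Longrightarrow> tensor_elem R M N x y \<in> carrier (tensor R M N)"
proof -
  interpret M: module R M by fact
  note R = M.R.is_cring
  note F = free_module_module[OF R, of "carrier M \<times> carrier N"]
  note K = submodule_span(1)[OF F tensor_rels_closed[OF assms], folded tensor_kernel_def]
  show "module R (tensor R M N)" unfolding tensor_def by (rule quot_module(1)[OF F K])
  show "x \<in> carrier M \<Longrightarrow> y \<in> carrier N \<Longrightarrow> tensor_elem R M N x y \<in> carrier (tensor R M N)"
    unfolding tensor_def tensor_elem_def quot_module(3)[OF F K]
    by (intro imageI free_gen_closed[OF R] SigmaI)
qed

lemma tensor_lift:
  assumes M: "module R M" and N: "module R N" and Q: "module R Q"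
    and cl: "\<And>x y. x \<in> carrier M \<Longrightarrow> y \<in> carrier N \<Longrightarrow> \<beta> x y \<in> carrier Q"
    and al: "\<And>x x' y. x \<in> carrier M \<Longrightarrow> x' \<in> carrier M \<Longrightarrow> y \<in> carrier N \<Longrightarrow>
        \<beta> (x \<oplus>\<^bsub>M\<^esub> x') y = \<beta> x y \<oplus>\<^bsub>Q\<^esub> \<beta> x' y"
    and ar: "\<And>x y y'. x \<in> carrier M \<Longrightarrow> y \<in> carrier N \<Longrightarrow> y' \<in> carrier N \<Longrightarrow>
        \<beta> x (y \<oplus>\<^bsub>N\<^esub> y') = \<beta> x y \<oplus>\<^bsub>Q\<^esub> \<beta> x y'"
    and sl: "\<And>r x y. r \<in> carrier R \<Longrightarrow> x \<in> carrier M \<Longrightarrow> y \<in> carrier N \<Longrightarrow>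
        \<beta> (r \<odot>\<^bsub>M\<^esub> x) y = r \<odot>\<^bsub>Q\<^esub> \<beta> x y"
    and sr: "\<And>r x y. r \<in> carrier R \<Longrightarrow> x \<in> carrier M \<Longrightarrow> y \<in> carrier N \<Longrightarrow>
        \<beta> x (r \<odot>\<^bsub>N\<^esub> y) = r \<odot>\<^bsub>Q\<^esub> \<beta> x y"
  shows "x \<in> carrier M \<Longrightarrow> y \<in> carrier N \<Longrightarrow> tensor_lift R Q \<beta> (tensor_elem R M N x y) = \<beta> x y"
    and "tensor_lift R Q \<beta> \<in> module_hom R (tensor R M N) Q"
proof -
  interpret M: module R M by fact
  interpret N: module R N by fact
  let ?S = "carrier M \<times> carrier N" and ?\<phi> = "\<lambda>(x, y). \<beta> x y"
  have \<phi>: "?\<phi> z \<in> carrier Q" if "z \<in> ?S" for z using that cl by auto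
  have van: "free_lift R Q ?\<phi> t = \<zero>\<^bsub>Q\<^esub>" if "t \<in> tensor_rels R M N" for t
    using that unfolding tensor_rels_def Let_def
    by (elim UnE; elim CollectE exE conjE; hypsubst; intro free_lift_rel[OF Q, of ?S ?\<phi>] \<phi> SigmaI; assumption?)
      (simp_all add: al ar sl sr)
  note p = presented_lift[OF Q, of ?S ?\<phi> "tensor_rels R M N", folded tensor_kernel_def]
  show "tensor_lift R Q \<beta> \<in> module_hom R (tensor R M N) Q"
    unfolding tensor_lift_def tensor_def by (rule p(2)[OF \<phi> tensor_rels_closed[OF M N] van])
  show "tensor_lift R Q \<beta> (tensor_elem R M N x y) = \<beta> x y" if "x \<in> carrier M" "y \<in> carrier N"
  proof -
    have "(x, y) \<in> ?S" using that by simp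
    from p(1)[OF \<phi> tensor_rels_closed[OF M N] van this]
    show ?thesis unfolding tensor_lift_def tensor_elem_def by simp
  qed
qed

lemma tuples_update: "as \<in> tuples M n \<Longrightarrow> x \<in> carrier M \<Longrightarrow> as[i := x] \<in> tuples M n"
  unfolding tuples_def using set_update_subset_insert[of as i x] by auto

lemma tpow_rels_closed:
  assumes "module R M"
  shows "tpow_rels R M n \<subseteq> carrier (free_module R (tuples M n))"
proof -
  interpret M: module R M by fact
  note R = M.R.is_cring
  show ?thesis
    unfolding tpow_rels_def Let_def
    by (intro Un_least subsetI; elim CollectE exE conjE; hypsubst;
        intro free_rel_closed[OF R] tuples_update M.a_closed M.smult_closed)
qed

lemma tpow_module:
  assumes "module R M"
  shows "module R (tpow R M n)"
    and "as \<in> tuples M n \<Longrightarrow> tpow_elem R M as \<in> carrier (tpow R M n)"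
proof -
  interpret M: module R M by fact
  note R = M.R.is_cring
  note F = free_module_module[OF R, of "tuples M n"]
  note K = submodule_span(1)[OF F tpow_rels_closed[OF assms], folded tpow_kernel_def]
  show "module R (tpow R M n)" unfolding tpow_def by (rule quot_module(1)[OF F K])
  show "tpow_elem R M as \<in> carrier (tpow R M n)" if as: "as \<in> tuples M n"
  proof -
    have "length as = n" using as by (simp add: tuples_def)
    then show ?thesis
      unfolding tpow_def tpow_elem_def quot_module(3)[OF F K]
      using free_gen_closed[OF R as] by simp
  qed
qed

lemma tpow_lift:
  assumes M: "module R M" and Q: "module R Q"
    and cl: "\<And>as. as \<in> tuples M n \<Longrightarrow> \<mu> as \<in> carrier Q"
    and add: "\<And>as i x y. as \<in> tuples M n \<Longrightarrow> i < n \<Longrightarrow> x \<in> carrier M \<Longrightarrow> y \<in> carrier M \<Longrightarrow>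
        \<mu> (as[i := x \<oplus>\<^bsub>M\<^esub> y]) = \<mu> (as[i := x]) \<oplus>\<^bsub>Q\<^esub> \<mu> (as[i := y])"
    and smult: "\<And>as i r x. as \<in> tuples M n \<Longrightarrow> i < n \<Longrightarrow> r \<in> carrier R \<Longrightarrow> x \<in> carrier M \<Longrightarrow>
        \<mu> (as[i := r \<odot>\<^bsub>M\<^esub> x]) = r \<odot>\<^bsub>Q\<^esub> \<mu> (as[i := x])"
  shows "as \<in> tuples M n \<Longrightarrow> tpow_lift R Q \<mu> (tpow_elem R M as) = \<mu> as"
    and "tpow_lift R Q \<mu> \<in> module_hom R (tpow R M n) Q"
proof -
  interpret M: module R M by fact
  have van: "free_lift R Q \<mu> t = \<zero>\<^bsub>Q\<^esub>" if "t \<in> tpow_rels R M n" for t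
    using that unfolding tpow_rels_def Let_def
    by (elim UnE; elim CollectE exE conjE; hypsubst; intro free_lift_rel[OF Q, of "tuples M n" \<mu>] cl tuples_update; assumption?)
      (simp_all add: add smult)
  note p = presented_lift[OF Q, of "tuples M n" \<mu> "tpow_rels R M n", folded tpow_kernel_def]
  show "tpow_lift R Q \<mu> \<in> module_hom R (tpow R M n) Q"
    unfolding tpow_lift_def tpow_def by (rule p(2)[OF cl tpow_rels_closed[OF M] van])
  show "tpow_lift R Q \<mu> (tpow_elem R M as) = \<mu> as" if "as \<in> tuples M n"
  proof -
    have "length as = n" using that by (simp add: tuples_def)
    then show ?thesis unfolding tpow_lift_def tpow_elem_def using p(1)[OF cl tpow_rels_closed[OF M] van that] by simp
  qed
qed

lemma quot_eq:
  assumes M: "module R M" and N: "submodule N R M" and x: "x \<in> carrier M" and y: "y \<in> carrier M"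
    and d: "x \<ominus>\<^bsub>M\<^esub> y \<in> N"
  shows "N +>\<^bsub>M\<^esub> x = N +>\<^bsub>M\<^esub> y"
proof -
  interpret M: module R M by fact
  interpret N: submodule N R M by fact
  interpret N: abelian_subgroup N M
    by (rule abelian_subgroupI3) (auto intro: additive_subgroup.intro N.subgroup_axioms M.abelian_group_axioms)
  have "x = (x \<ominus>\<^bsub>M\<^esub> y) \<oplus>\<^bsub>M\<^esub> y"
    using x y by (simp add: a_minus_def M.a_assoc M.l_neg)
  then have "x \<in> N +>\<^bsub>M\<^esub> y" using d unfolding a_r_coset_def' by blast
  then show ?thesis using N.a_repr_independence' y by blast
qed

lemma presented_rel:
  assumes R: "cring R" and T: "T \<subseteq> carrier (free_module R S)"
    and xy: "x \<in> S" "y \<in> S"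
  defines "K \<equiv> submodule_span R (free_module R S) T"
  defines "e \<equiv> (\<lambda>x. K +>\<^bsub>free_module R S\<^esub> free_gen R x)"
  shows "z \<in> S \<Longrightarrow> free_gen R x \<ominus>\<^bsub>free_module R S\<^esub>
        (free_gen R y \<oplus>\<^bsub>free_module R S\<^esub> free_gen R z) \<in> T \<Longrightarrow>
      e x = e y \<oplus>\<^bsub>quot_module (free_module R S) K\<^esub> e z"
    and "r \<in> carrier R \<Longrightarrow> free_gen R x \<ominus>\<^bsub>free_module R S\<^esub>
        (r \<odot>\<^bsub>free_module R S\<^esub> free_gen R y) \<in> T \<Longrightarrow>
      e x = r \<odot>\<^bsub>quot_module (free_module R S) K\<^esub> e y"
proof -
  note FM = free_module_module[OF R, of S]
  interpret F: module R "free_module R S" by (rule FM)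
  note K = submodule_span[OF FM T, folded K_def]
  note q = quot_module(2)[OF FM K(1)]
  note g = free_gen_closed[OF R]
  show "e x = e y \<oplus>\<^bsub>quot_module (free_module R S) K\<^esub> e z"
    if z: "z \<in> S" and t: "free_gen R x \<ominus>\<^bsub>free_module R S\<^esub>
        (free_gen R y \<oplus>\<^bsub>free_module R S\<^esub> free_gen R z) \<in> T"
    using quot_eq[OF FM K(1) g[OF xy(1)] F.a_closed[OF g[OF xy(2)] g[OF z]] subsetD[OF K(2) t]]
      module_homD(2)[OF q g[OF xy(2)] g[OF z]] unfolding e_def by simp
  show "e x = r \<odot>\<^bsub>quot_module (free_module R S) K\<^esub> e y"
    if r: "r \<in> carrier R" and t: "free_gen R x \<ominus>\<^bsub>free_module R S\<^esub>
        (r \<odot>\<^bsub>free_module R S\<^esub> free_gen R y) \<in> T"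
    using quot_eq[OF FM K(1) g[OF xy(1)] F.smult_closed[OF r g[OF xy(2)]] subsetD[OF K(2) t]]
      module_homD(3)[OF q r g[OF xy(2)]] unfolding e_def by simp
qed

lemma tpow_elem_multilinear:
  assumes M: "module R M" and as: "as \<in> tuples M n" "i < n" and x: "x \<in> carrier M"
  shows "y \<in> carrier M \<Longrightarrow>
      tpow_elem R M (as[i := x \<oplus>\<^bsub>M\<^esub> y]) =
        tpow_elem R M (as[i := x]) \<oplus>\<^bsub>tpow R M n\<^esub> tpow_elem R M (as[i := y])"
    and "r \<in> carrier R \<Longrightarrow>
      tpow_elem R M (as[i := r \<odot>\<^bsub>M\<^esub> x]) = r \<odot>\<^bsub>tpow R M n\<^esub> tpow_elem R M (as[i := x])"
proof -
  interpret M: module R M by fact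
  note R = M.R.is_cring
  have l: "length as = n" using as by (simp add: tuples_def)
  note rel = presented_rel[OF R tpow_rels_closed[OF M, of n], folded tpow_kernel_def, folded tpow_def]
  note u = tuples_update[OF as(1)]
  show "tpow_elem R M (as[i := x \<oplus>\<^bsub>M\<^esub> y]) =
        tpow_elem R M (as[i := x]) \<oplus>\<^bsub>tpow R M n\<^esub> tpow_elem R M (as[i := y])" if y: "y \<in> carrier M"
    unfolding tpow_elem_def length_list_update l
    by (rule rel(1)[OF u[OF M.a_closed[OF x y]] u[OF x] u[OF y]])
      (use as x y in \<open>unfold tpow_rels_def Let_def, blast\<close>)
  show "tpow_elem R M (as[i := r \<odot>\<^bsub>M\<^esub> x]) = r \<odot>\<^bsub>tpow R M n\<^esub> tpow_elem R M (as[i := x])"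
    if r: "r \<in> carrier R"
    unfolding tpow_elem_def length_list_update l
    by (rule rel(2)[OF u[OF M.smult_closed[OF r x]] u[OF x] r])
      (use as x r in \<open>unfold tpow_rels_def Let_def, blast\<close>)
qed

lemma tensor_elem_bilinear:
  assumes M: "module R M" and N: "module R N" and x: "x \<in> carrier M" and y: "y \<in> carrier N"
  shows "x' \<in> carrier M \<Longrightarrow>
      tensor_elem R M N (x \<oplus>\<^bsub>M\<^esub> x') y =
        tensor_elem R M N x y \<oplus>\<^bsub>tensor R M N\<^esub> tensor_elem R M N x' y"
    and "y' \<in> carrier N \<Longrightarrow>
      tensor_elem R M N x (y \<oplus>\<^bsub>N\<^esub> y') =
        tensor_elem R M N x y \<oplus>\<^bsub>tensor R M N\<^esub> tensor_elem R M N x y'"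
    and "r \<in> carrier R \<Longrightarrow>
      tensor_elem R M N (r \<odot>\<^bsub>M\<^esub> x) y = r \<odot>\<^bsub>tensor R M N\<^esub> tensor_elem R M N x y"
    and "r \<in> carrier R \<Longrightarrow>
      tensor_elem R M N x (r \<odot>\<^bsub>N\<^esub> y) = r \<odot>\<^bsub>tensor R M N\<^esub> tensor_elem R M N x y"
proof -
  interpret M: module R M by fact
  interpret N: module R N by fact
  note R = M.R.is_cring
  note rel = presented_rel[OF R tensor_rels_closed[OF M N], folded tensor_kernel_def, folded tensor_def]
  show "tensor_elem R M N (x \<oplus>\<^bsub>M\<^esub> x') y =
        tensor_elem R M N x y \<oplus>\<^bsub>tensor R M N\<^esub> tensor_elem R M N x' y" if "x' \<in> carrier M"
    unfolding tensor_elem_def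
    by (rule rel(1)) (use that x y in \<open>simp, simp, simp, unfold tensor_rels_def Let_def, blast\<close>)
  show "tensor_elem R M N x (y \<oplus>\<^bsub>N\<^esub> y') =
        tensor_elem R M N x y \<oplus>\<^bsub>tensor R M N\<^esub> tensor_elem R M N x y'" if "y' \<in> carrier N"
    unfolding tensor_elem_def
    by (rule rel(1)) (use that x y in \<open>simp, simp, simp, unfold tensor_rels_def Let_def, blast\<close>)
  show "tensor_elem R M N (r \<odot>\<^bsub>M\<^esub> x) y = r \<odot>\<^bsub>tensor R M N\<^esub> tensor_elem R M N x y"
    if "r \<in> carrier R"
    unfolding tensor_elem_def
    by (rule rel(2)) (use that x y in \<open>simp, simp, simp, unfold tensor_rels_def Let_def, blast\<close>)
  show "tensor_elem R M N x (r \<odot>\<^bsub>N\<^esub> y) = r \<odot>\<^bsub>tensor R M N\<^esub> tensor_elem R M N x y"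
    if "r \<in> carrier R"
    unfolding tensor_elem_def
    by (rule rel(2)) (use that x y in \<open>simp, simp, simp, unfold tensor_rels_def Let_def, blast\<close>)
qed

definition multilin ::
    "('k, 'r) ring_scheme \<Rightarrow> ('k, 'a, 's) module_scheme \<Rightarrow> nat
      \<Rightarrow> ('k, 'c, 't) module_scheme \<Rightarrow> ('a list \<Rightarrow> 'c) \<Rightarrow> bool"
  where
  "multilin R M n Q \<mu> \<longleftrightarrow>
    (\<forall>as\<in>tuples M n. \<mu> as \<in> carrier Q) \<and>
    (\<forall>as\<in>tuples M n. \<forall>i<n. \<forall>x\<in>carrier M. \<forall>y\<in>carrier M.
        \<mu> (as[i := x \<oplus>\<^bsub>M\<^esub> y]) = \<mu> (as[i := x]) \<oplus>\<^bsub>Q\<^esub> \<mu> (as[i := y])) \<and>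
    (\<forall>as\<in>tuples M n. \<forall>i<n. \<forall>r\<in>carrier R. \<forall>x\<in>carrier M.
        \<mu> (as[i := r \<odot>\<^bsub>M\<^esub> x]) = r \<odot>\<^bsub>Q\<^esub> \<mu> (as[i := x]))"

lemma multilinI:
  assumes "\<And>as. as \<in> tuples M n \<Longrightarrow> \<mu> as \<in> carrier Q"
    and "\<And>as i x y. as \<in> tuples M n \<Longrightarrow> i < n \<Longrightarrow> x \<in> carrier M \<Longrightarrow> y \<in> carrier M \<Longrightarrow>
        \<mu> (as[i := x \<oplus>\<^bsub>M\<^esub> y]) = \<mu> (as[i := x]) \<oplus>\<^bsub>Q\<^esub> \<mu> (as[i := y])"
    and "\<And>as i r x. as \<in> tuples M n \<Longrightarrow> i < n \<Longrightarrow> r \<in> carrier R \<Longrightarrow> x \<in> carrier M \<Longrightarrow>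
        \<mu> (as[i := r \<odot>\<^bsub>M\<^esub> x]) = r \<odot>\<^bsub>Q\<^esub> \<mu> (as[i := x])"
  shows "multilin R M n Q \<mu>"
  using assms unfolding multilin_def by blast

lemma multilinD:
  assumes "multilin R M n Q \<mu>" "as \<in> tuples M n"
  shows "\<mu> as \<in> carrier Q"
    and "i < n \<Longrightarrow> x \<in> carrier M \<Longrightarrow> y \<in> carrier M \<Longrightarrow>
        \<mu> (as[i := x \<oplus>\<^bsub>M\<^esub> y]) = \<mu> (as[i := x]) \<oplus>\<^bsub>Q\<^esub> \<mu> (as[i := y])"
    and "i < n \<Longrightarrow> r \<in> carrier R \<Longrightarrow> x \<in> carrier M \<Longrightarrow>
        \<mu> (as[i := r \<odot>\<^bsub>M\<^esub> x]) = r \<odot>\<^bsub>Q\<^esub> \<mu> (as[i := x])"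
  using assms unfolding multilin_def by blast+

lemma multilin_hom:
  assumes \<mu>: "multilin R M n P \<mu>" and f: "f \<in> module_hom R P Q"
  shows "multilin R M n Q (\<lambda>as. f (\<mu> as))"
proof (rule multilinI)
  fix as i x y assume as: "as \<in> tuples M n" and i: "i < n" and x: "x \<in> carrier M" and y: "y \<in> carrier M"
  show "f (\<mu> (as[i := x \<oplus>\<^bsub>M\<^esub> y])) = f (\<mu> (as[i := x])) \<oplus>\<^bsub>Q\<^esub> f (\<mu> (as[i := y]))"
    using multilinD(2)[OF \<mu> as i x y] module_homD(2)[OF f multilinD(1)[OF \<mu>] multilinD(1)[OF \<mu>]]
      tuples_update[OF as x] tuples_update[OF as y] by simp
next
  fix as i r x assume as: "as \<in> tuples M n" and i: "i < n" and r: "r \<in> carrier R" and x: "x \<in> carrier M"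
  show "f (\<mu> (as[i := r \<odot>\<^bsub>M\<^esub> x])) = r \<odot>\<^bsub>Q\<^esub> f (\<mu> (as[i := x]))"
    using multilinD(3)[OF \<mu> as i r x] module_homD(3)[OF f r multilinD(1)[OF \<mu>]]
      tuples_update[OF as x] by simp
qed (rule module_homD(1)[OF f multilinD(1)[OF \<mu>]])

lemma multilin_smult:
  assumes M: "module R M" and Q: "module R Q" and \<mu>: "multilin R M n Q \<mu>" and c: "c \<in> carrier R"
  shows "multilin R M n Q (\<lambda>as. c \<odot>\<^bsub>Q\<^esub> \<mu> as)"
proof -
  interpret Q: module R Q by fact
  have "(\<lambda>x. c \<odot>\<^bsub>Q\<^esub> x) \<in> module_hom R Q Q"
    by (rule module_homI)
      (simp_all add: c Q.smult_r_distr Q.smult_assoc1[symmetric] Q.R.m_comm)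
  from multilin_hom[OF \<mu> this] show ?thesis .
qed

lemma multilin_add:
  assumes M: "module R M" and Q: "module R Q" and \<mu>: "multilin R M n Q \<mu>" and \<nu>: "multilin R M n Q \<nu>"
  shows "multilin R M n Q (\<lambda>as. \<mu> as \<oplus>\<^bsub>Q\<^esub> \<nu> as)"
proof -
  interpret Q: module R Q by fact
  interpret M: module R M by fact
  show ?thesis
  proof (rule multilinI)
    fix as i x y assume as: "as \<in> tuples M n" and i: "i < n" and x: "x \<in> carrier M" and y: "y \<in> carrier M"
    note u = tuples_update[OF as x, of i] tuples_update[OF as y, of i]
    note * = multilinD(1)[OF \<mu> u(1)] multilinD(1)[OF \<mu> u(2)] multilinD(1)[OF \<nu> u(1)] multilinD(1)[OF \<nu> u(2)]
    show "\<mu> (as[i := x \<oplus>\<^bsub>M\<^esub> y]) \<oplus>\<^bsub>Q\<^esub> \<nu> (as[i := x \<oplus>\<^bsub>M\<^esub> y]) =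
       \<mu> (as[i := x]) \<oplus>\<^bsub>Q\<^esub> \<nu> (as[i := x]) \<oplus>\<^bsub>Q\<^esub> (\<mu> (as[i := y]) \<oplus>\<^bsub>Q\<^esub> \<nu> (as[i := y]))"
      unfolding multilinD(2)[OF \<mu> as i x y] multilinD(2)[OF \<nu> as i x y]
      using * by (simp add: Q.a_ac)
  next
    fix as i r x assume as: "as \<in> tuples M n" and i: "i < n" and r: "r \<in> carrier R" and x: "x \<in> carrier M"
    note u = tuples_update[OF as x, of i]
    show "\<mu> (as[i := r \<odot>\<^bsub>M\<^esub> x]) \<oplus>\<^bsub>Q\<^esub> \<nu> (as[i := r \<odot>\<^bsub>M\<^esub> x]) =
       r \<odot>\<^bsub>Q\<^esub> (\<mu> (as[i := x]) \<oplus>\<^bsub>Q\<^esub> \<nu> (as[i := x]))"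
      unfolding multilinD(3)[OF \<mu> as i r x] multilinD(3)[OF \<nu> as i r x]
      using multilinD(1)[OF \<mu> u] multilinD(1)[OF \<nu> u] r by (simp add: Q.smult_r_distr)
  qed (use multilinD(1)[OF \<mu>] multilinD(1)[OF \<nu>] in simp)
qed

lemma multilin_minus:
  assumes M: "module R M" and Q: "module R Q" and \<mu>: "multilin R M n Q \<mu>" and \<nu>: "multilin R M n Q \<nu>"
  shows "multilin R M n Q (\<lambda>as. \<mu> as \<ominus>\<^bsub>Q\<^esub> \<nu> as)"
proof -
  interpret Q: module R Q by fact
  have "(\<lambda>x. \<ominus>\<^bsub>Q\<^esub> x) \<in> module_hom R Q Q"
    by (rule module_homI) (simp_all add: Q.smult_r_minus Q.minus_add)
  from multilin_add[OF M Q \<mu> multilin_hom[OF \<nu> this]] show ?thesis by (simp add: a_minus_def)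
qed

lemma multilin_finsum:
  assumes M: "module R M" and Q: "module R Q" and I: "finite I"
    and \<mu>: "\<And>i. i \<in> I \<Longrightarrow> multilin R M n Q (\<mu> i)"
  shows "multilin R M n Q (\<lambda>as. finsum Q (\<lambda>i. \<mu> i as) I)"
proof -
  interpret Q: module R Q by fact
  interpret M: module R M by fact
  have Pi: "(\<lambda>i. \<mu> i as) \<in> I \<rightarrow> carrier Q" if "as \<in> tuples M n" for as
    using multilinD(1)[OF \<mu> that] by simp
  show ?thesis
  proof (rule multilinI)
    fix as k x y assume as: "as \<in> tuples M n" and k: "k < n" and x: "x \<in> carrier M" and y: "y \<in> carrier M"
    note u = tuples_update[OF as x, of k] tuples_update[OF as y, of k] tuples_update[OF as M.a_closed[OF x y], of k]
    have "finsum Q (\<lambda>i. \<mu> i (as[k := x \<oplus>\<^bsub>M\<^esub> y])) I = 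
        finsum Q (\<lambda>i. \<mu> i (as[k := x]) \<oplus>\<^bsub>Q\<^esub> \<mu> i (as[k := y])) I"
      by (rule Q.finsum_cong'[OF refl])
        (use multilinD(2)[OF \<mu> as k x y] multilinD(1)[OF \<mu> u(1)] multilinD(1)[OF \<mu> u(2)] in auto)
    also have "\<dots> = finsum Q (\<lambda>i. \<mu> i (as[k := x])) I \<oplus>\<^bsub>Q\<^esub> finsum Q (\<lambda>i. \<mu> i (as[k := y])) I"
      by (rule Q.finsum_addf[OF Pi[OF u(1)] Pi[OF u(2)]])
    finally show "finsum Q (\<lambda>i. \<mu> i (as[k := x \<oplus>\<^bsub>M\<^esub> y])) I = \<dots>" .
  next
    fix as k r x assume as: "as \<in> tuples M n" and k: "k < n" and r: "r \<in> carrier R" and x: "x \<in> carrier M"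
    note u = tuples_update[OF as x, of k]
    have "finsum Q (\<lambda>i. \<mu> i (as[k := r \<odot>\<^bsub>M\<^esub> x])) I = finsum Q (\<lambda>i. r \<odot>\<^bsub>Q\<^esub> \<mu> i (as[k := x])) I"
      by (rule Q.finsum_cong'[OF refl])
        (use multilinD(3)[OF \<mu> as k r x] multilinD(1)[OF \<mu> u] r in auto)
    also have "\<dots> = r \<odot>\<^bsub>Q\<^esub> finsum Q (\<lambda>i. \<mu> i (as[k := x])) I"
      by (rule Q.finsum_smult_ldistr[symmetric, OF I r Pi[OF u]])
    finally show "finsum Q (\<lambda>i. \<mu> i (as[k := r \<odot>\<^bsub>M\<^esub> x])) I = \<dots>" .
  qed (rule Q.finsum_closed[OF Pi])
qed

lemma replace_delete_nth:
  assumes "length as = m" "1 \<le> i" "i < j" "j \<le> m"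
  shows "length (replace_delete as i j c) = m - 1"
    and "k < m - 1 \<Longrightarrow> replace_delete as i j c ! k =
       (if k = i - 1 then c else if k < j - 1 then as ! k else as ! (k + 1))"
  using assms by (auto simp: replace_delete_def Let_def nth_append)

lemma replace_delete_tuples:
  assumes "as \<in> tuples A m" "1 \<le> i" "i < j" "j \<le> m" "c \<in> carrier A"
  shows "replace_delete as i j c \<in> tuples A (m - 1)"
proof -
  have "set (replace_delete as i j c) \<subseteq> insert c (set as)"
    unfolding replace_delete_def Let_def set_append
    using set_update_subset_insert[of as "i - 1" c] set_take_subset[of "j - 1" "as[i - 1 := c]"]
      set_drop_subset[of j "as[i - 1 := c]"] by blast
  then show ?thesis using assms replace_delete_nth(1)[of as m i j c] by (auto simp: tuples_def)
qed

lemma tuples_nth: "as \<in> tuples A m \<Longrightarrow> k < m \<Longrightarrow> as ! k \<in> carrier A"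
  by (auto simp: tuples_def)

lemma multilin_tpow_elem: "module R M \<Longrightarrow> multilin R M n (tpow R M n) (tpow_elem R M)"
  by (rule multilinI) (auto simp: tpow_module(2) tpow_elem_multilinear)

lemma multilin_merge:
  assumes A: "assoc_algebra R A" and \<mu>: "multilin R A (m - 1) Q \<mu>" and ij: "1 \<le> i" "i < j" "j \<le> m"
    and uv: "(u, v) = (i - 1, j - 1) \<or> (u, v) = (j - 1, i - 1)"
  shows "multilin R A m Q (\<lambda>as. \<mu> (replace_delete as i j (as ! u \<otimes>\<^bsub>A\<^esub> as ! v)))"
proof -
  interpret A: assoc_algebra R A by fact
  have uvm: "u < m" "v < m" "u \<noteq> v" using uv ij by auto
  have cl: "as ! u \<otimes>\<^bsub>A\<^esub> as ! v \<in> carrier A" if "as \<in> tuples A m" for as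
    using tuples_nth[OF that] uvm by simp
  let ?f = "\<lambda>as. replace_delete as i j (as ! u \<otimes>\<^bsub>A\<^esub> as ! v)"
  have f: "?f as \<in> tuples A (m - 1)" if "as \<in> tuples A m" for as
    by (rule replace_delete_tuples[OF that ij cl[OF that]])
  have key: "\<exists>q \<phi>. q < m - 1 \<and> (\<phi> = (\<lambda>x. x) \<or> (\<exists>c\<in>carrier A. \<phi> = (\<lambda>x. x \<otimes>\<^bsub>A\<^esub> c) \<or> \<phi> = (\<lambda>x. c \<otimes>\<^bsub>A\<^esub> x)))
      \<and> (\<forall>x. ?f (as[p := x]) = (?f as)[q := \<phi> x])" if as: "as \<in> tuples A m" and p: "p < m" for as p
  proof -
    have l: "length as = m" using as by (simp add: tuples_def)
    note rd = replace_delete_nth[OF _ ij]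
    have uv': "(u = i - 1 \<and> v = j - 1) \<or> (u = j - 1 \<and> v = i - 1)" using uv by simp
    have upd: "?f (as[p := x]) = (?f as)[q := y]"
      if q: "q < m - 1"
        and y: "(if q = i - 1 then (as[p := x]) ! u \<otimes>\<^bsub>A\<^esub> (as[p := x]) ! v
                 else if q < j - 1 then as[p := x] ! q else as[p := x] ! (q + 1)) = y"
        and oth: "q \<noteq> i - 1 \<Longrightarrow> p \<noteq> u \<and> p \<noteq> v"
        and ne: "\<And>k. k \<noteq> q \<Longrightarrow> k \<noteq> i - 1 \<Longrightarrow> p \<noteq> (if k < j - 1 then k else k + 1)" for q x y
    proof (rule nth_equalityI)
      have len: "length (as[p := x]) = m" by (simp add: l)
      show "length (?f (as[p := x])) = length ((?f as)[q := y])"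
        unfolding length_list_update rd(1)[OF len] rd(1)[OF l] ..
      fix k assume "k < length (?f (as[p := x]))"
      then have k: "k < m - 1" unfolding rd(1)[OF len] .
      show "?f (as[p := x]) ! k = (?f as)[q := y] ! k"
      proof (cases "k = q")
        case True
        have "(?f as)[q := y] ! k = y" using True q by (simp add: rd(1)[OF l])
        moreover have "?f (as[p := x]) ! q = y" by (rule trans[OF rd(2)[OF len q] y])
        ultimately show ?thesis using True by simp
      next
        case False
        then have "(?f as)[q := y] ! k = ?f as ! k" by simp
        then show ?thesis
          unfolding rd(2)[OF len k] rd(2)[OF l k]
          using ne[OF False] oth False by (cases "k = i - 1") auto
      qed
    qed
    consider "p = u" | "p = v" | "p \<noteq> u" "p \<noteq> v" by blast
    then show ?thesis
    proof cases
      case 1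
      have "?f (as[p := x]) = (?f as)[i - 1 := x \<otimes>\<^bsub>A\<^esub> as ! v]" for x
      proof (rule upd)
        show "p \<noteq> (if k < j - 1 then k else k + 1)" if "k \<noteq> i - 1" for k
          using uv' 1 that ij by (elim disjE) auto
      qed (use ij uvm 1 l in auto)
      moreover have "i - 1 < m - 1" using ij by simp
      ultimately show ?thesis using tuples_nth[OF as uvm(2)] by blast
    next
      case 2
      have "?f (as[p := x]) = (?f as)[i - 1 := as ! u \<otimes>\<^bsub>A\<^esub> x]" for x
      proof (rule upd)
        show "p \<noteq> (if k < j - 1 then k else k + 1)" if "k \<noteq> i - 1" for k
          using uv' 2 that ij by (elim disjE) auto
      qed (use ij uvm 2 l in auto)
      moreover have "i - 1 < m - 1" using ij by simp
      ultimately show ?thesis using tuples_nth[OF as uvm(1)] by blast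
    next
      case 3
      define q where "q = (if p < j - 1 then p else p - 1)"
      have pij: "p \<noteq> i - 1" "p \<noteq> j - 1" using uv' 3 by auto
      have qm: "q < m - 1" using p pij ij unfolding q_def by auto
      have qi: "q \<noteq> i - 1" using pij ij unfolding q_def by auto
      have "?f (as[p := x]) = (?f as)[q := x]" for x
      proof (rule upd[OF qm])
        show "(if q = i - 1 then (as[p := x]) ! u \<otimes>\<^bsub>A\<^esub> (as[p := x]) ! v
           else if q < j - 1 then as[p := x] ! q else as[p := x] ! (q + 1)) = x"
          using qi p l pij by (auto simp: q_def)
        show "p \<noteq> (if k < j - 1 then k else k + 1)" if "k \<noteq> q" for k
          using that pij by (auto simp: q_def)
      qed (use 3 in auto)
      then show ?thesis using qm by blast
    qed
  qed
  have lin: "\<phi> x \<in> carrier A" "\<phi> (x \<oplus>\<^bsub>A\<^esub> y) = \<phi> x \<oplus>\<^bsub>A\<^esub> \<phi> y" "r \<in> carrier R \<Longrightarrow> \<phi> (r \<odot>\<^bsub>A\<^esub> x) = r \<odot>\<^bsub>A\<^esub> \<phi> x"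
    if "\<phi> = (\<lambda>x. x) \<or> (\<exists>c\<in>carrier A. \<phi> = (\<lambda>x. x \<otimes>\<^bsub>A\<^esub> c) \<or> \<phi> = (\<lambda>x. c \<otimes>\<^bsub>A\<^esub> x))"
      "x \<in> carrier A" "y \<in> carrier A" for \<phi> x y r
    using that by (auto simp: A.l_distr A.r_distr A.smult_mult_left A.smult_mult_right)
  show ?thesis
  proof (rule multilinI)
    show "\<mu> (?f as) \<in> carrier Q" if "as \<in> tuples A m" for as by (rule multilinD(1)[OF \<mu> f[OF that]])
  next
    fix as p x y assume as: "as \<in> tuples A m" and p: "p < m" and x: "x \<in> carrier A" and y: "y \<in> carrier A"
    obtain q \<phi> where q: "q < m - 1" and \<phi>: "\<phi> = (\<lambda>x. x) \<or> (\<exists>c\<in>carrier A. \<phi> = (\<lambda>x. x \<otimes>\<^bsub>A\<^esub> c) \<or> \<phi> = (\<lambda>x. c \<otimes>\<^bsub>A\<^esub> x))"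
      and e: "\<And>x. ?f (as[p := x]) = (?f as)[q := \<phi> x]" using key[OF as p] by blast
    show "\<mu> (?f (as[p := x \<oplus>\<^bsub>A\<^esub> y])) = \<mu> (?f (as[p := x])) \<oplus>\<^bsub>Q\<^esub> \<mu> (?f (as[p := y]))"
      unfolding e lin(2)[OF \<phi> x y]
      by (rule multilinD(2)[OF \<mu> f[OF as] q lin(1)[OF \<phi> x x] lin(1)[OF \<phi> y y]])
  next
    fix as p r x assume as: "as \<in> tuples A m" and p: "p < m" and r: "r \<in> carrier R" and x: "x \<in> carrier A"
    obtain q \<phi> where q: "q < m - 1" and \<phi>: "\<phi> = (\<lambda>x. x) \<or> (\<exists>c\<in>carrier A. \<phi> = (\<lambda>x. x \<otimes>\<^bsub>A\<^esub> c) \<or> \<phi> = (\<lambda>x. c \<otimes>\<^bsub>A\<^esub> x))"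
      and e: "\<And>x. ?f (as[p := x]) = (?f as)[q := \<phi> x]" using key[OF as p] by blast
    show "\<mu> (?f (as[p := r \<odot>\<^bsub>A\<^esub> x])) = r \<odot>\<^bsub>Q\<^esub> \<mu> (?f (as[p := x]))"
      unfolding e lin(3)[OF \<phi> x x r]
      by (rule multilinD(3)[OF \<mu> f[OF as] q r lin(1)[OF \<phi> x x]])
  qed
qed

lemma multilin_cong:
  assumes "multilin R M n Q \<mu>" and M: "module R M" and e: "\<And>as. as \<in> tuples M n \<Longrightarrow> \<nu> as = \<mu> as"
  shows "multilin R M n Q \<nu>"
proof -
  interpret M: module R M by fact
  show ?thesis
    by (rule multilinI) (simp_all add: e tuples_update multilinD[OF assms(1)])
qed

lemma sign_closed: "cring R \<Longrightarrow> (\<ominus>\<^bsub>R\<^esub> \<one>\<^bsub>R\<^esub>) [^]\<^bsub>R\<^esub> (i::nat) \<in> carrier R"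
proof -
  assume "cring R" then interpret cring R . 
  show ?thesis by simp
qed

lemma hoch_face_replace_delete:
  assumes "length as = n + 1" "i < n"
  shows "hoch_face A n i as = replace_delete as (i + 1) (i + 2) (as ! i \<otimes>\<^bsub>A\<^esub> as ! (i + 1))"
  by (rule nth_equalityI) (use assms in \<open>auto simp: hoch_face_def replace_delete_def Let_def nth_append nth_Cons' nth_list_update less_Suc_eq\<close>)

lemma hoch_face_last_replace_delete:
  assumes "length as = n + 1" "0 < n"
  shows "hoch_face A n n as = replace_delete as 1 (n + 1) (as ! n \<otimes>\<^bsub>A\<^esub> as ! 0)"
  by (rule nth_equalityI)
    (use assms in \<open>auto simp: hoch_face_def replace_delete_def Let_def nth_append nth_Cons' nth_tl\<close>)

lemma multilin_hoch_gen:
  assumes A: "assoc_algebra R A"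
  shows "multilin R A (n + 2) (hoch_chain R A n) (hoch_gen R A n)"
proof -
  interpret A: assoc_algebra R A by fact
  have M: "module R A" by (rule A.module_axioms)
  have Q: "module R (hoch_chain R A n)" unfolding hoch_chain_def by (rule tpow_module(1)[OF M])
  have t: "multilin R A (n + 2 - 1) (hoch_chain R A n) (tpow_elem R A)"
    using multilin_tpow_elem[OF M, of "n + 1"] by (simp add: hoch_chain_def)
  show ?thesis
    unfolding hoch_gen_def sign_smult_def
  proof (intro multilin_finsum[OF M Q] multilin_smult[OF M Q] sign_closed A.R.is_cring)
    fix i assume i: "i \<in> {0..n + 1}"
    show "multilin R A (n + 2) (hoch_chain R A n) (\<lambda>as. tpow_elem R A (hoch_face A (n + 1) i as))"
    proof (cases "i < n + 1")
      case True
      have "multilin R A (n + 2) (hoch_chain R A n)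
          (\<lambda>as. tpow_elem R A (replace_delete as (i + 1) (i + 2) (as ! i \<otimes>\<^bsub>A\<^esub> as ! (i + 1))))"
        by (rule multilin_merge[OF A t]) (use True in auto)
      then show ?thesis
        by (rule multilin_cong[OF _ M]) (use True in \<open>simp add: hoch_face_replace_delete tuples_def\<close>)
    next
      case False
      then have [simp]: "i = n + 1" using i by simp
      have "multilin R A (n + 2) (hoch_chain R A n)
          (\<lambda>as. tpow_elem R A (replace_delete as 1 (n + 2) (as ! (n + 1) \<otimes>\<^bsub>A\<^esub> as ! 0)))"
        by (rule multilin_merge[OF A t]) auto
      then show ?thesis
        by (rule multilin_cong[OF _ M])
          (use hoch_face_last_replace_delete[where n = "n + 1" and A = A] in \<open>simp add: tuples_def\<close>)
    qed
  qed simp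
qed

lemma tpow_lift_multilin:
  assumes M: "module R M" and Q: "module R Q" and \<mu>: "multilin R M n Q \<mu>"
  shows "as \<in> tuples M n \<Longrightarrow> tpow_lift R Q \<mu> (tpow_elem R M as) = \<mu> as"
    and "tpow_lift R Q \<mu> \<in> module_hom R (tpow R M n) Q"
  using tpow_lift[OF M Q, of n \<mu>] multilinD[OF \<mu>] by blast+

theorem hoch_boundary:
  assumes A: "assoc_algebra R A"
  shows "as \<in> tuples A (n + 2) \<Longrightarrow> hoch_boundary R A n (tpow_elem R A as) = hoch_gen R A n as"
    and "hoch_boundary R A n \<in> module_hom R (hoch_chain R A (Suc n)) (hoch_chain R A n)"
proof -
  interpret A: assoc_algebra R A by fact
  have M: "module R A" by (rule A.module_axioms)
  have Q: "module R (hoch_chain R A n)" unfolding hoch_chain_def by (rule tpow_module(1)[OF M])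
  note l = tpow_lift_multilin[OF M Q multilin_hoch_gen[OF A]]
  show "as \<in> tuples A (n + 2) \<Longrightarrow> hoch_boundary R A n (tpow_elem R A as) = hoch_gen R A n as"
    unfolding hoch_boundary_def by (rule l(1))
  show "hoch_boundary R A n \<in> module_hom R (hoch_chain R A (Suc n)) (hoch_chain R A n)"
    using l(2) unfolding hoch_boundary_def by (simp add: hoch_chain_def)
qed

lemma U_class_iff:
  "\<sigma> \<in> U_class m \<longleftrightarrow> (\<exists>cs. distinct cs \<and> set cs = {1..m} \<and> \<sigma> = cycle_of_list cs)"
proof
  assume "\<sigma> \<in> U_class m"
  then obtain \<tau> where \<tau>: "\<tau> permutes {1..m}"
    and \<sigma>: "\<sigma> = \<tau> \<circ> cycle_of_list [1..<m + 1] \<circ> inv_into UNIV \<tau>"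
    unfolding U_class_def by blast
  have "\<sigma> = cycle_of_list (map \<tau> [1..<m + 1])"
    unfolding \<sigma> by (rule conjugation_of_cycle[OF distinct_upt permutes_bij[OF \<tau>]])
  moreover have "distinct (map \<tau> [1..<m + 1])"
    using permutes_inj_on[OF \<tau>] by (simp add: distinct_map)
  moreover have "set (map \<tau> [1..<m + 1]) = {1..m}"
  proof -
    have "{1..<m + 1} = {1..m}" by auto
    then show ?thesis using permutes_image[OF \<tau>] by (simp only: set_map set_upt)
  qed
  ultimately show "\<exists>cs. distinct cs \<and> set cs = {1..m} \<and> \<sigma> = cycle_of_list cs" by blast
next
  assume "\<exists>cs. distinct cs \<and> set cs = {1..m} \<and> \<sigma> = cycle_of_list cs"
  then obtain cs where d: "distinct cs" and s: "set cs = {1..m}" and \<sigma>: "\<sigma> = cycle_of_list cs" by blast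
  have len: "length cs = m" using distinct_card[OF d] s by simp
  define \<tau> where "\<tau> x = (if x \<in> {1..m} then cs ! (x - 1) else x)" for x
  have b: "bij_betw (\<lambda>x. cs ! (x - 1)) {1..m} {1..m}"
  proof -
    have "bij_betw (\<lambda>x. x - 1) {1..m} {..<m}"
      by (rule bij_betwI[where g = Suc]) auto
    from bij_betw_trans[OF this bij_betw_nth[OF d _ s[symmetric]]] show ?thesis
      by (simp add: len comp_def)
  qed
  have bt: "bij_betw \<tau> {1..m} {1..m}"
    using bij_betw_cong[of "{1..m}" \<tau> "\<lambda>x. cs ! (x - 1)"] b by (simp add: \<tau>_def)
  have \<tau>: "\<tau> permutes {1..m}"
    by (rule bij_imp_permutes[OF bt]) (auto simp: \<tau>_def)
  have "map \<tau> [1..<m + 1] = cs"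
    by (rule nth_equalityI) (simp_all add: len \<tau>_def del: upt_Suc)
  then have "\<sigma> = \<tau> \<circ> cycle_of_list [1..<m + 1] \<circ> inv_into UNIV \<tau>"
    using conjugation_of_cycle[OF distinct_upt permutes_bij[OF \<tau>], of 1 "m + 1"] \<sigma> by simp
  then show "\<sigma> \<in> U_class m" using \<tau> unfolding U_class_def by blast
qed

lemma cycle_nth:
  assumes "distinct cs" "k < length cs"
  shows "cycle_of_list cs (cs ! k) = cs ! (Suc k mod length cs)"
proof -
  have "map (cycle_of_list cs) cs = rotate 1 cs" using cyclic_rotation[OF assms(1), of 1] by simp
  then have "map (cycle_of_list cs) cs ! k = rotate 1 cs ! k" by simp
  then show ?thesis using assms(2) by (simp add: nth_rotate del: rotate1_hd_tl rotate_Suc)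
qed

lemma skip_unskip: "y \<noteq> j \<Longrightarrow> skip j (unskip j y) = y" "unskip j (skip j x) = x" "skip j x \<noteq> j"
  by (auto simp: skip_def unskip_def)

lemma delete_from_cycle_closed:
  assumes \<sigma>: "\<sigma> \<in> U_class m" and m: "m \<ge> 2" and j: "1 \<le> j" "j \<le> m"
  shows "delete_from_cycle \<sigma> j \<in> U_class (m - 1)"
proof -
  obtain cs0 where d0: "distinct cs0" and s0: "set cs0 = {1..m}" and \<sigma>0: "\<sigma> = cycle_of_list cs0"
    using \<sigma> U_class_iff by blast
  have "j \<in> set cs0" using j s0 by simp
  then obtain xs zs where cs0: "cs0 = xs @ j # zs" using split_list by metis
  define ys where "ys = zs @ xs"
  have rot: "rotate (length (xs @ [j])) ((xs @ [j]) @ zs) = zs @ (xs @ [j])" by (rule rotate_append)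
  then have rot: "rotate (length xs + 1) cs0 = ys @ [j]" by (simp add: cs0 ys_def)
  have \<sigma>': "\<sigma> = cycle_of_list (ys @ [j])"
    using cycle_of_list_rotate_independent[OF d0, of "length xs + 1"] \<sigma>0 rot by simp
  have d: "distinct (ys @ [j])" using d0 by (auto simp: cs0 ys_def)
  have s: "set ys = {1..m} - {j}" using s0 d0 by (auto simp: cs0 ys_def)
  have jn: "j \<notin> set ys" using s by simp
  have ne: "ys \<noteq> []"
  proof
    assume "ys = []"
    then have "{1..m} \<subseteq> {j}" using s by auto
    then have "card {1..m} \<le> card {j}" by (intro card_mono) auto
    then show False using m by simp
  qed
  let ?n = "length ys" and ?ys = "map (unskip j) ys"
  have inj: "inj_on (unskip j) (set ys)"
  proof (rule inj_on_inverseI[where g = "skip j"])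
    fix y assume "y \<in> set ys"
    then have "y \<noteq> j" using jn by blast
    then show "skip j (unskip j y) = y" by (rule skip_unskip(1))
  qed
  have dy: "distinct ?ys" using d inj by (simp add: distinct_map)
  have sy: "set ?ys = {1..m - 1}"
  proof
    show "set ?ys \<subseteq> {1..m - 1}" using j by (auto simp: s unskip_def split: if_splits)
    show "{1..m - 1} \<subseteq> set ?ys"
    proof
      fix x assume "x \<in> {1..m - 1}"
      then have "skip j x \<in> set ys" using j m unfolding s by (auto simp: skip_def)
      then have "unskip j (skip j x) \<in> set ?ys" by simp
      then show "x \<in> set ?ys" by (simp only: skip_unskip(2))
    qed
  qed
  have \<sigma>y: "\<sigma> (ys ! k) = (if Suc k < ?n then ys ! Suc k else j)" if "k < ?n" for k
    using cycle_nth[OF d, of k] that by (auto simp: \<sigma>' nth_append)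
  have \<sigma>j: "\<sigma> j = ys ! 0"
    using cycle_nth[OF d, of ?n] ne by (auto simp: \<sigma>' nth_append)
  have "delete_from_cycle \<sigma> j x = cycle_of_list ?ys x" for x
  proof (cases "x \<in> set ?ys")
    case True
    then obtain k where k: "k < ?n" "x = unskip j (ys ! k)" by (auto simp: in_set_conv_nth)
    have "ys ! k \<noteq> j" using k jn by force
    then have sk: "skip j x = ys ! k" using k skip_unskip(1) by simp
    have c: "cycle_of_list ?ys x = ?ys ! (Suc k mod ?n)" using cycle_nth[OF dy, of k] k by simp
    show ?thesis
    proof (cases "Suc k < ?n")
      case True
      then have "ys ! Suc k \<noteq> j" using jn by force
      then show ?thesis
        unfolding c delete_from_cycle_def Let_def sk \<sigma>y[OF k(1)] using True by simp
    next
      case False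
      then have "Suc k = ?n" using k by simp
      then show ?thesis
        unfolding c delete_from_cycle_def Let_def sk \<sigma>y[OF k(1)] using \<sigma>j ne by simp
    qed
  next
    case False
    have "skip j x \<notin> set ys"
    proof
      assume "skip j x \<in> set ys"
      then have "unskip j (skip j x) \<in> set ?ys" by simp
      then show False using False by (simp only: skip_unskip(2))
    qed
    then have "skip j x \<notin> set (ys @ [j])" using skip_unskip(3)[of j x] by simp
    then have "\<sigma> (skip j x) = skip j x" unfolding \<sigma>' by (rule id_outside_supp)
    then show ?thesis
      using id_outside_supp[OF False] skip_unskip(2,3)[of j x] by (simp add: delete_from_cycle_def)
  qed
  then have "delete_from_cycle \<sigma> j = cycle_of_list ?ys" by blast
  then show ?thesis using U_class_iff[of _ "m - 1"] dy sy by blast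
qed

lemma free_lift_fun:
  assumes Q: "module R Q" and f: "f \<in> carrier (free_module R S)"
    and \<phi>: "\<And>x. x \<in> S \<Longrightarrow> \<phi> x \<in> carrier Q" 
  shows "(\<And>x. x \<in> S \<Longrightarrow> \<psi> x \<in> carrier Q) \<Longrightarrow> (\<And>x. x \<in> S \<Longrightarrow> \<chi> x = \<phi> x \<oplus>\<^bsub>Q\<^esub> \<psi> x) \<Longrightarrow>
      free_lift R Q \<chi> f = free_lift R Q \<phi> f \<oplus>\<^bsub>Q\<^esub> free_lift R Q \<psi> f"
    and "r \<in> carrier R \<Longrightarrow> (\<And>x. x \<in> S \<Longrightarrow> \<chi> x = r \<odot>\<^bsub>Q\<^esub> \<phi> x) \<Longrightarrow>
      free_lift R Q \<chi> f = r \<odot>\<^bsub>Q\<^esub> free_lift R Q \<phi> f"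
proof -
  interpret Q: module R Q by fact
  have R: "cring R" by (rule Q.R.is_cring)
  note D = free_module_carrierD[OF R f]
  let ?T = "{x. f x \<noteq> \<zero>\<^bsub>R\<^esub>}"
  have ft: "(\<lambda>x. f x \<odot>\<^bsub>Q\<^esub> \<phi> x) \<in> ?T \<rightarrow> carrier Q" if "\<And>x. x \<in> S \<Longrightarrow> \<phi> x \<in> carrier Q" for \<phi>
    using D(1,4) that by (auto intro!: Q.smult_closed)
  have f\<phi>: "(\<lambda>x. f x \<odot>\<^bsub>Q\<^esub> \<phi> x) \<in> ?T \<rightarrow> carrier Q" by (rule ft[OF \<phi>])
  show "free_lift R Q \<chi> f = free_lift R Q \<phi> f \<oplus>\<^bsub>Q\<^esub> free_lift R Q \<psi> f"
    if \<psi>: "\<And>x. x \<in> S \<Longrightarrow> \<psi> x \<in> carrier Q" and \<chi>: "\<And>x. x \<in> S \<Longrightarrow> \<chi> x = \<phi> x \<oplus>\<^bsub>Q\<^esub> \<psi> x"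
  proof -
    have f\<psi>: "(\<lambda>x. f x \<odot>\<^bsub>Q\<^esub> \<psi> x) \<in> ?T \<rightarrow> carrier Q" by (rule ft[OF \<psi>])
    have "free_lift R Q \<chi> f = (\<Oplus>\<^bsub>Q\<^esub>x\<in>?T. f x \<odot>\<^bsub>Q\<^esub> \<phi> x \<oplus>\<^bsub>Q\<^esub> f x \<odot>\<^bsub>Q\<^esub> \<psi> x)"
      unfolding free_lift_def
    proof (rule Q.finsum_cong'[OF refl])
      show "(\<lambda>x. f x \<odot>\<^bsub>Q\<^esub> \<phi> x \<oplus>\<^bsub>Q\<^esub> f x \<odot>\<^bsub>Q\<^esub> \<psi> x) \<in> ?T \<rightarrow> carrier Q"
        using f\<phi> f\<psi> by (simp add: Pi_iff)
      fix x assume "x \<in> ?T"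
      then have "x \<in> S" using D(4) by blast
      then show "f x \<odot>\<^bsub>Q\<^esub> \<chi> x = f x \<odot>\<^bsub>Q\<^esub> \<phi> x \<oplus>\<^bsub>Q\<^esub> f x \<odot>\<^bsub>Q\<^esub> \<psi> x"
        using \<phi> \<psi> \<chi> D(1) by (simp add: Q.smult_r_distr)
    qed
    then show ?thesis unfolding free_lift_def using Q.finsum_addf[OF f\<phi> f\<psi>] by simp
  qed
  show "free_lift R Q \<chi> f = r \<odot>\<^bsub>Q\<^esub> free_lift R Q \<phi> f"
    if r: "r \<in> carrier R" and \<chi>: "\<And>x. x \<in> S \<Longrightarrow> \<chi> x = r \<odot>\<^bsub>Q\<^esub> \<phi> x"
  proof -
    have "free_lift R Q \<chi> f = (\<Oplus>\<^bsub>Q\<^esub>x\<in>?T. r \<odot>\<^bsub>Q\<^esub> (f x \<odot>\<^bsub>Q\<^esub> \<phi> x))"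
      unfolding free_lift_def
    proof (rule Q.finsum_cong'[OF refl])
      show "(\<lambda>x. r \<odot>\<^bsub>Q\<^esub> (f x \<odot>\<^bsub>Q\<^esub> \<phi> x)) \<in> ?T \<rightarrow> carrier Q"
        using f\<phi> r by (simp add: Pi_iff)
      fix x assume "x \<in> ?T"
      then have "x \<in> S" using D(4) by blast
      then show "f x \<odot>\<^bsub>Q\<^esub> \<chi> x = r \<odot>\<^bsub>Q\<^esub> (f x \<odot>\<^bsub>Q\<^esub> \<phi> x)"
        using \<phi> \<chi> D(1) r by (simp add: Q.smult_assoc1[symmetric] Q.R.m_comm)
    qed
    then show ?thesis unfolding free_lift_def using Q.finsum_smult_ldistr[OF D(3) r f\<phi>] by simp
  qed
qed

lemma P_chain_module: "module R A \<Longrightarrow> module R (P_chain R A n)"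
  unfolding P_chain_def
  by (intro tensor_module(1) free_module_module tpow_module(1) module.axioms(1))

lemma multilin_P_elem:
  assumes M: "module R A" and \<sigma>: "\<sigma> \<in> U_class (n + 1)"
  shows "multilin R A (n + 1) (P_chain R A n) (P_elem R A \<sigma>)"
proof -
  have R: "cring R" by (rule module.axioms(1)[OF M])
  note F = free_module_module[OF R, of "U_class (n + 1)"]
  note T = tpow_module(1)[OF M, of "n + 1"]
  note g = free_gen_closed[OF R \<sigma>]
  have "tensor_elem R (free_module R (U_class (n + 1))) (tpow R A (n + 1)) (free_gen R \<sigma>)
      \<in> module_hom R (tpow R A (n + 1)) (P_chain R A n)"
    unfolding P_chain_def
    by (rule module_homI)
      (rule tensor_module(2)[OF F T g] tensor_elem_bilinear(2,4)[OF F T g]; assumption)+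
  from multilin_hom[OF multilin_tpow_elem[OF M] this]
  show ?thesis by (rule multilin_cong[OF _ M]) (simp add: P_elem_def tuples_def)
qed

lemma multilin_P_gen:
  assumes A: "assoc_algebra R A" and \<sigma>: "\<sigma> \<in> U_class (n + 2)"
  shows "multilin R A (n + 2) (P_chain R A n) (P_gen R A n \<sigma>)"
proof -
  interpret A: assoc_algebra R A by fact
  have M: "module R A" by (rule A.module_axioms)
  note Q = P_chain_module[OF M, of n]
  have t: "multilin R A (n + 2 - 1) (P_chain R A n) (P_elem R A (delete_from_cycle \<sigma> j))"
    if "1 \<le> j" "j \<le> n + 2" for j
    using multilin_P_elem[OF M, of "delete_from_cycle \<sigma> j" n] delete_from_cycle_closed[OF \<sigma> _ that] by simp
  have fin: "finite {(i, j). 1 \<le> i \<and> i < j \<and> j \<le> n + 2 \<and> p i j}" for p :: "nat \<Rightarrow> nat \<Rightarrow> bool"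
    by (rule finite_subset[of _ "{..n + 2} \<times> {..n + 2}"]) auto
  show ?thesis
    unfolding P_gen_def Let_def sign_smult_def
  proof (intro multilin_minus[OF M Q] multilin_finsum[OF M Q] fin)
    fix p assume "p \<in> {(i, j). 1 \<le> i \<and> i < j \<and> j \<le> n + 2 \<and> \<sigma> i = j}"
    then obtain i j where p: "p = (i, j)" and ij: "1 \<le> i" "i < j" "j \<le> n + 2" by auto
    show "multilin R A (n + 2) (P_chain R A n) (\<lambda>as. case p of (i, j) \<Rightarrow>
        (\<ominus>\<^bsub>R\<^esub> \<one>\<^bsub>R\<^esub>) [^]\<^bsub>R\<^esub> j \<odot>\<^bsub>P_chain R A n\<^esub> P_elem R A (delete_from_cycle \<sigma> j)
          (replace_delete as i j (as ! (i - 1) \<otimes>\<^bsub>A\<^esub> as ! (j - 1))))"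
      unfolding p prod.case
      by (intro multilin_smult[OF M Q] sign_closed A.R.is_cring multilin_merge[OF A t ij])
        (use ij in auto)
  next
    fix p assume "p \<in> {(i, j). 1 \<le> i \<and> i < j \<and> j \<le> n + 2 \<and> \<sigma> j = i}"
    then obtain i j where p: "p = (i, j)" and ij: "1 \<le> i" "i < j" "j \<le> n + 2" by auto
    show "multilin R A (n + 2) (P_chain R A n) (\<lambda>as. case p of (i, j) \<Rightarrow>
        (\<ominus>\<^bsub>R\<^esub> \<one>\<^bsub>R\<^esub>) [^]\<^bsub>R\<^esub> j \<odot>\<^bsub>P_chain R A n\<^esub> P_elem R A (delete_from_cycle \<sigma> j)
          (replace_delete as i j (as ! (j - 1) \<otimes>\<^bsub>A\<^esub> as ! (i - 1))))"
      unfolding p prod.case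
      by (intro multilin_smult[OF M Q] sign_closed A.R.is_cring multilin_merge[OF A t ij])
        (use ij in auto)
  qed
qed

theorem P_boundary:
  assumes A: "assoc_algebra R A"
  shows "\<sigma> \<in> U_class (n + 2) \<Longrightarrow> as \<in> tuples A (n + 2) \<Longrightarrow>
      P_boundary R A n (P_elem R A \<sigma> as) = P_gen R A n \<sigma> as"
    and "P_boundary R A n \<in> module_hom R (P_chain R A (Suc n)) (P_chain R A n)"
proof -
  interpret A: assoc_algebra R A by fact
  have M: "module R A" by (rule A.module_axioms)
  have R: "cring R" by (rule A.R.is_cring)
  let ?Q = "P_chain R A n" and ?F = "free_module R (U_class (n + 2))" and ?T = "tpow R A (n + 2)"
  note Q = P_chain_module[OF M, of n]
  note F = free_module_module[OF R, of "U_class (n + 2)"]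
  note T = tpow_module(1)[OF M, of "n + 2"]
  interpret T: module R ?T by (rule T)
  define \<phi> where "\<phi> t \<sigma> = tpow_lift R ?Q (P_gen R A n \<sigma>) t" for t \<sigma>
  note l = tpow_lift_multilin[OF M Q multilin_P_gen[OF A]]
  have \<phi>h: "\<And>\<sigma>. \<sigma> \<in> U_class (n + 2) \<Longrightarrow> (\<lambda>t. \<phi> t \<sigma>) \<in> module_hom R ?T ?Q"
    unfolding \<phi>_def by (rule l(2))
  have \<phi>c: "\<phi> t \<sigma> \<in> carrier ?Q" if "\<sigma> \<in> U_class (n + 2)" "t \<in> carrier ?T" for t \<sigma>
    by (rule module_homD(1)[OF \<phi>h[OF that(1)] that(2)])
  have h: "free_lift R ?Q (\<phi> t) \<in> module_hom R ?F ?Q" if "t \<in> carrier ?T" for t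
    by (rule free_lift(2)[OF Q \<phi>c[OF _ that]])
  have eq: "P_boundary R A n = tensor_lift R ?Q (\<lambda>f t. free_lift R ?Q (\<phi> t) f)"
    unfolding P_boundary_def Let_def \<phi>_def ..
  have add: "free_lift R ?Q (\<phi> (t \<oplus>\<^bsub>?T\<^esub> t')) f = free_lift R ?Q (\<phi> t) f \<oplus>\<^bsub>?Q\<^esub> free_lift R ?Q (\<phi> t') f"
    if f: "f \<in> carrier ?F" and t: "t \<in> carrier ?T" "t' \<in> carrier ?T" for f t t'
    by (rule free_lift_fun(1)[OF Q f \<phi>c[OF _ t(1)] \<phi>c[OF _ t(2)] module_homD(2)[OF \<phi>h t]])
  have smult: "free_lift R ?Q (\<phi> (r \<odot>\<^bsub>?T\<^esub> t)) f = r \<odot>\<^bsub>?Q\<^esub> free_lift R ?Q (\<phi> t) f"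
    if r: "r \<in> carrier R" and f: "f \<in> carrier ?F" and t: "t \<in> carrier ?T" for f t r
    by (rule free_lift_fun(2)[OF Q f \<phi>c[OF _ t] r module_homD(3)[OF \<phi>h r t]])
  let ?\<beta> = "\<lambda>f t. free_lift R ?Q (\<phi> t) f"
  have tl: "tensor_lift R ?Q ?\<beta> (tensor_elem R ?F ?T f t) = ?\<beta> f t" if "f \<in> carrier ?F" "t \<in> carrier ?T" for f t
    by (rule tensor_lift(1)[OF F T Q _ _ _ _ _ that, of ?\<beta>])
      (rule module_homD(1)[OF h] module_homD(2)[OF h] add module_homD(3)[OF h] smult; assumption)+
  have "P_boundary R A n \<in> module_hom R (tensor R ?F ?T) ?Q"
    unfolding eq
    by (rule tensor_lift(2)[OF F T Q])
      (rule module_homD(1)[OF h] module_homD(2)[OF h] add module_homD(3)[OF h] smult; assumption)+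
  then show "P_boundary R A n \<in> module_hom R (P_chain R A (Suc n)) ?Q" by (simp add: P_chain_def)
  show "P_boundary R A n (P_elem R A \<sigma> as) = P_gen R A n \<sigma> as"
    if \<sigma>: "\<sigma> \<in> U_class (n + 2)" and as: "as \<in> tuples A (n + 2)"
  proof -
    have len: "length as = n + 2" using as by (simp add: tuples_def)
    have te: "tpow_elem R A as \<in> carrier ?T" by (rule tpow_module(2)[OF M as])
    have "P_boundary R A n (P_elem R A \<sigma> as) = free_lift R ?Q (\<phi> (tpow_elem R A as)) (free_gen R \<sigma>)"
      unfolding P_elem_def eq len by (rule tl[OF free_gen_closed[OF R \<sigma>] te])
    also have "\<dots> = \<phi> (tpow_elem R A as) \<sigma>" by (rule free_lift(1)[OF Q \<phi>c[OF _ te] \<sigma>])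
    also have "\<dots> = P_gen R A n \<sigma> as" unfolding \<phi>_def by (rule l(1)[OF \<sigma> as])
    finally show ?thesis .
  qed
qed

end

theory Submission
  imports Defs
begin

text \<open>Picture \<open>\<sigma> \<otimes> (a\<^sub>1, \<dots>, a\<^sub>m)\<close> as a cyclic word: \<open>m\<close> points on a circle, labelled \<open>1, \<dots>, m\<close> in
  the cyclic order \<open>\<sigma>\<close>, where point \<open>i\<close> carries the letter \<open>a\<^sub>i\<close>. The differential is then a single
  sum over the arrows \<open>x \<rightarrow> \<sigma> x\<close>: the two letters are multiplied in cyclic order, the smaller label
  survives, the larger one is deleted, and the sign depends on the larger label and on the direction
  of the arrow (\<open>P_gen_eq\<close>).

  For the standard cycle \<open>(1, 2, \<dots>, m)\<close> the arrows give exactly the faces of the Hochschild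
  complex, with their signs. Hence \<open>a \<mapsto> (1, 2, \<dots>, m) \<otimes> a\<close> is an
  injective chain map \<open>\<iota>\<close> (\<open>hoch_incl\<close>), and the theorem says that it induces isomorphisms on
  homology.

  The homotopy that shows this inserts the unit of \<open>A\<close>, under a new smallest label, in front of the
  old label \<open>1\<close>; call it \<open>s\<close>. In \<open>d s\<close> the arrow out of the new point gives back the original word.
  The arrows inside the old word are contracted as before but with all labels raised by one, so with
  the opposite sign, and they cancel \<open>s d\<close>. There remain only the two terms that come from the arrow
  into the label \<open>1\<close>. Thus \<open>id - d s - s d\<close> is minus the sum of these two terms.

  Filter \<open>P\<^sub>*(A)\<close> by the length \<open>k\<close> of the initial stretch \<open>1 \<rightarrow> 2 \<rightarrow> \<dots> \<rightarrow> k\<close> of the cycle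
  (\<open>ascending k\<close>). The new point extends the stretch by one. As long as \<open>k < m\<close>, the arrow into \<open>1\<close>
  starts outside the stretch, at a label larger than \<open>k\<close>, so that contracting it leaves the stretch
  intact. Hence \<open>id - d s - s d\<close> raises \<open>k\<close> by at least one (\<open>insert_unit_homotopy\<close>). For \<open>k = m\<close>
  the word is a standard one, and \<open>s\<close> preserves the standard words. In each degree finitely many
  steps therefore replace every cycle by a homologous one in the image of \<open>\<iota>\<close>, and every chain that
  bounds a cycle of the image by a chain of the image (\<open>filtered_homology_isomorphic\<close>).

  That \<open>d\<close> squares to zero is a cancellation in pairs: contracting the arrow out of \<open>x\<close> and then the
  one out of \<open>z\<close> gives the same word as the opposite order, with the opposite sign
  (\<open>contract_twice_swap\<close>). The Hochschild complex inherits this through \<open>\<iota>\<close>.\<close>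


section \<open>Submodules, spans and homomorphisms\<close>

lemma module_hom_comp:
  assumes "f \<in> module_hom R L M" "g \<in> module_hom R M N"
  shows "(\<lambda>x. g (f x)) \<in> module_hom R L N"
  using assms by (auto simp: module_hom_def Pi_iff)

lemma module_hom_id: "(\<lambda>x. x) \<in> module_hom R M M"
  by (simp add: module_hom_def)

lemma module_hom_diff:
  assumes N: "module R N" and f: "f \<in> module_hom R M N" and g: "g \<in> module_hom R M N"
  shows "(\<lambda>x. f x \<ominus>\<^bsub>N\<^esub> g x) \<in> module_hom R M N"
proof -
  interpret N: module R N by fact
  show ?thesis
    by (rule module_homI)
      (auto simp: module_homD[OF f] module_homD[OF g] a_minus_def N.minus_add N.smult_r_distr
        N.smult_r_minus N.a_ac)
qed

lemma submodule_vimage: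
  assumes M: "module R M" and N: "module R N" and f: "f \<in> module_hom R M N" and K: "submodule K R N"
  shows "submodule {x \<in> carrier M. f x \<in> K} R M"
proof -
  interpret M: module R M by fact
  interpret N: module R N by fact
  interpret K: submodule K R N by fact
  show ?thesis
    by (rule M.submoduleI)
      (use N.submoduleE(3,5)[OF K] K.one_closed in
        \<open>auto simp: module_homD[OF f] module_hom_zero[OF M N f] module_hom_neg[OF M N f]\<close>)
qed

lemma submodule_image:
  assumes M: "module R M" and N: "module R N" and f: "f \<in> module_hom R M N" and K: "submodule K R M"
  shows "submodule (f ` K) R N"
proof -
  interpret M: module R M by fact
  interpret N: module R N by fact
  note KE = M.submoduleE[OF K]
  have KM: "x \<in> carrier M" if "x \<in> K" for x using that KE(1) by auto
  show ?thesis
  proof (rule N.submoduleI)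
    show "f ` K \<subseteq> carrier N" using KM module_homD(1)[OF f] by auto
    show "\<zero>\<^bsub>N\<^esub> \<in> f ` K"
      using module_hom_zero[OF M N f] subgroup.one_closed[OF submodule.axioms(1)[OF K]]
      by (metis imageI monoid.select_convs(2))
  next
    fix a assume "a \<in> f ` K"
    then show "\<ominus>\<^bsub>N\<^esub> a \<in> f ` K"
      using module_hom_neg[OF M N f] KE(3) KM by (metis (no_types, lifting) imageE imageI)
    fix b assume "b \<in> f ` K"
    with \<open>a \<in> f ` K\<close> obtain x y where "a = f x" "b = f y" "x \<in> K" "y \<in> K" by auto
    then show "a \<oplus>\<^bsub>N\<^esub> b \<in> f ` K"
      using module_homD(2)[OF f KM KM, of x y] KE(5)[of x y] by (metis imageI)
  next
    fix r a assume "r \<in> carrier R" "a \<in> f ` K"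
    then show "r \<odot>\<^bsub>N\<^esub> a \<in> f ` K"
      using module_homD(3)[OF f] KE(4) KM by (metis (no_types, lifting) imageE imageI)
  qed
qed

lemma submodule_span_least:
  assumes "submodule N R M" "S \<subseteq> N"
  shows "submodule_span R M S \<subseteq> N"
  using assms unfolding submodule_span_def by blast

lemma submodule_span_closed:
  assumes "module R M" "S \<subseteq> carrier M"
  shows "submodule_span R M S \<subseteq> carrier M"
  using submodule_span_least[OF module.carrier_is_submodule[OF assms(1)] assms(2)] .

lemma submodule_span_hom:
  assumes M: "module R M" and N: "module R N" and f: "f \<in> module_hom R M N" and K: "submodule K R N"
    and S: "S \<subseteq> carrier M" "\<And>x. x \<in> S \<Longrightarrow> f x \<in> K" and x: "x \<in> submodule_span R M S"
  shows "f x \<in> K"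
  using submodule_span_least[OF submodule_vimage[OF M N f K], of S] S x by blast

lemma free_module_span:
  assumes R: "cring R"
  shows "submodule_span R (free_module R S) (free_gen R ` S) = carrier (free_module R S)"
proof
  let ?F = "free_module R S" and ?N = "submodule_span R (free_module R S) (free_gen R ` S)"
  interpret R: cring R by fact
  note FM = free_module_module[OF R, of S]
  interpret F: module R ?F by (rule FM)
  note D = free_module_carrierD[OF R]
  have G: "free_gen R ` S \<subseteq> carrier ?F" using free_gen_closed[OF R] by auto
  show "?N \<subseteq> carrier ?F" by (rule submodule_span_closed[OF FM G])
  note N = submodule_span[OF FM G]
  note NE = F.submoduleE[OF N(1)]
  have "f \<in> ?N" if "finite T" "f \<in> carrier ?F" "{x. f x \<noteq> \<zero>\<^bsub>R\<^esub>} \<subseteq> T" for T f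
    using that
  proof (induction T arbitrary: f rule: finite_induct)
    case empty
    then have "f = \<zero>\<^bsub>?F\<^esub>" by (auto simp: free_module_simps)
    then show ?case using subgroup.one_closed[OF submodule.axioms(1)[OF N(1)]] by simp
  next
    case (insert x T)
    show ?case
    proof (cases "x \<in> S")
      case False
      then have "f x = \<zero>\<^bsub>R\<^esub>" using D(2)[OF insert.prems(1)] by simp
      then show ?thesis using insert by blast
    next
      case True
      let ?g = "f(x := \<zero>\<^bsub>R\<^esub>)"
      have g: "?g \<in> carrier ?F"
      proof (rule free_module_carrierI)
        show "finite {y. ?g y \<noteq> \<zero>\<^bsub>R\<^esub>}"
          by (rule finite_subset[OF _ D(3)[OF insert.prems(1)]]) auto
      qed (simp_all add: D(1,2)[OF insert.prems(1)])
      have "?g \<in> ?N" by (rule insert.IH[OF g]) (use insert.prems in auto)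
      moreover have "f x \<odot>\<^bsub>?F\<^esub> free_gen R x \<in> ?N"
        by (rule NE(4)[OF D(1)[OF insert.prems(1)]]) (use True N(2) in auto)
      moreover have "f = ?g \<oplus>\<^bsub>?F\<^esub> (f x \<odot>\<^bsub>?F\<^esub> free_gen R x)"
        using D(1)[OF insert.prems(1)] by (auto simp: free_module_simps free_gen_def)
      ultimately show ?thesis using NE(5) by metis
    qed
  qed
  then show "carrier ?F \<subseteq> ?N" using D(3) by blast
qed

text \<open>A module given by generators and relations is spanned by the classes of the generators, so two
  linear maps out of it agree as soon as they agree there. The next lemmas pass this on to tensor
  powers, to tensor products and to \<open>P\<^sub>n(A)\<close>, in the form needed for induction on spans.\<close>

lemma presented_span:
  assumes R: "cring R" and T: "T \<subseteq> carrier (free_module R S)"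
  defines "K \<equiv> submodule_span R (free_module R S) T"
  assumes N: "submodule N R (quot_module (free_module R S) K)"
    and g: "\<And>x. x \<in> S \<Longrightarrow> K +>\<^bsub>free_module R S\<^esub> free_gen R x \<in> N"
  shows "N = carrier (quot_module (free_module R S) K)"
proof
  note FM = free_module_module[OF R, of S]
  note K = submodule_span[OF FM T, folded K_def]
  note q = quot_module[OF FM K(1)]
  show "N \<subseteq> carrier (quot_module (free_module R S) K)"
    by (rule module.submoduleE(1)[OF q(1) N])
  have "K +>\<^bsub>free_module R S\<^esub> f \<in> N" if f: "f \<in> carrier (free_module R S)" for f
    by (rule submodule_span_hom[OF FM q(1,2) N, of "free_gen R ` S"])
      (use g free_gen_closed[OF R] f in \<open>auto simp: free_module_span[OF R]\<close>)
  then show "carrier (quot_module (free_module R S) K) \<subseteq> N" unfolding q(3) by blast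
qed

lemma tpow_span:
  assumes M: "module R M" and N: "submodule N R (tpow R M n)"
    and g: "\<And>as. as \<in> tuples M n \<Longrightarrow> tpow_elem R M as \<in> N"
  shows "N = carrier (tpow R M n)"
  unfolding tpow_def
proof (rule presented_span[OF module.axioms(1)[OF M] tpow_rels_closed[OF M], folded tpow_kernel_def])
  show "submodule N R (quot_module (free_module R (tuples M n)) (tpow_kernel R M n))"
    using N by (simp add: tpow_def)
  fix as assume as: "as \<in> tuples M n"
  then have "length as = n" by (simp add: tuples_def)
  then show "tpow_kernel R M n +>\<^bsub>free_module R (tuples M n)\<^esub> free_gen R as \<in> N"
    using g[OF as] by (simp add: tpow_elem_def)
qed

lemma tensor_span:
  assumes M: "module R M" and N: "module R N" and K: "submodule K R (tensor R M N)"
    and g: "\<And>x y. x \<in> carrier M \<Longrightarrow> y \<in> carrier N \<Longrightarrow> tensor_elem R M N x y \<in> K"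
  shows "K = carrier (tensor R M N)"
  unfolding tensor_def
  by (rule presented_span[OF module.axioms(1)[OF M] tensor_rels_closed[OF M N], folded tensor_kernel_def])
    (use K g in \<open>auto simp: tensor_def tensor_elem_def\<close>)

lemma tensor_elem_hom:
  assumes M: "module R M" and N: "module R N"
  shows "x \<in> carrier M \<Longrightarrow> tensor_elem R M N x \<in> module_hom R N (tensor R M N)"
    and "y \<in> carrier N \<Longrightarrow> (\<lambda>x. tensor_elem R M N x y) \<in> module_hom R M (tensor R M N)"
  using tensor_module(2)[OF M N] tensor_elem_bilinear[OF M N] by (auto intro!: module_homI)

lemma P_chain_span:
  assumes A: "module R A" and K: "submodule K R (P_chain R A n)"
    and g: "\<And>\<sigma> as. \<sigma> \<in> U_class (n + 1) \<Longrightarrow> as \<in> tuples A (n + 1) \<Longrightarrow> P_elem R A \<sigma> as \<in> K"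
  shows "K = carrier (P_chain R A n)"
proof -
  have R: "cring R" by (rule module.axioms(1)[OF A])
  let ?F = "free_module R (U_class (n + 1))" and ?T = "tpow R A (n + 1)"
  note F = free_module_module[OF R, of "U_class (n + 1)"]
  note T = tpow_module(1)[OF A, of "n + 1"]
  note P = tensor_module(1)[OF F T]
  have K': "submodule K R (tensor R ?F ?T)" using K by (simp add: P_chain_def)
  have 1: "tensor_elem R ?F ?T (free_gen R \<sigma>) t \<in> K"
    if \<sigma>: "\<sigma> \<in> U_class (n + 1)" and t: "t \<in> carrier ?T" for \<sigma> t
  proof -
    note h = tensor_elem_hom(1)[OF F T free_gen_closed[OF R \<sigma>]]
    have "{t \<in> carrier ?T. tensor_elem R ?F ?T (free_gen R \<sigma>) t \<in> K} = carrier ?T"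
    proof (rule tpow_span[OF A submodule_vimage[OF T P h K']])
      fix as assume as: "as \<in> tuples A (n + 1)"
      then have "length as = n + 1" by (simp add: tuples_def)
      then show "tpow_elem R A as \<in> {t \<in> carrier ?T. tensor_elem R ?F ?T (free_gen R \<sigma>) t \<in> K}"
        using g[OF \<sigma> as] tpow_module(2)[OF A as] by (simp add: P_elem_def)
    qed
    then show ?thesis using t by blast
  qed
  have 2: "tensor_elem R ?F ?T f t \<in> K" if t: "t \<in> carrier ?T" and f: "f \<in> carrier ?F" for f t
    by (rule submodule_span_hom[OF F P tensor_elem_hom(2)[OF F T t] K', of "free_gen R ` U_class (n + 1)"])
      (use 1 t f free_gen_closed[OF R] in \<open>auto simp: free_module_span[OF R]\<close>)
  show ?thesis unfolding P_chain_def by (rule tensor_span[OF F T K' 2])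
qed

text \<open>The linear map out of \<open>P\<^sub>n(A)\<close> induced by a family of multilinear maps, one for each cycle.\<close>

definition P_lift ::
    "('k, 'r) ring_scheme \<Rightarrow> ('k, 'c, 't) module_scheme \<Rightarrow> ((nat \<Rightarrow> nat) \<Rightarrow> 'a list \<Rightarrow> 'c)
      \<Rightarrow> (((nat \<Rightarrow> nat) \<Rightarrow> 'k) \<times> ('a list \<Rightarrow> 'k) set \<Rightarrow> 'k) set \<Rightarrow> 'c"
  where "P_lift R Q \<mu> =
    tensor_lift R Q (\<lambda>f t. free_lift R Q (\<lambda>\<sigma>. tpow_lift R Q (\<mu> \<sigma>) t) f)"

lemma P_lift:
  assumes M: "module R A" and Q: "module R Q"
    and \<mu>: "\<And>\<sigma>. \<sigma> \<in> U_class (n + 1) \<Longrightarrow> multilin R A (n + 1) Q (\<mu> \<sigma>)"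
  shows "\<sigma> \<in> U_class (n + 1) \<Longrightarrow> as \<in> tuples A (n + 1) \<Longrightarrow>
      P_lift R Q \<mu> (P_elem R A \<sigma> as) = \<mu> \<sigma> as"
    and "P_lift R Q \<mu> \<in> module_hom R (P_chain R A n) Q"
proof -
  have R: "cring R" by (rule module.axioms(1)[OF M])
  let ?U = "U_class (n + 1)"
  let ?F = "free_module R ?U" and ?T = "tpow R A (n + 1)"
  let ?\<beta> = "\<lambda>f t. free_lift R Q (\<lambda>\<sigma>. tpow_lift R Q (\<mu> \<sigma>) t) f"
  note F = free_module_module[OF R, of ?U] and T = tpow_module(1)[OF M, of "n + 1"]
  note l = tpow_lift_multilin[OF M Q \<mu>]
  have c: "tpow_lift R Q (\<mu> \<sigma>) t \<in> carrier Q" if "t \<in> carrier ?T" "\<sigma> \<in> ?U" for \<sigma> t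
    by (rule module_homD(1)[OF l(2)[OF that(2)] that(1)])
  have h: "?\<beta> f t \<in> carrier Q"
      "f' \<in> carrier ?F \<Longrightarrow> ?\<beta> (f \<oplus>\<^bsub>?F\<^esub> f') t = ?\<beta> f t \<oplus>\<^bsub>Q\<^esub> ?\<beta> f' t"
      "t' \<in> carrier ?T \<Longrightarrow> ?\<beta> f (t \<oplus>\<^bsub>?T\<^esub> t') = ?\<beta> f t \<oplus>\<^bsub>Q\<^esub> ?\<beta> f t'"
      "r \<in> carrier R \<Longrightarrow> ?\<beta> (r \<odot>\<^bsub>?F\<^esub> f) t = r \<odot>\<^bsub>Q\<^esub> ?\<beta> f t"
      "r \<in> carrier R \<Longrightarrow> ?\<beta> f (r \<odot>\<^bsub>?T\<^esub> t) = r \<odot>\<^bsub>Q\<^esub> ?\<beta> f t"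
    if f: "f \<in> carrier ?F" and t: "t \<in> carrier ?T" for f f' t t' r
  proof -
    note hom = free_lift(2)[OF Q c[OF t], of ?U]
    show "?\<beta> f t \<in> carrier Q"
      "f' \<in> carrier ?F \<Longrightarrow> ?\<beta> (f \<oplus>\<^bsub>?F\<^esub> f') t = ?\<beta> f t \<oplus>\<^bsub>Q\<^esub> ?\<beta> f' t"
      "r \<in> carrier R \<Longrightarrow> ?\<beta> (r \<odot>\<^bsub>?F\<^esub> f) t = r \<odot>\<^bsub>Q\<^esub> ?\<beta> f t"
      using module_homD[OF hom] f by auto
    show "?\<beta> f (t \<oplus>\<^bsub>?T\<^esub> t') = ?\<beta> f t \<oplus>\<^bsub>Q\<^esub> ?\<beta> f t'" if t': "t' \<in> carrier ?T"
      by (rule free_lift_fun(1)[OF Q f c[OF t] c[OF t'] module_homD(2)[OF l(2) t t']])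
    show "?\<beta> f (r \<odot>\<^bsub>?T\<^esub> t) = r \<odot>\<^bsub>Q\<^esub> ?\<beta> f t" if r: "r \<in> carrier R"
      by (rule free_lift_fun(2)[OF Q f c[OF t] r module_homD(3)[OF l(2) r t]])
  qed
  have tl: "P_lift R Q \<mu> (tensor_elem R ?F ?T f t) = ?\<beta> f t"
    if "f \<in> carrier ?F" "t \<in> carrier ?T" for f t
    unfolding P_lift_def by (rule tensor_lift(1)[OF F T Q _ _ _ _ _ that, of ?\<beta>]) (rule h; assumption)+
  show "P_lift R Q \<mu> \<in> module_hom R (P_chain R A n) Q"
    unfolding P_lift_def P_chain_def by (rule tensor_lift(2)[OF F T Q]) (rule h; assumption)+
  show "P_lift R Q \<mu> (P_elem R A \<sigma> as) = \<mu> \<sigma> as" if \<sigma>: "\<sigma> \<in> ?U" and as: "as \<in> tuples A (n + 1)"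
  proof -
    have te: "tpow_elem R A as \<in> carrier ?T" by (rule tpow_module(2)[OF M as])
    have len: "length as = n + 1" using as by (simp add: tuples_def)
    have "P_lift R Q \<mu> (P_elem R A \<sigma> as) = ?\<beta> (free_gen R \<sigma>) (tpow_elem R A as)"
      unfolding P_elem_def len by (rule tl[OF free_gen_closed[OF R \<sigma>] te])
    also have "\<dots> = tpow_lift R Q (\<mu> \<sigma>) (tpow_elem R A as)"
      by (rule free_lift(1)[OF Q c[OF te] \<sigma>])
    also have "\<dots> = \<mu> \<sigma> as" by (rule l(1)[OF \<sigma> as])
    finally show ?thesis .
  qed
qed


section \<open>Homology of complexes of modules\<close>

locale module_complex =
  fixes R :: "('k, 'r) ring_scheme" and C :: "nat \<Rightarrow> ('k, 'c, 's) module_scheme" and d :: "nat \<Rightarrow> 'c \<Rightarrow> 'c"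
  assumes module_C: "module R (C n)"
    and d_hom: "d n \<in> module_hom R (C (Suc n)) (C n)"
    and d_d: "x \<in> carrier (C (Suc (Suc n))) \<Longrightarrow> d n (d (Suc n) x) = \<zero>\<^bsub>C n\<^esub>"
begin

lemma cycles_of_Suc: "x \<in> cycles_of C d (Suc n) \<longleftrightarrow> x \<in> carrier (C (Suc n)) \<and> d n x = \<zero>\<^bsub>C n\<^esub>"
  by (auto simp: a_kernel_def')

lemma cycles_of_closed: "x \<in> cycles_of C d n \<Longrightarrow> x \<in> carrier (C n)"
  by (cases n) (auto simp: a_kernel_def')

lemma boundaries_of_cycles: "boundaries_of C d n \<subseteq> cycles_of C d n"
proof (cases n)
  case 0
  then show ?thesis using module_homD(1)[OF d_hom] by (auto simp: boundaries_of_def)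
next
  case (Suc n')
  show ?thesis
    unfolding boundaries_of_def Suc
    using module_homD(1)[OF d_hom, of _ "Suc n'"] d_d[of _ n'] cycles_of_Suc[of _ n'] by blast
qed

lemma cycles_of_submodule: "submodule (cycles_of C d n) R (C n)"
proof (cases n)
  case 0
  then show ?thesis using module.carrier_is_submodule[OF module_C] by simp
next
  case (Suc n')
  interpret C: module R "C n'" by (rule module_C)
  have "submodule {\<zero>\<^bsub>C n'\<^esub>} R (C n')" by (rule C.submoduleI) auto
  from submodule_vimage[OF module_C module_C d_hom this]
  have "submodule {x \<in> carrier (C (Suc n')). d n' x \<in> {\<zero>\<^bsub>C n'\<^esub>}} R (C (Suc n'))" .
  moreover have "cycles_of C d (Suc n') = {x \<in> carrier (C (Suc n')). d n' x \<in> {\<zero>\<^bsub>C n'\<^esub>}}"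
    using cycles_of_Suc[of _ n'] by blast
  ultimately show ?thesis unfolding Suc by simp
qed

lemma boundaries_of_submodule: "submodule (boundaries_of C d n) R (C n)"
  unfolding boundaries_of_def
  by (rule submodule_image[OF module_C module_C d_hom module.carrier_is_submodule[OF module_C]])

lemma cycles_of_module: "module R ((C n)\<lparr>carrier := cycles_of C d n\<rparr>)"
  using submodule.submodule_is_module[OF cycles_of_submodule module_C] .

lemma boundaries_of_submodule_cycles:
  "submodule (boundaries_of C d n) R ((C n)\<lparr>carrier := cycles_of C d n\<rparr>)"
  by (rule module.module_incl_imp_submodule[OF cycles_of_module])
     (use boundaries_of_cycles submodule.submodule_is_module[OF boundaries_of_submodule module_C] in auto)

end

text \<open>Surjectivity is stated with a sum \<open>z = \<iota> y + w\<close> and not with a difference because the negation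
  of a module record depends on its carrier: that of the module of cycles is not literally that of
  the module of chains.\<close>

lemma homology_isomorphicI:
  assumes C: "module_complex R C b" and D: "module_complex R D d"
    and \<iota>: "\<And>n. \<iota> n \<in> module_hom R (C n) (D n)"
    and chain: "\<And>n x. x \<in> carrier (C (Suc n)) \<Longrightarrow> d n (\<iota> (Suc n) x) = \<iota> n (b n x)"
    and inj: "\<And>z. z \<in> cycles_of C b n \<Longrightarrow> \<iota> n z \<in> boundaries_of D d n \<Longrightarrow> z \<in> boundaries_of C b n"
    and surj: "\<And>z. z \<in> cycles_of D d n \<Longrightarrow>
      \<exists>y\<in>cycles_of C b n. \<exists>w\<in>boundaries_of D d n. z = \<iota> n y \<oplus>\<^bsub>D n\<^esub> w"
  shows "module_isomorphic R (homology D d n) (homology C b n)"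
proof -
  interpret C: module_complex R C b by fact
  interpret D: module_complex R D d by fact
  let ?ZC = "(C n)\<lparr>carrier := cycles_of C b n\<rparr>" and ?ZD = "(D n)\<lparr>carrier := cycles_of D d n\<rparr>"
  let ?BC = "boundaries_of C b n" and ?BD = "boundaries_of D d n"
  let ?HC = "homology C b n" and ?HD = "homology D d n"
  let ?p = "\<lambda>z. ?BC +>\<^bsub>?ZC\<^esub> z" and ?q = "\<lambda>z. ?BD +>\<^bsub>?ZD\<^esub> z"
  note ZC = C.cycles_of_module[of n] and ZD = D.cycles_of_module[of n]
  note BC = C.boundaries_of_submodule_cycles[of n] and BD = D.boundaries_of_submodule_cycles[of n]
  note p = quot_module[OF ZC BC, folded homology_def] and q = quot_module[OF ZD BD, folded homology_def]
  interpret HC: module R ?HC by (rule p(1))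
  interpret HD: module R ?HD by (rule q(1))
  have \<iota>Z: "\<iota> n z \<in> cycles_of D d n" if z: "z \<in> cycles_of C b n" for z
  proof (cases n)
    case 0
    then show ?thesis using z module_homD(1)[OF \<iota>] by simp
  next
    case (Suc n')
    have "d n' (\<iota> n z) = \<iota> n' \<zero>\<^bsub>C n'\<^esub>"
      using z chain[of z n'] C.cycles_of_Suc[of z n'] unfolding Suc by simp
    then show ?thesis
      using module_hom_zero[OF C.module_C D.module_C \<iota>] module_homD(1)[OF \<iota>] C.cycles_of_closed[OF z]
        D.cycles_of_Suc[of "\<iota> n z" n'] unfolding Suc by simp
  qed
  have h: "(\<lambda>z. ?q (\<iota> n z)) \<in> module_hom R ?ZC ?HD"
  proof (rule module_hom_comp[OF _ q(2)])
    show "\<iota> n \<in> module_hom R ?ZC ?ZD"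
      by (rule module_homI) (use \<iota>Z module_homD(2,3)[OF \<iota>] C.cycles_of_closed in auto)
  qed
  have zero: "?q w = \<zero>\<^bsub>?HD\<^esub> \<longleftrightarrow> w \<in> ?BD" if w: "w \<in> cycles_of D d n" for w
  proof -
    interpret ZD: module R ?ZD by (rule ZD)
    interpret BD: submodule ?BD R ?ZD by (rule BD)
    interpret BD: abelian_subgroup ?BD ?ZD
      by (rule abelian_subgroupI3) (auto intro: additive_subgroup.intro BD.subgroup_axioms ZD.abelian_group_axioms)
    have z: "\<zero>\<^bsub>?HD\<^esub> = ?BD" by (simp add: homology_def quot_module_def)
    show ?thesis
    proof
      assume "?q w = \<zero>\<^bsub>?HD\<^esub>"
      then show "w \<in> ?BD" using BD.a_rcos_self[of w] w z by simp
    next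
      assume "w \<in> ?BD"
      then show "?q w = \<zero>\<^bsub>?HD\<^esub>" unfolding z by (rule BD.a_rcos_const)
    qed
  qed
  let ?f = "quot_lift (\<lambda>z. ?q (\<iota> n z))"
  have van: "?q (\<iota> n z) = \<zero>\<^bsub>?HD\<^esub>" if "z \<in> ?BC" for z
  proof -
    obtain x where x: "x \<in> carrier (C (Suc n))" "z = b n x" using \<open>z \<in> ?BC\<close> by (auto simp: boundaries_of_def)
    then have "\<iota> n z \<in> ?BD"
      using chain[OF x(1)] module_homD(1)[OF \<iota> x(1)] by (metis boundaries_of_def imageI)
    then show ?thesis using zero D.boundaries_of_cycles by blast
  qed
  note l = quot_lift[OF ZC q(1) h BC van, folded homology_def]
  have f: "?f (?p z) = ?q (\<iota> n z)" if "z \<in> cycles_of C b n" for z using l(1) that by simp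
  have cp: "carrier ?HC = ?p ` cycles_of C b n" and cq: "carrier ?HD = ?q ` cycles_of D d n"
    using p(3) q(3) by simp_all
  have "inj_on ?f (carrier ?HC)"
  proof (rule inj_onI)
    fix u v assume u: "u \<in> carrier ?HC" and v: "v \<in> carrier ?HC" and e: "?f u = ?f v"
    have "u \<ominus>\<^bsub>?HC\<^esub> v \<in> carrier ?HC" using u v by simp
    then obtain z where z: "z \<in> cycles_of C b n" "u \<ominus>\<^bsub>?HC\<^esub> v = ?p z" using cp by auto
    have "?q (\<iota> n z) = \<zero>\<^bsub>?HD\<^esub>"
      using f[OF z(1)] z(2) module_hom_minus[OF p(1) q(1) l(2) u v] e module_homD(1)[OF l(2) v]
      by (simp add: a_minus_def HD.r_neg)
    then have "z \<in> ?BC" using zero[OF \<iota>Z[OF z(1)]] inj[OF z(1)] by simp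
    moreover interpret ZC: module R ?ZC by (rule ZC)
    interpret BC: submodule ?BC R ?ZC by (rule BC)
    interpret BC: abelian_subgroup ?BC ?ZC
      by (rule abelian_subgroupI3) (auto intro: additive_subgroup.intro BC.subgroup_axioms ZC.abelian_group_axioms)
    have "\<zero>\<^bsub>?HC\<^esub> = ?BC" by (simp add: homology_def quot_module_def)
    ultimately have "u \<ominus>\<^bsub>?HC\<^esub> v = \<zero>\<^bsub>?HC\<^esub>" using z(2) BC.a_rcos_const by simp
    then show "u = v"
      using u v by (metis HC.a_inv_closed HC.minus_equality HC.minus_minus a_minus_def)
  qed
  moreover have "?f ` carrier ?HC = carrier ?HD"
  proof
    show "?f ` carrier ?HC \<subseteq> carrier ?HD" using module_homD(1)[OF l(2)] by auto
    show "carrier ?HD \<subseteq> ?f ` carrier ?HC"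
    proof
      fix u assume "u \<in> carrier ?HD"
      then obtain z where z: "z \<in> cycles_of D d n" "u = ?q z" using cq by auto
      obtain y w where y: "y \<in> cycles_of C b n" and w: "w \<in> ?BD" and e: "z = \<iota> n y \<oplus>\<^bsub>D n\<^esub> w"
        using surj[OF z(1)] by blast
      have wZ: "w \<in> cycles_of D d n" using w D.boundaries_of_cycles by blast
      have "?q z = ?q (\<iota> n y) \<oplus>\<^bsub>?HD\<^esub> ?q w"
        using module_homD(2)[OF q(2), of "\<iota> n y" w] \<iota>Z[OF y] wZ e by simp
      also have "\<dots> = ?f (?p y)"
        using zero[OF wZ] w f[OF y] module_homD(1)[OF q(2)] \<iota>Z[OF y] by simp
      finally show "u \<in> ?f ` carrier ?HC" using z(2) y cp by blast
    qed
  qed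
  ultimately have bij: "bij_betw ?f (carrier ?HC) (carrier ?HD)" by (simp add: bij_betw_def)
  let ?g = "inv_into (carrier ?HC) ?f"
  have g: "?g u \<in> carrier ?HC" "?f (?g u) = u" if "u \<in> carrier ?HD" for u
    using bij_betw_inv_into_right[OF bij that] bij_betwE[OF bij_betw_inv_into[OF bij]] that by blast+
  have gf: "?g (?f v) = v" if "v \<in> carrier ?HC" for v by (rule bij_betw_inv_into_left[OF bij that])
  have "?g \<in> module_hom R ?HD ?HC"
  proof (rule module_homI)
    fix u v assume u: "u \<in> carrier ?HD" and v: "v \<in> carrier ?HD"
    show "?g (u \<oplus>\<^bsub>?HD\<^esub> v) = ?g u \<oplus>\<^bsub>?HC\<^esub> ?g v"
      using gf[of "?g u \<oplus>\<^bsub>?HC\<^esub> ?g v"] module_homD(2)[OF l(2) g(1)[OF u] g(1)[OF v]] g[OF u] g[OF v] by simp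
  next
    fix r u assume r: "r \<in> carrier R" and u: "u \<in> carrier ?HD"
    show "?g (r \<odot>\<^bsub>?HD\<^esub> u) = r \<odot>\<^bsub>?HC\<^esub> ?g u"
      using gf[of "r \<odot>\<^bsub>?HC\<^esub> ?g u"] module_homD(3)[OF l(2) r g(1)[OF u]] g[OF u] r by simp
  qed (rule g(1))
  then show ?thesis unfolding module_isomorphic_def using bij_betw_inv_into[OF bij] by blast
qed

text \<open>If \<open>id - d s - s d\<close> maps each filtration step into the next and the last step lies in the
  subcomplex, then the subcomplex carries the homology. A cycle \<open>z\<close> may be replaced by
  \<open>z - d (s z)\<close>, which lies one step further. A chain \<open>y\<close> whose boundary lies in the subcomplex may
  be replaced by \<open>y - d (s y) - s (d y)\<close>, which changes \<open>d y\<close> only by the boundary of \<open>s (d y)\<close>, an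
  element of the subcomplex because \<open>s\<close> preserves it. The induction is on the number of
  steps that remain.\<close>

lemma filtered_homology_isomorphic:
  assumes C: "module_complex R C b" and D: "module_complex R D d"
    and \<iota>: "\<And>n. \<iota> n \<in> module_hom R (C n) (D n)"
    and chain: "\<And>n x. x \<in> carrier (C (Suc n)) \<Longrightarrow> d n (\<iota> (Suc n) x) = \<iota> n (b n x)"
    and inj: "\<And>n. inj_on (\<iota> n) (carrier (C n))"
    and s: "\<And>n. s n \<in> module_hom R (D n) (D (Suc n))"
    and s\<iota>: "\<And>n x. x \<in> carrier (C n) \<Longrightarrow> s n (\<iota> n x) \<in> \<iota> (Suc n) ` carrier (C (Suc n))"
    and G_first: "\<And>n. carrier (D n) \<subseteq> G n (Suc 0)"
    and G_last: "\<And>n. G n (Suc n) \<subseteq> \<iota> n ` carrier (C n)"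
    and G_step: "\<And>n k x. x \<in> carrier (D (Suc n)) \<Longrightarrow> x \<in> G (Suc n) k \<Longrightarrow> 1 \<le> k \<Longrightarrow> k \<le> Suc n \<Longrightarrow>
      x \<ominus>\<^bsub>D (Suc n)\<^esub> d (Suc n) (s (Suc n) x) \<ominus>\<^bsub>D (Suc n)\<^esub> s n (d n x) \<in> G (Suc n) (Suc k)"
  shows "module_isomorphic R (homology D d n) (homology C b n)"
proof -
  interpret C: module_complex R C b by fact
  interpret D: module_complex R D d by fact
  note Ddh = module_homD[OF D.d_hom] and sh = module_homD[OF s] and \<iota>h = module_homD[OF \<iota>]
  let ?F = "\<lambda>n. \<iota> n ` carrier (C n)"
  have F: "submodule (?F n) R (D n)" for n
    by (rule submodule_image[OF C.module_C D.module_C \<iota> module.carrier_is_submodule[OF C.module_C]])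
  have surj: "\<exists>y\<in>?F n. \<exists>w\<in>boundaries_of D d n. z = y \<oplus>\<^bsub>D n\<^esub> w" if "z \<in> cycles_of D d n" for z n
  proof (cases n)
    case 0
    interpret D0: module R "D 0" by (rule D.module_C)
    have z: "z \<in> carrier (D 0)" using that 0 by simp
    have "\<zero>\<^bsub>D 0\<^esub> \<in> boundaries_of D d 0"
      using subgroup.one_closed[OF submodule.axioms(1)[OF D.boundaries_of_submodule[of 0]]] by simp
    moreover have "z = z \<oplus>\<^bsub>D 0\<^esub> \<zero>\<^bsub>D 0\<^esub>" using z by simp
    ultimately show ?thesis using G_first[of 0] G_last[of 0] z unfolding 0 by blast
  next
    case (Suc m)
    interpret Dn: module R "D n" by (rule D.module_C)
    note Bn = Dn.submoduleE[OF D.boundaries_of_submodule[of n]]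
    have claim: "\<exists>y\<in>?F n. \<exists>w\<in>boundaries_of D d n. z = y \<oplus>\<^bsub>D n\<^esub> w"
      if "1 \<le> k" "k \<le> Suc n" "z \<in> cycles_of D d n" "z \<in> G n k" for k z
      using that(2,1,3,4)
    proof (induction k arbitrary: z rule: inc_induct)
      case base
      have "\<zero>\<^bsub>D n\<^esub> \<in> boundaries_of D d n"
        using subgroup.one_closed[OF submodule.axioms(1)[OF D.boundaries_of_submodule[of n]]] by simp
      moreover have "z = z \<oplus>\<^bsub>D n\<^esub> \<zero>\<^bsub>D n\<^esub>" using D.cycles_of_closed[OF base(2)] by simp
      ultimately show ?case using G_last base(3) by blast
    next
      case (step k)
      have z: "z \<in> carrier (D n)" and dz: "d m z = \<zero>\<^bsub>D m\<^esub>"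
        using step.prems D.cycles_of_Suc[of z m] Suc by auto
      define w where "w = d n (s n z)"
      have sz: "s n z \<in> carrier (D (Suc n))" by (rule sh(1)[OF z])
      have w: "w \<in> boundaries_of D d n" unfolding w_def boundaries_of_def using sz by blast
      have wc: "w \<in> cycles_of D d n" and wD: "w \<in> carrier (D n)"
        using w D.boundaries_of_cycles D.cycles_of_closed by blast+
      have "s m (d m z) = \<zero>\<^bsub>D n\<^esub>"
        unfolding dz Suc by (rule module_hom_zero[OF D.module_C D.module_C s])
      moreover have "z \<ominus>\<^bsub>D n\<^esub> w \<ominus>\<^bsub>D n\<^esub> \<zero>\<^bsub>D n\<^esub> = z \<ominus>\<^bsub>D n\<^esub> w"
        using z wD by (simp add: a_minus_def)
      moreover have "z \<ominus>\<^bsub>D n\<^esub> w \<ominus>\<^bsub>D n\<^esub> s m (d m z) \<in> G n (Suc k)"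
        unfolding w_def Suc by (rule G_step) (use z step.hyps step.prems(1,3) Suc in auto)
      ultimately have hG: "z \<ominus>\<^bsub>D n\<^esub> w \<in> G n (Suc k)" by simp
      have hZ: "z \<ominus>\<^bsub>D n\<^esub> w \<in> cycles_of D d n"
        unfolding a_minus_def
        by (rule Dn.submoduleE(5)[OF D.cycles_of_submodule step.prems(2)
              Dn.submoduleE(3)[OF D.cycles_of_submodule wc]])
      obtain y v where y: "y \<in> ?F n" and v: "v \<in> boundaries_of D d n"
        and e: "z \<ominus>\<^bsub>D n\<^esub> w = y \<oplus>\<^bsub>D n\<^esub> v" using step.IH[OF _ hZ hG] by auto
      have yD: "y \<in> carrier (D n)" using y \<iota>h(1) by auto
      have vD: "v \<in> carrier (D n)" using v Bn(1) by blast
      have "z = (z \<ominus>\<^bsub>D n\<^esub> w) \<oplus>\<^bsub>D n\<^esub> w" using z wD by (simp add: a_minus_def Dn.a_assoc Dn.l_neg)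
      also have "\<dots> = y \<oplus>\<^bsub>D n\<^esub> (v \<oplus>\<^bsub>D n\<^esub> w)" unfolding e using yD vD wD by (simp add: Dn.a_assoc)
      finally show ?case using y Bn(5)[OF v w] by blast
    qed
    show ?thesis by (rule claim[of 1]) (use that G_first[of n] D.cycles_of_closed in auto)
  qed
  have lift: "\<exists>x\<in>?F (Suc n). d n x = d n y"
    if "1 \<le> k" "k \<le> Suc (Suc n)" "y \<in> carrier (D (Suc n))" "y \<in> G (Suc n) k" "d n y \<in> ?F n" for k y n
    using that(2,1,3,4,5)
  proof (induction k arbitrary: y rule: inc_induct)
    case base
    then show ?case using G_last by blast
  next
    case (step k)
    interpret Dn: module R "D n" by (rule D.module_C)
    interpret DS: module R "D (Suc n)" by (rule D.module_C)
    define u where "u = d (Suc n) (s (Suc n) y)"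
    define v where "v = s n (d n y)"
    have y: "y \<in> carrier (D (Suc n))" by fact
    have u: "u \<in> carrier (D (Suc n))" "d n u = \<zero>\<^bsub>D n\<^esub>"
      unfolding u_def using Ddh(1) sh(1)[OF y] D.d_d by auto
    have vF: "v \<in> ?F (Suc n)" unfolding v_def using step.prems(4) s\<iota> by auto
    then have v: "v \<in> carrier (D (Suc n))" using \<iota>h(1) by auto
    have dvF: "d n v \<in> ?F n" using vF chain module_homD(1)[OF C.d_hom] by auto
    note mm = module_hom_minus[OF D.module_C D.module_C D.d_hom]
    let ?h = "y \<ominus>\<^bsub>D (Suc n)\<^esub> u \<ominus>\<^bsub>D (Suc n)\<^esub> v"
    have "d n y \<ominus>\<^bsub>D n\<^esub> \<zero>\<^bsub>D n\<^esub> = d n y" using Ddh(1)[OF y] by (simp add: a_minus_def)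
    then have dh: "d n ?h = d n y \<ominus>\<^bsub>D n\<^esub> d n v"
      using mm[OF DS.minus_closed[OF y u(1)] v] mm[OF y u(1)] u(2) Ddh(1)[OF y] by simp
    have "d n ?h \<in> ?F n"
      unfolding dh unfolding a_minus_def
      by (rule Dn.submoduleE(5)[OF F step.prems(4) Dn.submoduleE(3)[OF F dvF]])
    moreover have "?h \<in> G (Suc n) (Suc k)"
      unfolding u_def v_def by (rule G_step) (use step y in auto)
    ultimately obtain x where x: "x \<in> ?F (Suc n)" "d n x = d n ?h"
      using step.IH[of ?h] y u v by auto
    have xD: "x \<in> carrier (D (Suc n))" using x(1) \<iota>h(1) by auto
    have "d n (x \<oplus>\<^bsub>D (Suc n)\<^esub> v) = d n y"
      unfolding Ddh(2)[OF xD v] x(2) dh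
      using Ddh(1)[OF y] Ddh(1)[OF v] by (simp add: a_minus_def Dn.a_assoc Dn.l_neg)
    moreover have "x \<oplus>\<^bsub>D (Suc n)\<^esub> v \<in> ?F (Suc n)" by (rule DS.submoduleE(5)[OF F x(1) vF])
    ultimately show ?case by blast
  qed
  show ?thesis
  proof (rule homology_isomorphicI[OF C D \<iota> chain])
    fix z assume z: "z \<in> cycles_of C b n" and bd: "\<iota> n z \<in> boundaries_of D d n"
    have zC: "z \<in> carrier (C n)" by (rule C.cycles_of_closed[OF z])
    obtain y where y: "y \<in> carrier (D (Suc n))" "\<iota> n z = d n y" using bd by (auto simp: boundaries_of_def)
    have "d n y \<in> ?F n" unfolding y(2)[symmetric] using zC by (rule imageI)
    moreover have "y \<in> G (Suc n) 1" using G_first y(1) by auto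
    ultimately have "\<exists>x\<in>?F (Suc n). d n x = d n y" by (intro lift[of 1] y(1)) simp_all
    then obtain x where x: "x \<in> carrier (C (Suc n))" "d n (\<iota> (Suc n) x) = d n y" by auto
    then have "\<iota> n (b n x) = \<iota> n z" using chain[OF x(1)] y(2) by simp
    then have "b n x = z" using inj_onD[OF inj] module_homD(1)[OF C.d_hom x(1)] zC by blast
    then show "z \<in> boundaries_of C b n" using x(1) by (auto simp: boundaries_of_def)
  next
    fix z assume z: "z \<in> cycles_of D d n"
    obtain y w where y: "y \<in> carrier (C n)" and w: "w \<in> boundaries_of D d n" and e: "z = \<iota> n y \<oplus>\<^bsub>D n\<^esub> w"
      using surj[OF z] by auto
    have "y \<in> cycles_of C b n"
    proof (cases n)
      case 0
      then show ?thesis using y by simp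
    next
      case (Suc m)
      interpret Cm: module R "C m" by (rule C.module_C)
      interpret Dm: module R "D m" by (rule D.module_C)
      have wD: "w \<in> carrier (D (Suc m))" and dw: "d m w = \<zero>\<^bsub>D m\<^esub>"
        using w D.boundaries_of_cycles[of n] D.cycles_of_Suc[of w m] unfolding Suc by auto
      have y': "y \<in> carrier (C (Suc m))" using y Suc by simp
      have "\<zero>\<^bsub>D m\<^esub> = d m z" using z D.cycles_of_Suc[of z m] unfolding Suc by simp
      also have "\<dots> = \<iota> m (b m y)"
        using e Ddh(2)[OF \<iota>h(1)[OF y'] wD] dw chain[OF y'] \<iota>h(1)[OF module_homD(1)[OF C.d_hom y']]
        unfolding Suc by simp
      finally have "\<iota> m (b m y) = \<iota> m \<zero>\<^bsub>C m\<^esub>"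
        using module_hom_zero[OF C.module_C D.module_C \<iota>] by simp
      then have "b m y = \<zero>\<^bsub>C m\<^esub>"
        using inj_onD[OF inj] module_homD(1)[OF C.d_hom y'] Cm.zero_closed by blast
      then show ?thesis using C.cycles_of_Suc[of y m] y' Suc by simp
    qed
    then show "\<exists>y\<in>cycles_of C b n. \<exists>w\<in>boundaries_of D d n. z = \<iota> n y \<oplus>\<^bsub>D n\<^esub> w"
      using w e by blast
  qed
qed


section \<open>Long cycles and contraction of their arrows\<close>

lemma U_class_permutes: "\<sigma> \<in> U_class m \<Longrightarrow> \<sigma> permutes {1..m}"
  using U_class_iff cycle_permutes by metis

text \<open>Transitivity of a long cycle on its labels. It excludes fixed points and 2-cycles, and it keeps the
  orbit of \<open>1\<close> from closing up too early.\<close>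

lemma U_class_invariant_set:
  assumes \<sigma>: "\<sigma> \<in> U_class m" and S: "S \<subseteq> {1..m}" "S \<noteq> {}" and inv: "\<And>x. x \<in> S \<Longrightarrow> \<sigma> x \<in> S"
  shows "S = {1..m}"
proof -
  obtain cs where d: "distinct cs" and s: "set cs = {1..m}" and e: "\<sigma> = cycle_of_list cs"
    using \<sigma> U_class_iff by blast
  obtain k where k: "k < length cs" "cs ! k \<in> S" using S s by (metis all_not_in_conv in_set_conv_nth subsetD)
  have *: "cs ! ((k + i) mod length cs) \<in> S" for i
  proof (induction i)
    case 0 then show ?case using k by simp
  next
    case (Suc i)
    have "(k + i) mod length cs < length cs" using k by (intro mod_less_divisor) linarith
    from cycle_nth[OF d this] show ?case
      using inv[OF Suc] e by (simp add: mod_Suc_eq)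
  qed
  have "cs ! i \<in> S" if "i < length cs" for i
  proof -
    have "(k + (length cs - k + i)) mod length cs = i" using k that by simp
    then show ?thesis using *[of "length cs - k + i"] by simp
  qed
  then have "{1..m} \<subseteq> S" unfolding s[symmetric] by (auto simp: in_set_conv_nth)
  then show ?thesis using S by blast
qed

lemma U_class_start:
  assumes "\<sigma> \<in> U_class m" "j \<in> {1..m}"
  obtains cs where "distinct (j # cs)" "set (j # cs) = {1..m}" "\<sigma> = cycle_of_list (j # cs)"
proof -
  obtain cs0 where d: "distinct cs0" and s: "set cs0 = {1..m}" and e: "\<sigma> = cycle_of_list cs0"
    using assms U_class_iff by blast
  obtain xs zs where cs0: "cs0 = xs @ j # zs" using assms(2) s split_list by metis
  have "rotate (length xs) cs0 = j # zs @ xs" using rotate_append[of xs "j # zs"] by (simp add: cs0)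
  then have "\<sigma> = cycle_of_list (j # zs @ xs)"
    using cycle_of_list_rotate_independent[OF d, of "length xs"] e by simp
  then show thesis using that[of "zs @ xs"] d s by (auto simp: cs0)
qed

lemma U_class_no_fixpoint:
  assumes "\<sigma> \<in> U_class m" "2 \<le> m" "x \<in> {1..m}" shows "\<sigma> x \<noteq> x"
proof
  assume "\<sigma> x = x"
  then have "{x} = {1..m}" by (intro U_class_invariant_set[OF assms(1)]) (use assms in auto)
  then have "card {x} = card {1..m}" by (rule arg_cong)
  then show False using assms(2) by simp
qed

lemma U_class_no_2cycle:
  assumes "\<sigma> \<in> U_class m" "3 \<le> m" "x \<in> {1..m}" shows "\<sigma> (\<sigma> x) \<noteq> x"
proof
  assume "\<sigma> (\<sigma> x) = x"
  then have "{x, \<sigma> x} = {1..m}"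
    by (intro U_class_invariant_set[OF assms(1)])
      (use assms permutes_in_image[OF U_class_permutes[OF assms(1)]] in auto)
  moreover have "card {x, \<sigma> x} \<le> 2" by (simp add: card_insert_if)
  ultimately show False using assms(2) by simp
qed

definition std_cycle :: "nat \<Rightarrow> nat \<Rightarrow> nat"
  where "std_cycle m = cycle_of_list [1..<m + 1]"

text \<open>In cycle notation starting at \<open>1\<close>, the cycle begins with \<open>1, 2, \<dots>, k\<close>.\<close>

definition ascending :: "nat \<Rightarrow> (nat \<Rightarrow> nat) \<Rightarrow> bool"
  where "ascending k \<sigma> \<longleftrightarrow> (\<forall>i. 1 \<le> i \<and> i < k \<longrightarrow> \<sigma> i = i + 1)"

lemma std_cycle_U_class: "std_cycle m \<in> U_class m"
proof -
  have "set [1..<m + 1] = {1..m}" by auto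
  then show ?thesis unfolding U_class_iff std_cycle_def by (intro exI[of _ "[1..<m + 1]"]) simp
qed

lemma std_cycle_nth:
  assumes "1 \<le> i" "i \<le> m"
  shows "std_cycle m i = (if i < m then i + 1 else 1)"
proof -
  have "std_cycle m ([1..<m + 1] ! (i - 1)) = [1..<m + 1] ! (Suc (i - 1) mod length [1..<m + 1])"
    unfolding std_cycle_def by (rule cycle_nth) (use assms in auto)
  then show ?thesis using assms by (auto simp del: upt_Suc simp: mod_if split: if_splits)
qed

lemma ascending_std_cycle: "ascending m (std_cycle m)"
  by (simp add: ascending_def std_cycle_nth)

text \<open>Injectivity leaves \<open>1\<close> as the only possible value at \<open>m\<close>.\<close>

lemma ascending_eq_std_cycle:
  assumes "\<sigma> \<in> U_class m" "ascending m \<sigma>" shows "\<sigma> = std_cycle m"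
proof -
  have "\<sigma> i = (if i < m then i + 1 else 1)" if \<sigma>: "\<sigma> permutes {1..m}" "ascending m \<sigma>" and i: "1 \<le> i" "i \<le> m"
    for \<sigma> :: "nat \<Rightarrow> nat" and i
  proof (cases "i < m")
    case True then show ?thesis using \<sigma>(2) i by (simp add: ascending_def)
  next
    case False
    then have "i = m" using i by simp
    have "\<sigma> m = 1"
    proof (rule ccontr)
      assume "\<sigma> m \<noteq> 1"
      moreover have "\<sigma> m \<in> {1..m}" using permutes_in_image[OF \<sigma>(1)] i by simp
      ultimately have l: "1 \<le> \<sigma> m - 1" "\<sigma> m - 1 < m" by auto
      then have "\<sigma> (\<sigma> m - 1) = \<sigma> m" using \<sigma>(2) by (simp add: ascending_def)
      then have "\<sigma> m - 1 = m" by (rule injD[OF permutes_inj[OF \<sigma>(1)]])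
      then show False using l by simp
    qed
    then show ?thesis using \<open>i = m\<close> by simp
  qed
  note val = this[OF U_class_permutes[OF assms(1)] assms(2)]
  show ?thesis
  proof
    fix i
    show "\<sigma> i = std_cycle m i"
    proof (cases "i \<in> {1..m}")
      case True
      then show ?thesis using val[of i] std_cycle_nth[of i m] by simp
    next
      case False
      then show ?thesis
        using permutes_not_in[OF U_class_permutes[OF assms(1)] False]
          permutes_not_in[OF U_class_permutes[OF std_cycle_U_class] False] by simp
    qed
  qed
qed

text \<open>Otherwise the orbit of \<open>1\<close> would close up inside the initial stretch and miss the label \<open>m\<close>.\<close>

lemma ascending_preimage_1:
  assumes \<sigma>: "\<sigma> \<in> U_class m" and k: "ascending k \<sigma>" "k < m" and x: "x \<in> {1..m}" "\<sigma> x = 1"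
  shows "k < x"
proof (rule ccontr)
  assume n: "\<not> k < x"
  have "\<sigma> i \<in> {1..x}" if "i \<in> {1..x}" for i
    using that n k(1) x(2) by (cases "i = x") (auto simp: ascending_def)
  then have "{1..x} = {1..m}" by (intro U_class_invariant_set[OF \<sigma>]) (use x in auto)
  then show False using x n k(2) by (metis Icc_eq_Icc atLeastAtMost_iff less_le_trans linorder_not_less)
qed

text \<open>Neither the initial stretch nor its labels are affected by a deletion beyond it.\<close>

lemma ascending_delete:
  assumes "ascending k \<sigma>" "k < j" shows "ascending k (delete_from_cycle \<sigma> j)"
  using assms unfolding ascending_def delete_from_cycle_def skip_def unskip_def Let_def by auto

text \<open>A new smallest label is inserted in front of the label \<open>1\<close> of the cycle \<open>\<sigma>\<close>, all old labels
  being raised by one. The value at \<open>0\<close> only ensures that \<open>0\<close> stays outside the support.\<close>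

definition ext_cycle :: "(nat \<Rightarrow> nat) \<Rightarrow> nat \<Rightarrow> nat"
  where "ext_cycle \<sigma> y =
    (if y = 0 then 0 else if y = 1 then 2 else if \<sigma> (y - 1) = 1 then 1 else \<sigma> (y - 1) + 1)"

lemma ext_cycle_U_class:
  assumes \<sigma>: "\<sigma> \<in> U_class m" and m: "1 \<le> m"
  shows "ext_cycle \<sigma> \<in> U_class (m + 1)"
proof -
  obtain cs where d: "distinct (1 # cs)" and s: "set (1 # cs) = {1..m}" and e: "\<sigma> = cycle_of_list (1 # cs)"
    using U_class_start[OF \<sigma>, of 1] m by auto
  let ?cs = "1 # cs" and ?ds = "1 # map Suc (1 # cs)"
  have s': "set ?ds = {1..m + 1}"
  proof -
    have "set ?ds = insert 1 (Suc ` set ?cs)" by simp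
    also have "\<dots> = {1..m + 1}" unfolding s image_Suc_atLeastAtMost by auto
    finally show ?thesis .
  qed
  have "0 \<notin> set ?cs" unfolding s by simp
  then have d': "distinct ?ds" using d by (auto simp: distinct_map)
  have "ext_cycle \<sigma> y = cycle_of_list ?ds y" for y
  proof (cases "y \<in> set ?ds")
    case False
    then have y: "y = 0 \<or> (y \<noteq> 1 \<and> y - 1 \<notin> set ?cs)" unfolding s s' by auto
    have "\<sigma> (y - 1) = y - 1" if "y - 1 \<notin> set ?cs" using that e id_outside_supp by metis
    moreover have "y - 1 \<noteq> 1" if "y - 1 \<notin> set ?cs" using that by auto
    ultimately have "ext_cycle \<sigma> y = y" using y by (auto simp: ext_cycle_def)
    then show ?thesis using id_outside_supp[OF False] by simp
  next
    case True
    then have "y = 1 \<or> y \<in> Suc ` set ?cs" by simp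
    then consider "y = 1" | k where "k < length ?cs" "y = Suc (?cs ! k)"
      by (metis imageE in_set_conv_nth)
    then show ?thesis
    proof cases
      case 1
      have "cycle_of_list ?ds (?ds ! 0) = ?ds ! (Suc 0 mod length ?ds)" by (rule cycle_nth[OF d']) simp
      then have "cycle_of_list ?ds 1 = 2" by (simp del: cycle_of_list.simps)
      then show ?thesis using 1 by (simp add: ext_cycle_def del: cycle_of_list.simps)
    next
      case (2 k)
      have nz: "?cs ! j \<noteq> 0" if "j < length ?cs" for j
        using nth_mem[OF that] \<open>0 \<notin> set ?cs\<close> by metis
      have yk: "y = ?ds ! Suc k" using 2 by (simp only: nth_Cons_Suc nth_map)
      have c: "cycle_of_list ?ds y = ?ds ! (Suc (Suc k) mod length ?ds)"
        unfolding yk by (rule cycle_nth[OF d']) (use 2 in simp)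
      have \<sigma>y: "\<sigma> (y - 1) = ?cs ! (Suc k mod length ?cs)"
        unfolding e 2(2) using cycle_nth[OF d 2(1)] by (simp del: cycle_of_list.simps)
      have y1: "y \<noteq> 0" "y \<noteq> 1" using 2 nz[OF 2(1)] by simp_all
      show ?thesis
      proof (cases "Suc k < length ?cs")
        case True
        have "?cs ! Suc k \<noteq> ?cs ! 0" using nth_eq_iff_index_eq[OF d True, of 0] by simp
        then show ?thesis unfolding c ext_cycle_def \<sigma>y using y1 True by simp
      next
        case False
        then have "Suc k = length ?cs" using 2(1) by simp
        then show ?thesis unfolding c ext_cycle_def \<sigma>y using y1 by simp
      qed
    qed
  qed
  then have "ext_cycle \<sigma> = cycle_of_list ?ds" by blast
  then show ?thesis unfolding U_class_iff using d' s' by blast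
qed

lemma ascending_ext_cycle:
  assumes "ascending k \<sigma>" shows "ascending (k + 1) (ext_cycle \<sigma>)"
  unfolding ascending_def
proof (intro allI impI)
  fix i assume i: "1 \<le> i \<and> i < k + 1"
  show "ext_cycle \<sigma> i = i + 1"
  proof (cases "i = 1")
    case True then show ?thesis by (simp add: ext_cycle_def)
  next
    case False
    then have "1 \<le> i - 1 \<and> i - 1 < k" using i by linarith
    then have "\<sigma> (i - 1) = i" using assms by (auto simp: ascending_def)
    then show ?thesis using i False by (simp add: ext_cycle_def)
  qed
qed

lemma ext_cycle_std: "1 \<le> m \<Longrightarrow> ext_cycle (std_cycle m) = std_cycle (m + 1)"
  by (rule ascending_eq_std_cycle)
    (auto intro: ext_cycle_U_class[of _ m, simplified] std_cycle_U_class
      ascending_ext_cycle[of m, simplified] ascending_std_cycle)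

text \<open>The label \<open>q = 1\<close> is excluded because deleting it would turn another label into the one in front
  of which the new point sits.\<close>

lemma delete_ext_cycle:
  assumes q: "2 \<le> q" and inj: "inj \<sigma>" and z: "\<sigma> 0 = 0"
  shows "delete_from_cycle (ext_cycle \<sigma>) (q + 1) = ext_cycle (delete_from_cycle \<sigma> q)"
proof
  have nz: "\<sigma> i \<noteq> 0" if "i \<noteq> 0" for i using z that injD[OF inj, of i 0] by auto
  fix v :: nat
  consider "v = 0" | "v = 1" | "2 \<le> v" by linarith
  then show "delete_from_cycle (ext_cycle \<sigma>) (q + 1) v = ext_cycle (delete_from_cycle \<sigma> q) v"
  proof cases
    case 3
    define u where "u = skip q (v - 1)"
    have u: "skip (q + 1) v = u + 1" "u \<noteq> q" "u \<noteq> 0" using 3 by (auto simp: u_def skip_def)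
    have E: "ext_cycle \<sigma> (w + 1) = (if \<sigma> w = 1 then 1 else \<sigma> w + 1)" if "w \<noteq> 0" for w
      using that by (simp add: ext_cycle_def)
    define t where "t = (if \<sigma> u = q then \<sigma> q else \<sigma> u)"
    have t: "t \<noteq> q" "t \<noteq> 0" using u nz q injD[OF inj, of u q] by (auto simp: t_def)
    have D: "delete_from_cycle \<sigma> q (v - 1) = unskip q t"
      by (simp add: delete_from_cycle_def Let_def u_def t_def)
    have "delete_from_cycle (ext_cycle \<sigma>) (q + 1) v = unskip (q + 1) (if t = 1 then 1 else t + 1)"
      unfolding delete_from_cycle_def Let_def u(1) using E[OF u(3)] E[of q] q by (auto simp: t_def)
    moreover have "ext_cycle (delete_from_cycle \<sigma> q) v = (if unskip q t = 1 then 1 else unskip q t + 1)"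
      using 3 D by (simp add: ext_cycle_def)
    moreover have "unskip q t = 1 \<longleftrightarrow> t = 1" using q t by (auto simp: unskip_def)
    ultimately show ?thesis using q t by (auto simp: unskip_def)
  qed (use q z in \<open>auto simp: delete_from_cycle_def ext_cycle_def skip_def unskip_def\<close>)
qed

lemma delete_ext_cycle_2:
  assumes inj: "inj \<sigma>" and z: "\<sigma> 0 = 0"
  shows "delete_from_cycle (ext_cycle \<sigma>) 2 = \<sigma>"
proof
  have nz: "\<sigma> i \<noteq> 0" if "i \<noteq> 0" for i using z that injD[OF inj, of i 0] by auto
  fix v :: nat
  consider "v = 0" | "v = 1" | "2 \<le> v" by linarith
  then show "delete_from_cycle (ext_cycle \<sigma>) 2 v = \<sigma> v"
    by cases (use z nz[of v] nz[of 1] in \<open>auto simp: delete_from_cycle_def Let_def ext_cycle_def skip_def unskip_def\<close>)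
qed

lemma delete_std_cycle:
  assumes "2 \<le> j" "j \<le> m"
  shows "delete_from_cycle (std_cycle m) j = std_cycle (m - 1)"
proof (rule ascending_eq_std_cycle)
  show "delete_from_cycle (std_cycle m) j \<in> U_class (m - 1)"
    by (rule delete_from_cycle_closed[OF std_cycle_U_class]) (use assms in auto)
  show "ascending (m - 1) (delete_from_cycle (std_cycle m) j)"
    unfolding ascending_def delete_from_cycle_def skip_def unskip_def Let_def
    using assms by (auto simp: std_cycle_nth)
qed


section \<open>Contracting two arrows\<close>

text \<open>Contraction of the arrow \<open>x \<rightarrow> \<sigma> x\<close>. Writing the factors as \<open>a\<^sub>x a\<^bsub>\<sigma> x\<^esub>\<close> covers both sums in the
  definition of the differential, whether the arrow goes up or down.\<close>

definition contract_perm :: "(nat \<Rightarrow> nat) \<Rightarrow> nat \<Rightarrow> nat \<Rightarrow> nat"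
  where "contract_perm \<sigma> x = delete_from_cycle \<sigma> (max x (\<sigma> x))"

definition contract_tuple :: "('a, 's) ring_scheme \<Rightarrow> (nat \<Rightarrow> nat) \<Rightarrow> nat \<Rightarrow> 'a list \<Rightarrow> 'a list"
  where "contract_tuple A \<sigma> x as =
    replace_delete as (min x (\<sigma> x)) (max x (\<sigma> x)) (as ! (x - 1) \<otimes>\<^bsub>A\<^esub> as ! (\<sigma> x - 1))"

definition merge_letters :: "('a, 's) ring_scheme \<Rightarrow> nat \<Rightarrow> nat \<Rightarrow> 'a list \<Rightarrow> 'a list"
  where "merge_letters A x y as = as[min x y - 1 := as ! (x - 1) \<otimes>\<^bsub>A\<^esub> as ! (y - 1)]"

text \<open>The exponent of the sign of an arrow. The sum over the arrows that go down is subtracted in the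
  differential; the summand \<open>1\<close> in the second case accounts for this.\<close>

definition edge_exp :: "nat \<Rightarrow> nat \<Rightarrow> nat"
  where "edge_exp x y = (if x < y then y else x + 1)"

text \<open>\<open>collapse \<sigma> x\<close> is the quotient map on labels when the arrow out of \<open>x\<close> is contracted;
  \<open>merge_labels\<close> is the same map before the remaining labels are closed up.\<close>

definition merge_labels :: "nat \<Rightarrow> nat \<Rightarrow> nat \<Rightarrow> nat"
  where "merge_labels x y z = (if z = max x y then min x y else z)"

definition collapse :: "(nat \<Rightarrow> nat) \<Rightarrow> nat \<Rightarrow> nat \<Rightarrow> nat"
  where "collapse \<sigma> x z = unskip (max x (\<sigma> x)) (merge_labels x (\<sigma> x) z)"

text \<open>The arrows of the contracted cycle are those of \<open>\<sigma>\<close> other than the one out of \<open>x\<close>. Together with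
  \<open>collapse_bij\<close> this turns a sum over the arrows of the contracted cycle into one over the labels
  \<open>z \<noteq> x\<close>.\<close>

lemma contract_perm_collapse:
  assumes \<sigma>: "inj \<sigma>" and x: "\<sigma> x \<noteq> x" and z: "z \<noteq> x"
  shows "contract_perm \<sigma> x (collapse \<sigma> x z) = collapse \<sigma> x (\<sigma> z)"
proof -
  let ?q = "max x (\<sigma> x)"
  have m: "merge_labels x (\<sigma> x) z \<noteq> ?q" using x by (auto simp: merge_labels_def)
  have zx: "\<sigma> z \<noteq> \<sigma> x" using injD[OF \<sigma>, of z x] z by blast
  have e: "contract_perm \<sigma> x (collapse \<sigma> x z) = unskip ?q
      (if \<sigma> (merge_labels x (\<sigma> x) z) = ?q then \<sigma> ?q else \<sigma> (merge_labels x (\<sigma> x) z))"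
    unfolding contract_perm_def collapse_def delete_from_cycle_def Let_def skip_unskip(1)[OF m] ..
  consider "x < \<sigma> x" | "\<sigma> x < x" using x by linarith
  then show ?thesis
  proof cases
    case 1
    then have q: "?q = \<sigma> x" "min x (\<sigma> x) = x" by auto
    have "\<sigma> (\<sigma> x) \<noteq> \<sigma> x" using injD[OF \<sigma>, of "\<sigma> x" x] x by blast
    then show ?thesis unfolding e unfolding collapse_def merge_labels_def q using zx by auto
  next
    case 2
    then have q: "?q = x" "min x (\<sigma> x) = \<sigma> x" by auto
    show ?thesis unfolding e unfolding collapse_def merge_labels_def q using z by auto
  qed
qed

lemma collapse_bij:
  assumes x: "x \<in> {1..m}" and \<sigma>x: "\<sigma> x \<in> {1..m}" "\<sigma> x \<noteq> x"
  shows "bij_betw (collapse \<sigma> x) ({1..m} - {x}) {1..m - 1}"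
proof -
  let ?q = "max x (\<sigma> x)" and ?p = "min x (\<sigma> x)"
  have "bij_betw (merge_labels x (\<sigma> x)) ({1..m} - {x}) ({1..m} - {?q})"
    by (rule bij_betwI[where g = "\<lambda>u. if u = x then \<sigma> x else u"])
      (use assms in \<open>auto simp: merge_labels_def max_def min_def split: if_splits\<close>)
  moreover have "bij_betw (unskip ?q) ({1..m} - {?q}) {1..m - 1}"
    by (rule bij_betwI[where g = "skip ?q"])
      (use assms in \<open>auto simp: skip_unskip skip_def unskip_def split: if_splits\<close>)
  ultimately have "bij_betw (unskip ?q \<circ> merge_labels x (\<sigma> x)) ({1..m} - {x}) {1..m - 1}"
    by (rule bij_betw_trans)
  then show ?thesis by (simp add: comp_def collapse_def[abs_def])
qed

lemma unskip_eq_iff: "u \<noteq> j \<Longrightarrow> v \<noteq> j \<Longrightarrow> unskip j u = unskip j v \<longleftrightarrow> u = v"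
  by (metis skip_unskip(1))

lemma unskip_max: "u \<noteq> j \<Longrightarrow> v \<noteq> j \<Longrightarrow> max (unskip j u) (unskip j v) = unskip j (max u v)"
  and unskip_min: "u \<noteq> j \<Longrightarrow> v \<noteq> j \<Longrightarrow> min (unskip j u) (unskip j v) = unskip j (min u v)"
  and unskip_less: "u \<noteq> j \<Longrightarrow> v \<noteq> j \<Longrightarrow> unskip j u < unskip j v \<longleftrightarrow> u < v"
  by (auto simp: unskip_def max_def min_def)

lemma skip_skip:
  "i \<noteq> j \<Longrightarrow> skip i (skip (unskip i j) v) = skip j (skip (unskip j i) v)"
  by (auto simp: skip_def unskip_def)

lemma unskip_unskip:
  "i \<noteq> j \<Longrightarrow> w \<noteq> i \<Longrightarrow> w \<noteq> j \<Longrightarrow> unskip (unskip i j) (unskip i w) = unskip (unskip j i) (unskip j w)"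
  by (auto simp: unskip_def)

lemma skip_skip_neq: "i \<noteq> j \<Longrightarrow> skip i (skip (unskip i j) v) \<notin> {i, j}"
  by (auto simp: skip_def unskip_def)

text \<open>Up to relabelling, both sides send a label to the first point after it in the cycle \<open>\<sigma>\<close> that
  is neither \<open>i\<close> nor \<open>j\<close>.\<close>

lemma delete_delete:
  assumes \<sigma>: "inj \<sigma>" and ij: "i \<noteq> j"
  shows "delete_from_cycle (delete_from_cycle \<sigma> i) (unskip i j) =
    delete_from_cycle (delete_from_cycle \<sigma> j) (unskip j i)"
proof
  fix v :: nat
  let ?D = "\<lambda>i u. if \<sigma> u = i then \<sigma> i else \<sigma> u"
  define D2 where "D2 i j u = (if ?D i u = j then ?D i j else ?D i u)" for i j u
  let ?u = "skip i (skip (unskip i j) v)"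
  have D: "?D i u \<noteq> i" if "u \<noteq> i" for i u using that injD[OF \<sigma>, of u i] by auto
  have e: "delete_from_cycle (delete_from_cycle \<sigma> i) (unskip i j) v =
      unskip (unskip i j) (unskip i (D2 i j (skip i (skip (unskip i j) v))))" if "i \<noteq> j" for i j
  proof -
    let ?u = "skip i (skip (unskip i j) v)"
    have 1: "delete_from_cycle \<sigma> i (skip (unskip i j) v) = unskip i (?D i ?u)"
      by (simp add: delete_from_cycle_def Let_def)
    have 2: "delete_from_cycle \<sigma> i (unskip i j) = unskip i (?D i j)"
      using that by (simp add: delete_from_cycle_def Let_def skip_unskip)
    have "?u \<noteq> i" by (rule skip_unskip(3))
    then have "unskip i (?D i ?u) = unskip i j \<longleftrightarrow> ?D i ?u = j"
      by (intro unskip_eq_iff D) (use that in auto)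
    then show ?thesis
      unfolding delete_from_cycle_def[of "delete_from_cycle \<sigma> i"] Let_def 1 2 D2_def by simp
  qed
  \<comment> \<open>Injectivity rules out that the walk along \<open>\<sigma>\<close> gets trapped between \<open>i\<close> and \<open>j\<close>.\<close>
  have key: "D2 i j u = D2 j i u \<and> D2 i j u \<noteq> i \<and> D2 i j u \<noteq> j" if "u \<noteq> i" "u \<noteq> j" for u
  proof -
    have "\<sigma> a = c \<Longrightarrow> \<sigma> b = c \<Longrightarrow> a = b" for a b c using injD[OF \<sigma>, of a b] by simp
    note f = this[of j i i] this[of u i i] this[of u j i] this[of u i j] this[of u j j] this[of i j i] this[of i j j]
    show ?thesis
      by (cases "\<sigma> u = i"; cases "\<sigma> u = j"; cases "\<sigma> i = j"; cases "\<sigma> j = i") (use f ij that in \<open>auto simp: D2_def\<close>)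
  qed
  have "?u \<noteq> i" "?u \<noteq> j" using skip_skip_neq[OF ij, of v] by auto
  note key = key[OF this]
  have s: "D2 i j ?u = D2 j i ?u" and n: "D2 i j ?u \<noteq> i" "D2 i j ?u \<noteq> j" using key by blast+
  show "delete_from_cycle (delete_from_cycle \<sigma> i) (unskip i j) v =
    delete_from_cycle (delete_from_cycle \<sigma> j) (unskip j i) v"
    unfolding e[OF ij] e[OF ij[symmetric]] skip_skip[OF ij, symmetric] s[symmetric]
    by (rule unskip_unskip[OF ij n])
qed

lemma replace_delete_nth':
  assumes "p < q" "1 \<le> p" "q \<le> length as" "i < length as - 1"
  shows "replace_delete as p q c ! i = as[p - 1 := c] ! (skip q (i + 1) - 1)"
  using assms by (auto simp: replace_delete_def Let_def nth_append skip_def)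

text \<open>The two products may be entered into the original tuple before anything is dropped. The right
  side then depends on the two dropped places only through the map \<open>skip q \<circ> skip (unskip q Q)\<close>,
  which by \<open>skip_skip\<close> is symmetric in \<open>q\<close> and \<open>Q\<close>.\<close>

lemma replace_delete_twice_nth:
  assumes pq: "1 \<le> p" "p < q" "q \<le> length as" and PQ: "1 \<le> P" "P < Q" "Q \<le> length as"
    and ne: "P \<noteq> q" "Q \<noteq> q" and i: "i < length as - 2"
  shows "replace_delete (replace_delete as p q c) (unskip q P) (unskip q Q) C ! i =
    as[p - 1 := c, P - 1 := C] ! (skip q (skip (unskip q Q) (i + 1)) - 1)"
proof -
  let ?bs = "replace_delete as p q c" and ?v = "skip (unskip q Q) (i + 1)"
  have l: "length ?bs = length as - 1" by (rule replace_delete_nth(1)) (use pq in auto)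
  have u: "1 \<le> unskip q P" "unskip q P < unskip q Q" "unskip q Q \<le> length as - 1"
    using pq PQ ne by (auto simp: unskip_def)
  have v: "1 \<le> ?v" "?v \<le> length as - 1" using i by (auto simp: skip_def)
  have "replace_delete ?bs (unskip q P) (unskip q Q) C ! i = ?bs[unskip q P - 1 := C] ! (?v - 1)"
    by (rule replace_delete_nth') (use u l i in auto)
  also have "\<dots> = as[p - 1 := c, P - 1 := C] ! (skip q ?v - 1)"
  proof (cases "?v = unskip q P")
    case True
    then have "skip q ?v = P" using ne skip_unskip(1) by simp
    then show ?thesis using True v l PQ by simp
  next
    case False
    then have "skip q ?v \<noteq> P" using skip_unskip(2) by metis
    moreover have "1 \<le> skip q ?v" using v by (auto simp: skip_def)
    ultimately have "skip q ?v - 1 \<noteq> P - 1" using PQ by linarith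
    moreover have "?v - 1 \<noteq> unskip q P - 1" using False v u by linarith
    moreover have "?bs ! (?v - 1) = as[p - 1 := c] ! (skip q (?v - 1 + 1) - 1)"
      by (rule replace_delete_nth') (use pq v in auto)
    ultimately show ?thesis using v by simp
  qed
  finally show ?thesis .
qed

text \<open>Two successive contractions in terms of the labels \<open>1, \<dots>, m\<close> of the original cycle: the
  second one contracts the arrow \<open>u \<rightarrow> v\<close>, which is the arrow \<open>z \<rightarrow> \<sigma> z\<close> after identifying \<open>x\<close>
  with \<open>\<sigma> x\<close>.\<close>

lemma contract_twice:
  fixes A :: "('a, 's) ring_scheme"
  assumes inj: "inj \<sigma>" and as: "length as = m"
    and x: "x \<in> {1..m}" "\<sigma> x \<in> {1..m}" "\<sigma> x \<noteq> x" and z: "z \<in> {1..m}" "\<sigma> z \<in> {1..m}" "z \<noteq> x"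
    and ne: "merge_labels x (\<sigma> x) z \<noteq> merge_labels x (\<sigma> x) (\<sigma> z)"
  defines "q \<equiv> max x (\<sigma> x)" and "u \<equiv> merge_labels x (\<sigma> x) z" and "v \<equiv> merge_labels x (\<sigma> x) (\<sigma> z)"
    and "b \<equiv> merge_letters A x (\<sigma> x) as"
  shows "contract_perm (contract_perm \<sigma> x) (collapse \<sigma> x z) =
      delete_from_cycle (delete_from_cycle \<sigma> q) (unskip q (max u v))"
    and "i < m - 2 \<Longrightarrow>
      contract_tuple A (contract_perm \<sigma> x) (collapse \<sigma> x z) (contract_tuple A \<sigma> x as) ! i =
      merge_letters A u v b ! (skip q (skip (unskip q (max u v)) (i + 1)) - 1)"
    and "length (contract_tuple A (contract_perm \<sigma> x) (collapse \<sigma> x z) (contract_tuple A \<sigma> x as)) = m - 2"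
proof -
  have uv: "u \<noteq> q" "v \<noteq> q" "u \<noteq> v" "u \<in> {1..m}" "v \<in> {1..m}"
    using x z ne by (auto simp: u_def v_def q_def merge_labels_def max_def min_def split: if_splits)
  note cc = contract_perm_collapse[OF inj x(3) z(3)]
  have c: "collapse \<sigma> x z = unskip q u" "collapse \<sigma> x (\<sigma> z) = unskip q v"
    by (simp_all add: collapse_def q_def u_def v_def)
  show "contract_perm (contract_perm \<sigma> x) (collapse \<sigma> x z) =
      delete_from_cycle (delete_from_cycle \<sigma> q) (unskip q (max u v))"
    unfolding contract_perm_def[of "contract_perm \<sigma> x"] cc unfolding c unskip_max[OF uv(1,2)]
    by (simp add: contract_perm_def q_def)
  let ?bs = "contract_tuple A \<sigma> x as"
  have pq: "1 \<le> min x (\<sigma> x)" "min x (\<sigma> x) < q" "q \<le> length as"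
    using x as by (auto simp: q_def)
  have l: "length ?bs = m - 1" "length b = m"
    unfolding contract_tuple_def by (rule replace_delete_nth(1), use pq as in \<open>auto simp: q_def b_def merge_letters_def\<close>)
  have bs: "?bs ! (unskip q w - 1) = b ! (w - 1)" if w: "w \<noteq> q" "w \<in> {1..m}" for w
  proof -
    have "1 \<le> unskip q w" "unskip q w \<le> m - 1" using w pq as by (auto simp: unskip_def)
    then have "?bs ! (unskip q w - 1) = b ! (skip q (unskip q w - 1 + 1) - 1)"
      unfolding contract_tuple_def b_def merge_letters_def q_def[symmetric]
      by (intro replace_delete_nth') (use pq as in auto)
    then show ?thesis using \<open>1 \<le> unskip q w\<close> w by (simp add: skip_unskip)
  qed
  have e: "contract_tuple A (contract_perm \<sigma> x) (collapse \<sigma> x z) ?bs =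
      replace_delete ?bs (unskip q (min u v)) (unskip q (max u v)) (b ! (u - 1) \<otimes>\<^bsub>A\<^esub> b ! (v - 1))"
    unfolding contract_tuple_def[of A "contract_perm \<sigma> x"] cc unfolding c unskip_max[OF uv(1,2)] unskip_min[OF uv(1,2)]
      bs[OF uv(1,4)] bs[OF uv(2,5)] ..
  have PQ: "1 \<le> min u v" "min u v < max u v" "max u v \<le> length as" "min u v \<noteq> q" "max u v \<noteq> q"
    using uv as by (auto simp: max_def min_def)
  show "length (contract_tuple A (contract_perm \<sigma> x) (collapse \<sigma> x z) ?bs) = m - 2"
  proof -
    have "length (contract_tuple A (contract_perm \<sigma> x) (collapse \<sigma> x z) ?bs) = m - 1 - 1"
      unfolding e by (rule replace_delete_nth(1)[OF l(1)]) (use PQ pq as in \<open>auto simp: unskip_def\<close>)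
    then show ?thesis by simp
  qed
  show "contract_tuple A (contract_perm \<sigma> x) (collapse \<sigma> x z) ?bs ! i =
      merge_letters A u v b ! (skip q (skip (unskip q (max u v)) (i + 1)) - 1)"
    if "i < m - 2"
    unfolding e unfolding contract_tuple_def q_def[symmetric] b_def merge_letters_def
    by (rule replace_delete_twice_nth[OF pq PQ]) (use that as in simp)
qed


text \<open>Contracting \<open>x \<rightarrow> y\<close> and then \<open>u \<rightarrow> v\<close> has the same effect, with the opposite sign, as contracting
  \<open>x' \<rightarrow> y'\<close> and then \<open>u' \<rightarrow> v'\<close>. All labels are those before any relabelling, and the letters are
  compared only at labels that survive.\<close>

definition same_contraction ::
  "('a, 's) ring_scheme \<Rightarrow> nat \<Rightarrow> 'a list \<Rightarrow> nat \<Rightarrow> nat \<Rightarrow> nat \<Rightarrow> nat \<Rightarrow> nat \<Rightarrow> nat \<Rightarrow> nat \<Rightarrow> nat \<Rightarrow> bool"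
  where "same_contraction A m as x y u v x' y' u' v' \<longleftrightarrow>
    max x y \<noteq> max u v \<and> max x' y' \<noteq> max u' v' \<and>
    {max x y, max u v} = {max x' y', max u' v'} \<and>
    (\<forall>w\<in>{1..m}. w \<noteq> max x y \<longrightarrow> w \<noteq> max u v \<longrightarrow>
      merge_letters A u v (merge_letters A x y as) ! (w - 1) =
      merge_letters A u' v' (merge_letters A x' y' as) ! (w - 1)) \<and>
    odd (edge_exp x y + edge_exp (unskip (max x y) u) (unskip (max x y) v) +
      (edge_exp x' y' + edge_exp (unskip (max x' y') u') (unskip (max x' y') v')))"

lemma same_contraction_sym:
  assumes "same_contraction A m as x y u v x' y' u' v'"
  shows "same_contraction A m as x' y' u' v' x y u v"
proof -
  have "w \<noteq> max x y \<and> w \<noteq> max u v" if "w \<noteq> max x' y'" "w \<noteq> max u' v'" for w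
    using assms that unfolding same_contraction_def by blast
  then show ?thesis using assms unfolding same_contraction_def by (simp add: add.commute)
qed

text \<open>The signs are opposite because the larger of the two deleted labels is lowered by one if and only
  if it is deleted last.\<close>

lemma disjoint_contractions:
  assumes "length as = m" "{x, y, z, w} \<subseteq> {1..m}" "distinct [x, y, z, w]"
  shows "same_contraction A m as x y z w z w x y"
proof -
  have e: "edge_exp a b = max a b + (if a < b then 0 else 1)" if "a \<noteq> b" for a b
    using that by (auto simp: edge_exp_def)
  have s: "edge_exp (unskip q a) (unskip q b) = unskip q (max a b) + (if a < b then 0 else 1)"
    if "a \<noteq> b" "a \<noteq> q" "b \<noteq> q" for a b q
    using that by (simp add: e unskip_eq_iff unskip_max unskip_less)
  have d: "max x y \<noteq> max z w" "z \<noteq> max x y" "w \<noteq> max x y" "x \<noteq> max z w" "y \<noteq> max z w"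
      "min x y - 1 \<noteq> min z w - 1" "min x y - 1 \<noteq> z - 1" "min x y - 1 \<noteq> w - 1" "min z w - 1 \<noteq> x - 1" "min z w - 1 \<noteq> y - 1"
    using assms by (auto simp: max_def min_def)
  have m: "1 \<le> max x y" "1 \<le> max z w" using assms(2) by auto
  have "odd (max x y + unskip (max x y) (max z w) + (max z w + unskip (max z w) (max x y)))"
    using d(1) m unfolding unskip_def by (auto simp del: max_less_iff_conj simp flip: mult_2)
  then have "odd (edge_exp x y + edge_exp (unskip (max x y) z) (unskip (max x y) w) +
      (edge_exp z w + edge_exp (unskip (max z w) x) (unskip (max z w) y)))"
  proof -
    have xyzw: "x \<noteq> y" "z \<noteq> w" using assms(3) by auto
    have par: "odd (a + i + (b + j) + (c + j + (d + i)))" if "odd (a + b + (c + d))" for a b c d i j :: nat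
      using that by auto
    assume "odd (max x y + unskip (max x y) (max z w) + (max z w + unskip (max z w) (max x y)))"
    then show ?thesis
      unfolding e[OF xyzw(1)] e[OF xyzw(2)] s[OF xyzw(2) d(2,3)] s[OF xyzw(1) d(4,5)] by (rule par)
  qed
  then show ?thesis
    unfolding same_contraction_def using d
    by (auto simp: merge_letters_def list_update_swap nth_list_update)
qed

text \<open>The word \<open>x \<rightarrow> y \<rightarrow> w\<close> shrinks to one point, labelled with the least of the three labels. Its letter
  is the triple product, bracketed in the two possible ways. The signs are compared for each of the
  six orders of the labels.\<close>

lemma adjacent_contractions:
  assumes "length as = m" "{x, y, w} \<subseteq> {1..m}" "distinct [x, y, w]"
    and assoc: "(as ! (x - 1) \<otimes>\<^bsub>A\<^esub> as ! (y - 1)) \<otimes>\<^bsub>A\<^esub> as ! (w - 1) =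
      as ! (x - 1) \<otimes>\<^bsub>A\<^esub> (as ! (y - 1) \<otimes>\<^bsub>A\<^esub> as ! (w - 1))"
  shows "same_contraction A m as x y (min x y) w y w x (min y w)"
proof -
  obtain x' y' w' where S: "x = Suc x'" "y = Suc y'" "w = Suc w'"
    using assms(2) by (cases x; cases y; cases w) auto
  have l: "x' < length as" "y' < length as" "w' < length as" and d: "x' \<noteq> y'" "x' \<noteq> w'" "y' \<noteq> w'"
    using assms S by auto
  have B: "merge_letters A (min x y) w (merge_letters A x y as) =
      as[min x' y' := as ! x' \<otimes>\<^bsub>A\<^esub> as ! y', min (min x' y') w' := (as ! x' \<otimes>\<^bsub>A\<^esub> as ! y') \<otimes>\<^bsub>A\<^esub> as ! w']"
    unfolding merge_letters_def S using l d by (simp add: min_def nth_list_update)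
  have B': "merge_letters A x (min y w) (merge_letters A y w as) =
      as[min y' w' := as ! y' \<otimes>\<^bsub>A\<^esub> as ! w', min x' (min y' w') := as ! x' \<otimes>\<^bsub>A\<^esub> (as ! y' \<otimes>\<^bsub>A\<^esub> as ! w')]"
    unfolding merge_letters_def S using l d by (simp add: min_def nth_list_update)
  have ass: "(as ! x' \<otimes>\<^bsub>A\<^esub> as ! y') \<otimes>\<^bsub>A\<^esub> as ! w' = as ! x' \<otimes>\<^bsub>A\<^esub> (as ! y' \<otimes>\<^bsub>A\<^esub> as ! w')"
    using assoc by (simp add: S)
  consider "x' < y'" "y' < w'" | "x' < w'" "w' < y'" | "y' < x'" "x' < w'" | "y' < w'" "w' < x'"
    | "w' < x'" "x' < y'" | "w' < y'" "y' < x'"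
    using d by linarith
  then show ?thesis
    unfolding same_contraction_def B B' ass unfolding S
    by cases (use l in \<open>auto simp: max_def min_def nth_list_update edge_exp_def unskip_def\<close>)
qed

text \<open>Two distinct arrows of a cycle of length at least three share at most one point, so they are either
  disjoint or adjacent in one of the two orders.\<close>

lemma contract_twice_swap:
  assumes A: "ring A" and \<sigma>: "\<sigma> \<in> U_class m" and m: "3 \<le> m" and as: "as \<in> tuples A m"
    and xz: "x \<in> {1..m}" "z \<in> {1..m}" "x \<noteq> z"
  shows "contract_perm (contract_perm \<sigma> x) (collapse \<sigma> x z) = contract_perm (contract_perm \<sigma> z) (collapse \<sigma> z x)"
    and "contract_tuple A (contract_perm \<sigma> x) (collapse \<sigma> x z) (contract_tuple A \<sigma> x as) =
      contract_tuple A (contract_perm \<sigma> z) (collapse \<sigma> z x) (contract_tuple A \<sigma> z as)"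
    and "odd (edge_exp x (\<sigma> x) + edge_exp (collapse \<sigma> x z) (contract_perm \<sigma> x (collapse \<sigma> x z)) +
      (edge_exp z (\<sigma> z) + edge_exp (collapse \<sigma> z x) (contract_perm \<sigma> z (collapse \<sigma> z x))))"
proof -
  interpret A: ring A by fact
  have len: "length as = m" using as by (simp add: tuples_def)
  have inj: "inj \<sigma>" using U_class_permutes[OF \<sigma>] by (rule permutes_inj)
  have cl: "\<sigma> a \<in> {1..m}" if "a \<in> {1..m}" for a using permutes_in_image[OF U_class_permutes[OF \<sigma>]] that by simp
  have nf: "\<sigma> a \<noteq> a" if "a \<in> {1..m}" for a using U_class_no_fixpoint[OF \<sigma> _ that] m by simp
  have n2: "\<sigma> (\<sigma> a) \<noteq> a" if "a \<in> {1..m}" for a using U_class_no_2cycle[OF \<sigma> m that] .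
  have ie: "\<sigma> a = \<sigma> b \<longleftrightarrow> a = b" for a b using inj by (simp add: inj_eq)
  let ?u = "\<lambda>x z. merge_labels x (\<sigma> x) z"
  let ?S = "\<lambda>x z. same_contraction A m as x (\<sigma> x) (?u x z) (?u x (\<sigma> z)) z (\<sigma> z) (?u z x) (?u z (\<sigma> x))"
  have assoc: "(as ! (a - 1) \<otimes>\<^bsub>A\<^esub> as ! (b - 1)) \<otimes>\<^bsub>A\<^esub> as ! (c - 1) = as ! (a - 1) \<otimes>\<^bsub>A\<^esub> (as ! (b - 1) \<otimes>\<^bsub>A\<^esub> as ! (c - 1))"
    if "a \<in> {1..m}" "b \<in> {1..m}" "c \<in> {1..m}" for a b c
    by (rule A.m_assoc) (use that tuples_nth[OF as] in auto)
  have adj: "?S a (\<sigma> a)" if a: "a \<in> {1..m}" for a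
  proof -
    have d: "distinct [a, \<sigma> a, \<sigma> (\<sigma> a)]" using nf[OF a] nf[OF cl[OF a]] n2[OF a] by auto
    have "?u a (\<sigma> a) = min a (\<sigma> a)" "?u a (\<sigma> (\<sigma> a)) = \<sigma> (\<sigma> a)" "?u (\<sigma> a) a = a"
        "?u (\<sigma> a) (\<sigma> a) = min (\<sigma> a) (\<sigma> (\<sigma> a))"
      using d by (auto simp: merge_labels_def max_def min_def)
    then show ?thesis
      using adjacent_contractions[OF len _ d, of A] assoc[OF a cl[OF a] cl[OF cl[OF a]]] a cl[OF a] cl[OF cl[OF a]]
      by simp
  qed
  have "?S x z"
  proof (cases "z = \<sigma> x \<or> x = \<sigma> z")
    case True
    then show ?thesis using adj[OF xz(1)] same_contraction_sym[OF adj[OF xz(2)]] by auto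
  next
    case False
    then have d: "distinct [x, \<sigma> x, z, \<sigma> z]" using nf[OF xz(1)] nf[OF xz(2)] xz(3) ie by auto
    then have "?u x z = z" "?u x (\<sigma> z) = \<sigma> z" "?u z x = x" "?u z (\<sigma> x) = \<sigma> x"
      by (auto simp: merge_labels_def max_def)
    then show ?thesis using disjoint_contractions[OF len _ d, of A] xz cl by simp
  qed
  note S = this[unfolded same_contraction_def]
  have ne: "?u x z \<noteq> ?u x (\<sigma> z)" if "x \<in> {1..m}" "z \<in> {1..m}" "x \<noteq> z" for x z
    using that nf[of z] nf[of x] n2[of x] ie[of z x] by (auto simp: merge_labels_def max_def min_def split: if_splits)
  note tw = contract_twice[OF inj len xz(1) cl[OF xz(1)] nf[OF xz(1)] xz(2) cl[OF xz(2)] xz(3)[symmetric] ne[OF xz]]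
    contract_twice[OF inj len xz(2) cl[OF xz(2)] nf[OF xz(2)] xz(1) cl[OF xz(1)] xz(3) ne[OF xz(2,1) xz(3)[symmetric]]]
  let ?q = "max x (\<sigma> x)" and ?Q = "max (?u x z) (?u x (\<sigma> z))"
  let ?q' = "max z (\<sigma> z)" and ?Q' = "max (?u z x) (?u z (\<sigma> x))"
  have D: "?q = ?q' \<and> ?Q = ?Q' \<or> ?q = ?Q' \<and> ?Q = ?q'" and n: "?q \<noteq> ?Q"
    using S by (auto simp: doubleton_eq_iff)
  have dd: "delete_from_cycle (delete_from_cycle \<sigma> ?q) (unskip ?q ?Q) =
      delete_from_cycle (delete_from_cycle \<sigma> ?q') (unskip ?q' ?Q')"
    using D delete_delete[OF inj n] by metis
  have ss: "skip ?q (skip (unskip ?q ?Q) i) = skip ?q' (skip (unskip ?q' ?Q') i)" for i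
    using D skip_skip[OF n] by metis
  show "contract_perm (contract_perm \<sigma> x) (collapse \<sigma> x z) = contract_perm (contract_perm \<sigma> z) (collapse \<sigma> z x)"
    unfolding tw(1) tw(4) by (rule dd)
  show "contract_tuple A (contract_perm \<sigma> x) (collapse \<sigma> x z) (contract_tuple A \<sigma> x as) =
      contract_tuple A (contract_perm \<sigma> z) (collapse \<sigma> z x) (contract_tuple A \<sigma> z as)"
  proof (rule nth_equalityI)
    show "length (contract_tuple A (contract_perm \<sigma> x) (collapse \<sigma> x z) (contract_tuple A \<sigma> x as)) =
      length (contract_tuple A (contract_perm \<sigma> z) (collapse \<sigma> z x) (contract_tuple A \<sigma> z as))"
      unfolding tw(3) tw(6) ..
    fix i assume "i < length (contract_tuple A (contract_perm \<sigma> x) (collapse \<sigma> x z) (contract_tuple A \<sigma> x as))"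
    then have i: "i < m - 2" unfolding tw(3) .
    let ?w = "skip ?q (skip (unskip ?q ?Q) (i + 1))"
    have "?w \<in> {1..m}" using i by (auto simp: skip_def)
    moreover have "?w \<noteq> ?q" "?w \<noteq> ?Q" using skip_skip_neq[OF n, of "i + 1"] by auto
    ultimately show "contract_tuple A (contract_perm \<sigma> x) (collapse \<sigma> x z) (contract_tuple A \<sigma> x as) ! i =
      contract_tuple A (contract_perm \<sigma> z) (collapse \<sigma> z x) (contract_tuple A \<sigma> z as) ! i"
      unfolding tw(2)[OF i] tw(5)[OF i] ss[symmetric] using S by blast
  qed
  show "odd (edge_exp x (\<sigma> x) + edge_exp (collapse \<sigma> x z) (contract_perm \<sigma> x (collapse \<sigma> x z)) +
      (edge_exp z (\<sigma> z) + edge_exp (collapse \<sigma> z x) (contract_perm \<sigma> z (collapse \<sigma> z x))))"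
    unfolding contract_perm_collapse[OF inj nf[OF xz(1)] xz(3)[symmetric]]
      contract_perm_collapse[OF inj nf[OF xz(2)] xz(3)]
    unfolding collapse_def using S by blast
qed


section \<open>Signs and finite sums in modules\<close>

lemma sign_smult_rules:
  assumes M: "module R M" and x: "x \<in> carrier M"
  shows "sign_smult R M i x \<in> carrier M"
    and "even i \<Longrightarrow> sign_smult R M i x = x"
    and "odd i \<Longrightarrow> sign_smult R M i x = \<ominus>\<^bsub>M\<^esub> x"
    and "sign_smult R M i (sign_smult R M j x) = sign_smult R M (i + j) x"
proof -
  interpret M: module R M by fact
  let ?e = "\<ominus>\<^bsub>R\<^esub> \<one>\<^bsub>R\<^esub>"
  have e: "?e [^]\<^bsub>R\<^esub> (i::nat) \<in> carrier R" for i by simp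
  show "sign_smult R M i x \<in> carrier M" using x by (simp add: sign_smult_def)
  show "sign_smult R M i (sign_smult R M j x) = sign_smult R M (i + j) x"
    using x by (simp add: sign_smult_def M.smult_assoc1[symmetric] M.R.nat_pow_mult)
  have sq: "?e \<otimes>\<^bsub>R\<^esub> ?e = \<one>\<^bsub>R\<^esub>" by (simp add: M.R.l_minus)
  have ev: "?e [^]\<^bsub>R\<^esub> (2 * j :: nat) = \<one>\<^bsub>R\<^esub>" for j
    by (induction j) (simp_all add: sq M.R.m_assoc)
  show "sign_smult R M i x = x" if "even i"
    using that x by (auto simp: sign_smult_def ev elim!: evenE)
  show "sign_smult R M i x = \<ominus>\<^bsub>M\<^esub> x" if "odd i"
    using that x by (auto simp: sign_smult_def ev M.smult_l_minus elim!: oddE)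
qed

lemma sign_smult_parity:
  assumes M: "module R M" and x: "x \<in> carrier M"
  shows "even (i + j) \<Longrightarrow> sign_smult R M i x = sign_smult R M j x"
    and "odd (i + j) \<Longrightarrow> sign_smult R M i x = \<ominus>\<^bsub>M\<^esub> sign_smult R M j x"
proof -
  interpret M: module R M by fact
  note s = sign_smult_rules(2,3)[OF M x]
  show "even (i + j) \<Longrightarrow> sign_smult R M i x = sign_smult R M j x"
    by (cases "even i"; cases "even j") (simp_all add: s)
  show "odd (i + j) \<Longrightarrow> sign_smult R M i x = \<ominus>\<^bsub>M\<^esub> sign_smult R M j x"
    using x by (cases "even i"; cases "even j") (simp_all add: s)
qed

lemma sign_smult_hom:
  assumes "cring R" "f \<in> module_hom R M N" "x \<in> carrier M"
  shows "f (sign_smult R M i x) = sign_smult R N i (f x)"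
  unfolding sign_smult_def by (rule module_homD(3)[OF assms(2) sign_closed[OF assms(1)] assms(3)])

lemma submodule_finsum:
  assumes M: "module R M" and N: "submodule N R M" and f: "\<And>i. i \<in> I \<Longrightarrow> f i \<in> N"
  shows "finsum M f I \<in> N"
proof -
  interpret M: module R M by fact
  note E = M.submoduleE[OF N]
  have z: "\<zero>\<^bsub>M\<^esub> \<in> N" using subgroup.one_closed[OF submodule.axioms(1)[OF N]] by simp
  show ?thesis
  proof (cases "finite I")
    case True
    then show ?thesis using f
    proof (induction I rule: finite_induct)
      case empty then show ?case using z by simp
    next
      case (insert i I)
      then have "f \<in> insert i I \<rightarrow> carrier M" using E(1) by auto
      then have "finsum M f (insert i I) = f i \<oplus>\<^bsub>M\<^esub> finsum M f I" using insert by simp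
      then show ?case using insert E(5) by simp
    qed
  qed (simp add: z M.finsum_infinite)
qed

text \<open>The sum over the off-diagonal pairs grows, with each new index \<open>a\<close>, by the pairs \<open>(a, x)\<close>
  and \<open>(x, a)\<close>, which cancel.\<close>

lemma finsum_antisymmetric:
  assumes M: "abelian_group M" and I: "finite I"
    and T: "\<And>x z. x \<in> I \<Longrightarrow> z \<in> I \<Longrightarrow> x \<noteq> z \<Longrightarrow> T x z \<in> carrier M \<and> T z x = \<ominus>\<^bsub>M\<^esub> T x z"
  shows "(\<Oplus>\<^bsub>M\<^esub>x\<in>I. \<Oplus>\<^bsub>M\<^esub>z\<in>I - {x}. T x z) = \<zero>\<^bsub>M\<^esub>"
proof -
  interpret M: abelian_group M by fact
  show ?thesis using I T
  proof (induction I rule: finite_induct)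
    case empty then show ?case by simp
  next
    case (insert a I)
    have c: "T x z \<in> carrier M" if "x \<in> insert a I" "z \<in> insert a I" "x \<noteq> z" for x z
      using insert.prems that by blast
    have n: "x \<noteq> a" if "x \<in> I" for x using that insert.hyps by blast
    have "T a x \<in> carrier M \<and> T x a \<in> carrier M" if "x \<in> I" for x
      using c[of a x] c[of x a] n[OF that] that by auto
    then have row: "T a \<in> I \<rightarrow> carrier M" and col: "(\<lambda>x. T x a) \<in> I \<rightarrow> carrier M"
      by auto
    have old: "T x \<in> I - {x} \<rightarrow> carrier M" if "x \<in> I" for x using c that by auto
    let ?S = "\<lambda>x. \<Oplus>\<^bsub>M\<^esub>z\<in>I - {x}. T x z" and ?S' = "\<lambda>x. \<Oplus>\<^bsub>M\<^esub>z\<in>insert a I - {x}. T x z"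
    have S: "?S \<in> I \<rightarrow> carrier M" using M.finsum_closed[OF old] by blast
    have inner: "?S' x = T x a \<oplus>\<^bsub>M\<^esub> ?S x" if x: "x \<in> I" for x
    proof -
      have "insert a I - {x} = insert a (I - {x})" using n[OF x] by auto
      then show ?thesis
        using M.finsum_insert[OF _ _ old[OF x], of a] insert.hyps c[of x a] x n[OF x] by simp
    qed
    have TS: "(\<lambda>x. T x a \<oplus>\<^bsub>M\<^esub> ?S x) \<in> I \<rightarrow> carrier M" using S col by (simp add: Pi_iff)
    have S': "?S' \<in> I \<rightarrow> carrier M" using TS inner by (simp add: Pi_iff)
    have a: "insert a I - {a} = I" using insert.hyps by auto
    have "finsum M ?S' (insert a I) = ?S' a \<oplus>\<^bsub>M\<^esub> finsum M ?S' I"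
      by (rule M.finsum_insert[OF insert.hyps S']) (simp only: a M.finsum_closed[OF row])
    also have "?S' a = (\<Oplus>\<^bsub>M\<^esub>z\<in>I. T a z)" unfolding a ..
    also have "finsum M ?S' I = (\<Oplus>\<^bsub>M\<^esub>x\<in>I. T x a \<oplus>\<^bsub>M\<^esub> ?S x)"
      by (rule M.finsum_cong'[OF refl TS inner])
    also have "\<dots> = (\<Oplus>\<^bsub>M\<^esub>x\<in>I. T x a) \<oplus>\<^bsub>M\<^esub> finsum M ?S I"
      by (rule M.finsum_addf[OF col S])
    also have "(\<Oplus>\<^bsub>M\<^esub>x\<in>I. \<Oplus>\<^bsub>M\<^esub>z\<in>I - {x}. T x z) = \<zero>\<^bsub>M\<^esub>"
      by (rule insert.IH) (use insert.prems in blast)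
    also have "(\<Oplus>\<^bsub>M\<^esub>z\<in>I. T a z) \<oplus>\<^bsub>M\<^esub> ((\<Oplus>\<^bsub>M\<^esub>x\<in>I. T x a) \<oplus>\<^bsub>M\<^esub> \<zero>\<^bsub>M\<^esub>) =
        (\<Oplus>\<^bsub>M\<^esub>z\<in>I. T a z) \<oplus>\<^bsub>M\<^esub> (\<Oplus>\<^bsub>M\<^esub>x\<in>I. T x a)"
      using M.finsum_closed[OF row] M.finsum_closed[OF col] by simp
    also have "\<dots> = (\<Oplus>\<^bsub>M\<^esub>z\<in>I. T a z \<oplus>\<^bsub>M\<^esub> T z a)"
      by (rule M.finsum_addf[OF row col, symmetric])
    also have "\<dots> = (\<Oplus>\<^bsub>M\<^esub>z\<in>I. \<zero>\<^bsub>M\<^esub>)"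
    proof (rule M.finsum_cong'[OF refl])
      fix z assume z: "z \<in> I"
      then have "T z a = \<ominus>\<^bsub>M\<^esub> T a z" using insert.prems[of a z] n[OF z] by simp
      then show "T a z \<oplus>\<^bsub>M\<^esub> T z a = \<zero>\<^bsub>M\<^esub>" using c[of a z] z n[OF z] by (simp add: M.r_neg)
    qed simp
    also have "\<dots> = \<zero>\<^bsub>M\<^esub>" by simp
    finally show ?case .
  qed
qed

lemma finsum_reindex_cong:
  assumes M: "abelian_group M" and h: "inj_on h U" and t: "t \<in> U \<rightarrow> carrier M"
    and g: "\<And>x. x \<in> U \<Longrightarrow> g (h x) = t x"
  shows "finsum M g (h ` U) = finsum M t U"
proof -
  interpret M: abelian_group M by fact
  have "finsum M g (h ` U) = finsum M (\<lambda>x. g (h x)) U"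
    by (rule M.finsum_reindex[OF _ h]) (use t g in \<open>auto simp: Pi_iff\<close>)
  also have "\<dots> = finsum M t U" by (rule M.finsum_cong'[OF refl t g])
  finally show ?thesis .
qed

section \<open>The differential as a sum over arrows\<close>

lemma P_elem_closed:
  "module R A \<Longrightarrow> \<sigma> \<in> U_class (n + 1) \<Longrightarrow> as \<in> tuples A (n + 1) \<Longrightarrow> P_elem R A \<sigma> as \<in> carrier (P_chain R A n)"
  using multilinD(1)[OF multilin_P_elem] by blast

lemma contract_closed:
  assumes A: "assoc_algebra R A" and \<sigma>: "\<sigma> \<in> U_class (n + 2)" and as: "as \<in> tuples A (n + 2)"
    and x: "x \<in> {1..n + 2}"
  shows "contract_perm \<sigma> x \<in> U_class (n + 1)" and "contract_tuple A \<sigma> x as \<in> tuples A (n + 1)"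
    and "P_elem R A (contract_perm \<sigma> x) (contract_tuple A \<sigma> x as) \<in> carrier (P_chain R A n)"
proof -
  interpret A: assoc_algebra R A by fact
  have y: "\<sigma> x \<in> {1..n + 2}" using permutes_in_image[OF U_class_permutes[OF \<sigma>]] x by simp
  have n: "\<sigma> x \<noteq> x" using U_class_no_fixpoint[OF \<sigma> _ x] by simp
  show 1: "contract_perm \<sigma> x \<in> U_class (n + 1)"
    unfolding contract_perm_def using delete_from_cycle_closed[OF \<sigma>, of "max x (\<sigma> x)"] x y
    by (simp add: le_max_iff_disj)
  have "contract_tuple A \<sigma> x as \<in> tuples A (n + 2 - 1)"
    unfolding contract_tuple_def
    by (rule replace_delete_tuples[OF as])
      (use x y n tuples_nth[OF as, of "x - 1"] tuples_nth[OF as, of "\<sigma> x - 1"] in auto)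
  then show 2: "contract_tuple A \<sigma> x as \<in> tuples A (n + 1)" by simp
  show "P_elem R A (contract_perm \<sigma> x) (contract_tuple A \<sigma> x as) \<in> carrier (P_chain R A n)"
    by (rule P_elem_closed[OF A.module_axioms 1 2])
qed

definition P_term ::
    "('k, 'r) ring_scheme \<Rightarrow> ('k, 'a, 's) module_scheme \<Rightarrow> nat \<Rightarrow> (nat \<Rightarrow> nat) \<Rightarrow> 'a list \<Rightarrow> nat
      \<Rightarrow> (((nat \<Rightarrow> nat) \<Rightarrow> 'k) \<times> ('a list \<Rightarrow> 'k) set \<Rightarrow> 'k) set"
  where "P_term R A n \<sigma> as x = sign_smult R (P_chain R A n) (edge_exp x (\<sigma> x))
    (P_elem R A (contract_perm \<sigma> x) (contract_tuple A \<sigma> x as))"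

lemma P_term_closed:
  assumes A: "assoc_algebra R A" and "\<sigma> \<in> U_class (n + 2)" "as \<in> tuples A (n + 2)" "x \<in> {1..n + 2}"
  shows "P_term R A n \<sigma> as x \<in> carrier (P_chain R A n)"
proof -
  interpret A: assoc_algebra R A by fact
  show ?thesis unfolding P_term_def
    by (rule sign_smult_rules(1)[OF P_chain_module[OF A.module_axioms] contract_closed(3)[OF assms]])
qed

lemma P_gen_eq:
  assumes A: "assoc_algebra R A" and \<sigma>: "\<sigma> \<in> U_class (n + 2)" and as: "as \<in> tuples A (n + 2)"
  shows "P_gen R A n \<sigma> as = finsum (P_chain R A n) (P_term R A n \<sigma> as) {1..n + 2}"
proof -
  interpret A: assoc_algebra R A by fact
  let ?Q = "P_chain R A n" and ?m = "n + 2" and ?t = "P_term R A n \<sigma> as"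
  let ?E = "\<lambda>x. P_elem R A (contract_perm \<sigma> x) (contract_tuple A \<sigma> x as)"
  note Q = P_chain_module[OF A.module_axioms, of n]
  interpret Q: module R ?Q by (rule Q)
  have y: "\<sigma> x \<in> {1..?m}" if "x \<in> {1..?m}" for x
    using permutes_in_image[OF U_class_permutes[OF \<sigma>]] that by simp
  have n: "\<sigma> x \<noteq> x" if "x \<in> {1..?m}" for x using U_class_no_fixpoint[OF \<sigma> _ that] by simp
  note tc = P_term_closed[OF A \<sigma> as] and Ec = contract_closed(3)[OF A \<sigma> as]
  let ?U = "{x \<in> {1..?m}. x < \<sigma> x}" and ?V = "{x \<in> {1..?m}. \<sigma> x < x}"
  have 1: "{(i, j). 1 \<le> i \<and> i < j \<and> j \<le> ?m \<and> \<sigma> i = j} = (\<lambda>x. (x, \<sigma> x)) ` ?U"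
    using y by (auto simp: image_iff)
  have 2: "{(i, j). 1 \<le> i \<and> i < j \<and> j \<le> ?m \<and> \<sigma> j = i} = (\<lambda>x. (\<sigma> x, x)) ` ?V"
    using y by (force simp: image_iff)
  have tU: "sign_smult R ?Q (\<sigma> x) (P_elem R A (delete_from_cycle \<sigma> (\<sigma> x))
      (replace_delete as x (\<sigma> x) (as ! (x - 1) \<otimes>\<^bsub>A\<^esub> as ! (\<sigma> x - 1)))) = ?t x" if "x \<in> ?U" for x
    using that by (simp add: P_term_def edge_exp_def contract_perm_def contract_tuple_def max_def min_def)
  have tV: "sign_smult R ?Q x (P_elem R A (delete_from_cycle \<sigma> x)
      (replace_delete as (\<sigma> x) x (as ! (x - 1) \<otimes>\<^bsub>A\<^esub> as ! (\<sigma> x - 1)))) = \<ominus>\<^bsub>?Q\<^esub> ?t x" if x: "x \<in> ?V" for x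
  proof -
    have "sign_smult R ?Q x (?E x) = \<ominus>\<^bsub>?Q\<^esub> sign_smult R ?Q (x + 1) (?E x)"
      by (rule sign_smult_parity(2)[OF Q Ec]) (use x in auto)
    then show ?thesis
      using x by (simp add: P_term_def edge_exp_def contract_perm_def contract_tuple_def max_def min_def)
  qed
  have neg: "(\<lambda>x. \<ominus>\<^bsub>?Q\<^esub> x) \<in> module_hom R ?Q ?Q"
    by (rule module_homI) (simp_all add: Q.smult_r_minus Q.minus_add)
  have tcU: "?t \<in> ?U \<rightarrow> carrier ?Q" and tcV: "?t \<in> ?V \<rightarrow> carrier ?Q" using tc by auto
  let ?g = "\<lambda>(i, j). sign_smult R ?Q j (P_elem R A (delete_from_cycle \<sigma> j)
        (replace_delete as i j (as ! (i - 1) \<otimes>\<^bsub>A\<^esub> as ! (j - 1))))"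
  have gU: "?g (x, \<sigma> x) = ?t x" if "x \<in> ?U" for x unfolding prod.case by (rule tU[OF that])
  have "finsum ?Q ?g ((\<lambda>x. (x, \<sigma> x)) ` ?U) = finsum ?Q ?t ?U"
    by (rule finsum_reindex_cong[OF Q.abelian_group_axioms _ tcU]) (simp add: inj_on_def, rule gU)
  then have S1: "finsum ?Q ?g {(i, j). 1 \<le> i \<and> i < j \<and> j \<le> ?m \<and> \<sigma> i = j} = finsum ?Q ?t ?U"
    unfolding 1 .
  let ?g' = "\<lambda>(i, j). sign_smult R ?Q j (P_elem R A (delete_from_cycle \<sigma> j)
        (replace_delete as i j (as ! (j - 1) \<otimes>\<^bsub>A\<^esub> as ! (i - 1))))"
  have gV: "?g' (\<sigma> x, x) = \<ominus>\<^bsub>?Q\<^esub> ?t x" if "x \<in> ?V" for x unfolding prod.case by (rule tV[OF that])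
  have ntV: "(\<lambda>x. \<ominus>\<^bsub>?Q\<^esub> ?t x) \<in> ?V \<rightarrow> carrier ?Q" using tcV by auto
  have "finsum ?Q ?g' ((\<lambda>x. (\<sigma> x, x)) ` ?V) = finsum ?Q (\<lambda>x. \<ominus>\<^bsub>?Q\<^esub> ?t x) ?V"
    by (rule finsum_reindex_cong[OF Q.abelian_group_axioms _ ntV]) (simp add: inj_on_def, rule gV)
  also have "\<dots> = \<ominus>\<^bsub>?Q\<^esub> finsum ?Q ?t ?V"
    by (rule module_hom_finsum[OF Q Q neg _ tcV, symmetric]) simp
  finally have S2: "finsum ?Q ?g' {(i, j). 1 \<le> i \<and> i < j \<and> j \<le> ?m \<and> \<sigma> j = i} = \<ominus>\<^bsub>?Q\<^esub> finsum ?Q ?t ?V"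
    unfolding 2 .
  have "x \<in> ?U \<union> ?V" if "x \<in> {1..?m}" for x
    using that n[OF that] by (cases "x < \<sigma> x") auto
  then have "{1..?m} = ?U \<union> ?V" by blast
  then have "finsum ?Q ?t {1..?m} = finsum ?Q ?t (?U \<union> ?V)" by (rule arg_cong)
  also have "\<dots> = finsum ?Q ?t ?U \<oplus>\<^bsub>?Q\<^esub> finsum ?Q ?t ?V"
    by (rule Q.finsum_Un_disjoint[OF _ _ _ tcU tcV]) auto
  also have "\<dots> = finsum ?Q ?t ?U \<ominus>\<^bsub>?Q\<^esub> (\<ominus>\<^bsub>?Q\<^esub> finsum ?Q ?t ?V)"
    using Q.finsum_closed[OF tcU] Q.finsum_closed[OF tcV] by (simp add: a_minus_def)
  finally show ?thesis
    unfolding P_gen_def Let_def S1 S2 by simp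
qed


lemma P_boundary_P_elem:
  assumes A: "assoc_algebra R A" and \<sigma>: "\<sigma> \<in> U_class (n + 2)" and as: "as \<in> tuples A (n + 2)"
  shows "P_boundary R A n (P_elem R A \<sigma> as) = finsum (P_chain R A n) (P_term R A n \<sigma> as) {1..n + 2}"
  using P_boundary(1)[OF A \<sigma> as] P_gen_eq[OF A \<sigma> as] by simp

lemma P_hom_zero:
  assumes A: "module R A" and Q: "module R Q" and f: "f \<in> module_hom R (P_chain R A n) Q"
    and z: "\<And>\<sigma> as. \<sigma> \<in> U_class (n + 1) \<Longrightarrow> as \<in> tuples A (n + 1) \<Longrightarrow> f (P_elem R A \<sigma> as) = \<zero>\<^bsub>Q\<^esub>"
    and x: "x \<in> carrier (P_chain R A n)"
  shows "f x = \<zero>\<^bsub>Q\<^esub>"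
proof -
  interpret Q: module R Q by fact
  have "submodule {\<zero>\<^bsub>Q\<^esub>} R Q" by (rule Q.submoduleI) auto
  note S = submodule_vimage[OF P_chain_module[OF A] Q f this]
  have "{x \<in> carrier (P_chain R A n). f x \<in> {\<zero>\<^bsub>Q\<^esub>}} = carrier (P_chain R A n)"
    by (rule P_chain_span[OF A S]) (use z P_elem_closed[OF A] in auto)
  then show ?thesis using x by blast
qed

lemma tpow_hom_eq:
  assumes A: "module R A" and Q: "module R Q"
    and f: "f \<in> module_hom R (tpow R A n) Q" and g: "g \<in> module_hom R (tpow R A n) Q"
    and e: "\<And>as. as \<in> tuples A n \<Longrightarrow> f (tpow_elem R A as) = g (tpow_elem R A as)"
    and x: "x \<in> carrier (tpow R A n)"
  shows "f x = g x"
proof -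
  interpret Q: module R Q by fact
  note T = tpow_module(1)[OF A, of n] tpow_module(2)[OF A, of _ n]
  have "submodule {\<zero>\<^bsub>Q\<^esub>} R Q" by (rule Q.submoduleI) auto
  note S = submodule_vimage[OF T(1) Q module_hom_diff[OF Q f g] this]
  have "{x \<in> carrier (tpow R A n). f x \<ominus>\<^bsub>Q\<^esub> g x \<in> {\<zero>\<^bsub>Q\<^esub>}} = carrier (tpow R A n)"
    by (rule tpow_span[OF A S])
      (use e T(2) module_homD(1)[OF g] in \<open>auto simp: a_minus_def Q.r_neg simp del: Q.add.inv_closed\<close>)
  then have "f x \<ominus>\<^bsub>Q\<^esub> g x = \<zero>\<^bsub>Q\<^esub>" using x by blast
  then show ?thesis
    using module_homD(1)[OF f x] module_homD(1)[OF g x]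
    by (metis Q.a_inv_closed Q.minus_equality Q.minus_minus a_minus_def)
qed

text \<open>The arrows of the cycle contracted at \<open>x\<close> are indexed by the labels \<open>z \<noteq> x\<close>, so \<open>d d\<close> is a sum over
  ordered pairs \<open>(x, z)\<close>, which is antisymmetric.\<close>

lemma P_boundary_boundary:
  assumes A: "assoc_algebra R A" and x: "x \<in> carrier (P_chain R A (Suc (Suc n)))"
  shows "P_boundary R A n (P_boundary R A (Suc n) x) = \<zero>\<^bsub>P_chain R A n\<^esub>"
proof -
  interpret A: assoc_algebra R A by fact
  have M: "module R A" by (rule A.module_axioms)
  have rA: "ring A" by (rule A.ring_axioms)
  let ?Q = "P_chain R A n" and ?Q1 = "P_chain R A (Suc n)" and ?m = "n + 3"
  note Q = P_chain_module[OF M, of n] and Q1 = P_chain_module[OF M, of "Suc n"]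
  interpret Q: module R ?Q by (rule Q)
  note d = P_boundary(2)[OF A]
  show ?thesis
  proof (rule P_hom_zero[OF M Q module_hom_comp[OF d d] _ x])
    fix \<sigma> as assume "\<sigma> \<in> U_class (Suc (Suc n) + 1)" "as \<in> tuples A (Suc (Suc n) + 1)"
    then have \<sigma>: "\<sigma> \<in> U_class (Suc n + 2)" "\<sigma> \<in> U_class ?m" and as: "as \<in> tuples A (Suc n + 2)" "as \<in> tuples A ?m"
      by (simp_all add: numeral_3_eq_3)
    have m: "{1..Suc n + 2} = {1..?m}" by auto
    have y: "\<sigma> x \<in> {1..?m}" if "x \<in> {1..?m}" for x
      using permutes_in_image[OF U_class_permutes[OF \<sigma>(2)]] that by simp
    have nf: "\<sigma> x \<noteq> x" if "x \<in> {1..?m}" for x using U_class_no_fixpoint[OF \<sigma>(2) _ that] by simp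
    let ?c = "\<lambda>x. contract_perm \<sigma> x" and ?a = "\<lambda>x. contract_tuple A \<sigma> x as"
    have cl: "?c x \<in> U_class (n + 2)" "?a x \<in> tuples A (n + 2)" "P_elem R A (?c x) (?a x) \<in> carrier ?Q1"
      if "x \<in> {1..?m}" for x
      using contract_closed[OF A \<sigma>(1) as(1), of x] that by simp_all
    let ?T = "\<lambda>x z. sign_smult R ?Q (edge_exp x (\<sigma> x)) (P_term R A n (?c x) (?a x) (collapse \<sigma> x z))"
    have bij: "bij_betw (collapse \<sigma> x) ({1..?m} - {x}) {1..n + 2}" if "x \<in> {1..?m}" for x
      using collapse_bij[of x ?m \<sigma>] that y nf by simp
    have pc: "P_term R A n (?c x) (?a x) i \<in> carrier ?Q" if "x \<in> {1..?m}" "i \<in> {1..n + 2}" for x i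
      by (rule P_term_closed[OF A cl(1,2)[OF that(1)] that(2)])
    have ci: "collapse \<sigma> x z \<in> {1..n + 2}" if "x \<in> {1..?m}" "z \<in> {1..?m}" "x \<noteq> z" for x z
      using bij_betw_apply[OF bij[OF that(1)], of z] that by auto
    have Tc: "?T x z \<in> carrier ?Q" if "x \<in> {1..?m}" "z \<in> {1..?m}" "x \<noteq> z" for x z
      by (rule sign_smult_rules(1)[OF Q pc[OF that(1) ci[OF that]]])
    have inner: "P_boundary R A n (P_term R A (Suc n) \<sigma> as x) = (\<Oplus>\<^bsub>?Q\<^esub>z\<in>{1..?m} - {x}. ?T x z)"
      if x: "x \<in> {1..?m}" for x
    proof -
      let ?e = "sign_smult R ?Q (edge_exp x (\<sigma> x))"
      have eh: "?e \<in> module_hom R ?Q ?Q"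
        unfolding sign_smult_def[abs_def]
        by (rule module_homI)
          (use sign_closed[OF A.R.is_cring] in \<open>simp_all add: Q.smult_r_distr Q.smult_assoc1[symmetric] A.R.m_comm\<close>)
      have "P_boundary R A n (P_term R A (Suc n) \<sigma> as x) = ?e (P_boundary R A n (P_elem R A (?c x) (?a x)))"
        unfolding P_term_def by (rule sign_smult_hom[OF A.R.is_cring d cl(3)[OF x]])
      also have "P_boundary R A n (P_elem R A (?c x) (?a x)) = finsum ?Q (P_term R A n (?c x) (?a x)) {1..n + 2}"
        by (rule P_boundary_P_elem[OF A cl(1,2)[OF x]])
      also have "{1..n + 2} = collapse \<sigma> x ` ({1..?m} - {x})"
        using bij[OF x] by (simp add: bij_betw_def)
      also have "finsum ?Q (P_term R A n (?c x) (?a x)) (collapse \<sigma> x ` ({1..?m} - {x})) =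
          (\<Oplus>\<^bsub>?Q\<^esub>z\<in>{1..?m} - {x}. P_term R A n (?c x) (?a x) (collapse \<sigma> x z))"
        by (rule finsum_reindex_cong[OF Q.abelian_group_axioms])
          (use bij[OF x] pc[OF x] ci[OF x] in \<open>auto simp: bij_betw_def\<close>)
      also have "?e \<dots> = (\<Oplus>\<^bsub>?Q\<^esub>z\<in>{1..?m} - {x}. ?T x z)"
        by (rule module_hom_finsum[OF Q Q eh]) (use pc[OF x] ci[OF x] in auto)
      finally show ?thesis .
    qed
    have "P_boundary R A n (P_boundary R A (Suc n) (P_elem R A \<sigma> as)) =
        P_boundary R A n (finsum ?Q1 (P_term R A (Suc n) \<sigma> as) {1..?m})"
      unfolding P_boundary_P_elem[OF A \<sigma>(1) as(1)] m ..
    also have "\<dots> = (\<Oplus>\<^bsub>?Q\<^esub>x\<in>{1..?m}. P_boundary R A n (P_term R A (Suc n) \<sigma> as x))"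
      by (rule module_hom_finsum[OF Q1 Q d]) (use P_term_closed[OF A \<sigma>(1) as(1)] in \<open>auto simp: m\<close>)
    also have "\<dots> = (\<Oplus>\<^bsub>?Q\<^esub>x\<in>{1..?m}. \<Oplus>\<^bsub>?Q\<^esub>z\<in>{1..?m} - {x}. ?T x z)"
    proof (rule Q.finsum_cong'[OF refl])
      show "(\<lambda>x. \<Oplus>\<^bsub>?Q\<^esub>z\<in>{1..?m} - {x}. ?T x z) \<in> {1..?m} \<rightarrow> carrier ?Q"
        by (intro funcsetI Q.finsum_closed) (use Tc in auto)
    qed (rule inner)
    also have "\<dots> = \<zero>\<^bsub>?Q\<^esub>"
    proof (rule finsum_antisymmetric[OF Q.abelian_group_axioms])
      fix x z assume x: "x \<in> {1..?m}" and z: "z \<in> {1..?m}" and xz: "x \<noteq> z"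
      note sw = contract_twice_swap[OF rA \<sigma>(2) _ as(2) x z xz]
      let ?E = "P_elem R A (contract_perm (?c x) (collapse \<sigma> x z)) (contract_tuple A (?c x) (collapse \<sigma> x z) (?a x))"
      have E: "?E \<in> carrier ?Q" by (rule contract_closed(3)[OF A cl(1,2)[OF x] ci[OF x z xz]])
      have 1: "?T x z = sign_smult R ?Q
          (edge_exp x (\<sigma> x) + edge_exp (collapse \<sigma> x z) (contract_perm \<sigma> x (collapse \<sigma> x z))) ?E"
        unfolding P_term_def by (rule sign_smult_rules(4)[OF Q E])
      have 2: "?T z x = sign_smult R ?Q
          (edge_exp z (\<sigma> z) + edge_exp (collapse \<sigma> z x) (contract_perm \<sigma> z (collapse \<sigma> z x))) ?E"
        unfolding P_term_def sw(1,2)[symmetric, simplified] by (rule sign_smult_rules(4)[OF Q E])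
      have "?T z x = \<ominus>\<^bsub>?Q\<^esub> ?T x z"
        unfolding 1 2 by (rule sign_smult_parity(2)[OF Q E]) (use sw(3) in \<open>simp add: add.commute\<close>)
      then show "?T x z \<in> carrier ?Q \<and> ?T z x = \<ominus>\<^bsub>?Q\<^esub> ?T x z" using Tc[OF x z xz] by blast
    qed simp
    finally show "P_boundary R A n (P_boundary R A (Suc n) (P_elem R A \<sigma> as)) = \<zero>\<^bsub>?Q\<^esub>" .
  qed
qed

lemma P_complex:
  assumes A: "assoc_algebra R A"
  shows "module_complex R (P_chain R A) (P_boundary R A)"
proof -
  interpret A: assoc_algebra R A by fact
  show ?thesis
    by (rule module_complex.intro)
      (rule P_chain_module[OF A.module_axioms], rule P_boundary(2)[OF A], rule P_boundary_boundary[OF A])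
qed

section \<open>The Hochschild complex inside \<open>P\<^sub>*(A)\<close>\<close>

definition hoch_incl ::
    "('k, 'r) ring_scheme \<Rightarrow> ('k, 'a, 's) module_scheme \<Rightarrow> nat
      \<Rightarrow> ('a list \<Rightarrow> 'k) set \<Rightarrow> (((nat \<Rightarrow> nat) \<Rightarrow> 'k) \<times> ('a list \<Rightarrow> 'k) set \<Rightarrow> 'k) set"
  where "hoch_incl R A n =
    tensor_elem R (free_module R (U_class (n + 1))) (tpow R A (n + 1)) (free_gen R (std_cycle (n + 1)))"

lemma hoch_incl:
  assumes A: "module R A"
  shows "hoch_incl R A n \<in> module_hom R (hoch_chain R A n) (P_chain R A n)"
    and "as \<in> tuples A (n + 1) \<Longrightarrow> hoch_incl R A n (tpow_elem R A as) = P_elem R A (std_cycle (n + 1)) as"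
proof -
  have R: "cring R" by (rule module.axioms(1)[OF A])
  show "hoch_incl R A n \<in> module_hom R (hoch_chain R A n) (P_chain R A n)"
    unfolding hoch_incl_def hoch_chain_def P_chain_def
    by (rule tensor_elem_hom(1)[OF free_module_module[OF R] tpow_module(1)[OF A] free_gen_closed[OF R std_cycle_U_class]])
  show "hoch_incl R A n (tpow_elem R A as) = P_elem R A (std_cycle (n + 1)) as" if "as \<in> tuples A (n + 1)"
    using that by (simp add: hoch_incl_def P_elem_def tuples_def)
qed

lemma multilin_zero:
  assumes M: "module R M" and Q: "module R Q" shows "multilin R M n Q (\<lambda>_. \<zero>\<^bsub>Q\<^esub>)"
proof -
  interpret Q: module R Q by fact
  show ?thesis by (rule multilinI) simp_all
qed

text \<open>The coefficient of the standard cycle gives a linear left inverse.\<close>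

lemma hoch_incl_inj:
  assumes A: "module R A" shows "inj_on (hoch_incl R A n) (carrier (hoch_chain R A n))"
proof -
  let ?T = "tpow R A (n + 1)" and ?c = "std_cycle (n + 1)"
  note T = tpow_module(1)[OF A, of "n + 1"]
  define \<mu> where "\<mu> \<sigma> as = (if \<sigma> = ?c then tpow_elem R A as else \<zero>\<^bsub>?T\<^esub>)" for \<sigma> as
  have "multilin R A (n + 1) ?T (\<mu> \<sigma>)" for \<sigma>
    using multilin_tpow_elem[OF A] multilin_zero[OF A T] by (cases "\<sigma> = ?c") (simp_all add: \<mu>_def[abs_def])
  note l = P_lift[OF A T this]
  have "P_lift R ?T \<mu> (hoch_incl R A n x) = x" if "x \<in> carrier ?T" for x
  proof (rule tpow_hom_eq[OF A T _ module_hom_id _ that])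
    show "(\<lambda>x. P_lift R ?T \<mu> (hoch_incl R A n x)) \<in> module_hom R ?T ?T"
      using module_hom_comp[OF hoch_incl(1)[OF A, of n, unfolded hoch_chain_def] l(2)] .
    show "P_lift R ?T \<mu> (hoch_incl R A n (tpow_elem R A as)) = tpow_elem R A as"
      if "as \<in> tuples A (n + 1)" for as
      using hoch_incl(2)[OF A that] l(1)[OF std_cycle_U_class that] by (simp add: \<mu>_def)
  qed
  then show ?thesis unfolding hoch_chain_def by (rule inj_on_inverseI)
qed

text \<open>The arrow out of \<open>i + 1\<close> gives the face \<open>d\<^sub>i\<close>, of sign \<open>(-1)\<^bsup>i + 2\<^esup>\<close> for \<open>i \<le> n\<close>. The arrow
  \<open>n + 2 \<rightarrow> 1\<close> goes down; it gives the last face, of sign \<open>-(-1)\<^bsup>n + 2\<^esup>\<close>.\<close>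

lemma hoch_incl_boundary:
  assumes A: "assoc_algebra R A" and x: "x \<in> carrier (hoch_chain R A (Suc n))"
  shows "P_boundary R A n (hoch_incl R A (Suc n) x) = hoch_incl R A n (hoch_boundary R A n x)"
proof -
  interpret A: assoc_algebra R A by fact
  have M: "module R A" by (rule A.module_axioms)
  let ?Q = "P_chain R A n" and ?H = "hoch_chain R A n" and ?c = "std_cycle (n + 2)"
  note Q = P_chain_module[OF M, of n]
  interpret Q: module R ?Q by (rule Q)
  have H: "module R ?H" unfolding hoch_chain_def by (rule tpow_module(1)[OF M])
  note \<iota> = hoch_incl[OF M]
  have x': "x \<in> carrier (tpow R A (n + 2))" using x by (simp add: hoch_chain_def)
  show ?thesis
  proof (rule tpow_hom_eq[OF M Q _ _ _ x'])
    show "(\<lambda>x. P_boundary R A n (hoch_incl R A (Suc n) x)) \<in> module_hom R (tpow R A (n + 2)) ?Q"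
      using module_hom_comp[OF \<iota>(1) P_boundary(2)[OF A], of n] by (simp add: hoch_chain_def)
    show "(\<lambda>x. hoch_incl R A n (hoch_boundary R A n x)) \<in> module_hom R (tpow R A (n + 2)) ?Q"
      using module_hom_comp[OF hoch_boundary(2)[OF A] \<iota>(1), of n] by (simp add: hoch_chain_def)
    fix as assume as: "as \<in> tuples A (n + 2)"
    have len: "length as = n + 2" using as by (simp add: tuples_def)
    note tc = P_term_closed[OF A std_cycle_U_class as] and cc = contract_closed[OF A std_cycle_U_class as]
    let ?g = "\<lambda>i. sign_smult R ?H i (tpow_elem R A (hoch_face A (n + 1) i as))"
    have face: "contract_perm ?c (i + 1) = std_cycle (n + 1) \<and>
        contract_tuple A ?c (i + 1) as = hoch_face A (n + 1) i as \<and> even (i + edge_exp (i + 1) (?c (i + 1)))"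
      if i: "i \<in> {0..n + 1}" for i
    proof (cases "i < n + 1")
      case True
      then have "?c (i + 1) = i + 2" using std_cycle_nth[of "i + 1" "n + 2"] by simp
      then show ?thesis
        using True delete_std_cycle[of "i + 2" "n + 2"] hoch_face_replace_delete[of as "n + 1" i A] len
        by (simp add: contract_perm_def contract_tuple_def edge_exp_def)
    next
      case False
      then have "i = n + 1" using i by simp
      moreover have "?c (n + 2) = 1" using std_cycle_nth[of "n + 2" "n + 2"] by simp
      ultimately show ?thesis
        using delete_std_cycle[of "n + 2" "n + 2"] hoch_face_last_replace_delete[of as "n + 1" A] len
        by (simp add: contract_perm_def contract_tuple_def edge_exp_def)
    qed
    have fc: "hoch_face A (n + 1) i as \<in> tuples A (n + 1)" if "i \<in> {0..n + 1}" for i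
      using cc(2)[of "i + 1"] face[OF that] that by simp
    have gc: "tpow_elem R A (hoch_face A (n + 1) i as) \<in> carrier ?H" if "i \<in> {0..n + 1}" for i
      unfolding hoch_chain_def by (rule tpow_module(2)[OF M fc[OF that]])
    have summand: "P_term R A n ?c as (i + 1) = hoch_incl R A n (?g i)" if i: "i \<in> {0..n + 1}" for i
    proof -
      have "hoch_incl R A n (?g i) = sign_smult R ?Q i (P_elem R A (std_cycle (n + 1)) (hoch_face A (n + 1) i as))"
        using sign_smult_hom[OF A.R.is_cring \<iota>(1) gc[OF i]] \<iota>(2)[OF fc[OF i]] by simp
      also have "\<dots> = sign_smult R ?Q (edge_exp (i + 1) (?c (i + 1))) (P_elem R A (std_cycle (n + 1)) (hoch_face A (n + 1) i as))"
        by (rule sign_smult_parity(1)[OF Q P_elem_closed[OF M std_cycle_U_class fc[OF i]]]) (use face[OF i] in blast)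
      finally show ?thesis using face[OF i] by (simp add: P_term_def)
    qed
    have im: "{1..n + 2} = (\<lambda>i. i + 1) ` {0..n + 1}" using image_add_atLeastAtMost'[of 1 0 "n + 1"] by simp
    have ic: "(\<lambda>i. hoch_incl R A n (?g i)) \<in> {0..n + 1} \<rightarrow> carrier ?Q"
      using module_homD(1)[OF \<iota>(1)] sign_smult_rules(1)[OF H gc] by blast
    have "P_boundary R A n (hoch_incl R A (Suc n) (tpow_elem R A as)) = P_boundary R A n (P_elem R A ?c as)"
      using \<iota>(2)[of as "Suc n"] as by simp
    also have "\<dots> = finsum ?Q (P_term R A n ?c as) {1..n + 2}"
      by (rule P_boundary_P_elem[OF A std_cycle_U_class as])
    also have "\<dots> = (\<Oplus>\<^bsub>?Q\<^esub>i\<in>{0..n + 1}. hoch_incl R A n (?g i))"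
      unfolding im by (rule finsum_reindex_cong[OF Q.abelian_group_axioms _ ic]) (simp, rule summand)
    also have "\<dots> = hoch_incl R A n (hoch_gen R A n as)"
      unfolding hoch_gen_def
      by (rule module_hom_finsum[OF H Q \<iota>(1), symmetric]) (use sign_smult_rules(1)[OF H gc] in auto)
    also have "\<dots> = hoch_incl R A n (hoch_boundary R A n (tpow_elem R A as))"
      using hoch_boundary(1)[OF A as] by simp
    finally show "P_boundary R A n (hoch_incl R A (Suc n) (tpow_elem R A as)) =
      hoch_incl R A n (hoch_boundary R A n (tpow_elem R A as))" .
  qed
qed

lemma hoch_complex:
  assumes A: "assoc_algebra R A"
  shows "module_complex R (hoch_chain R A) (hoch_boundary R A)"
proof -
  interpret A: assoc_algebra R A by fact
  have M: "module R A" by (rule A.module_axioms)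
  note b = hoch_boundary(2)[OF A] and \<iota> = hoch_incl[OF M] and ch = hoch_incl_boundary[OF A]
  have H: "module R (hoch_chain R A n)" for n unfolding hoch_chain_def by (rule tpow_module(1)[OF M])
  have "hoch_boundary R A n (hoch_boundary R A (Suc n) x) = \<zero>\<^bsub>hoch_chain R A n\<^esub>"
    if x: "x \<in> carrier (hoch_chain R A (Suc (Suc n)))" for n x
  proof -
    interpret H: module R "hoch_chain R A n" by (rule H)
    note bx = module_homD(1)[OF b x]
    have "hoch_incl R A n (hoch_boundary R A n (hoch_boundary R A (Suc n) x)) =
        P_boundary R A n (P_boundary R A (Suc n) (hoch_incl R A (Suc (Suc n)) x))"
      using ch[OF bx] ch[OF x] by simp
    also have "\<dots> = \<zero>\<^bsub>P_chain R A n\<^esub>" by (rule P_boundary_boundary[OF A module_homD(1)[OF \<iota>(1) x]])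
    also have "\<dots> = hoch_incl R A n \<zero>\<^bsub>hoch_chain R A n\<^esub>"
      using module_hom_zero[OF H P_chain_module[OF M] \<iota>(1)] by simp
    finally show ?thesis
      using inj_onD[OF hoch_incl_inj[OF M]] module_homD(1)[OF b bx] H.zero_closed by blast
  qed
  then show ?thesis by (intro module_complex.intro H b)
qed

section \<open>Inserting a unit\<close>

lemma multilin_Cons:
  assumes M: "module R M" and \<mu>: "multilin R M (Suc n) Q \<mu>" and c: "c \<in> carrier M"
  shows "multilin R M n Q (\<lambda>as. \<mu> (c # as))"
proof -
  interpret M: module R M by fact
  have t: "c # as \<in> tuples M (Suc n)" if "as \<in> tuples M n" for as using that c by (auto simp: tuples_def)
  show ?thesis
  proof (rule multilinI)
    fix as i x y assume "as \<in> tuples M n" "i < n" "x \<in> carrier M" "y \<in> carrier M"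
    then show "\<mu> (c # as[i := x \<oplus>\<^bsub>M\<^esub> y]) = \<mu> (c # as[i := x]) \<oplus>\<^bsub>Q\<^esub> \<mu> (c # as[i := y])"
      using multilinD(2)[OF \<mu> t, of as "Suc i" x y] by simp
  next
    fix as i r x assume "as \<in> tuples M n" "i < n" "r \<in> carrier R" "x \<in> carrier M"
    then show "\<mu> (c # as[i := r \<odot>\<^bsub>M\<^esub> x]) = r \<odot>\<^bsub>Q\<^esub> \<mu> (c # as[i := x])"
      using multilinD(3)[OF \<mu> t, of as "Suc i" r x] by simp
  qed (rule multilinD(1)[OF \<mu> t])
qed

definition insert_unit ::
    "('k, 'r) ring_scheme \<Rightarrow> ('k, 'a, 's) module_scheme \<Rightarrow> nat
      \<Rightarrow> (((nat \<Rightarrow> nat) \<Rightarrow> 'k) \<times> ('a list \<Rightarrow> 'k) set \<Rightarrow> 'k) set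
      \<Rightarrow> (((nat \<Rightarrow> nat) \<Rightarrow> 'k) \<times> ('a list \<Rightarrow> 'k) set \<Rightarrow> 'k) set"
  where "insert_unit R A n =
    P_lift R (P_chain R A (Suc n)) (\<lambda>\<sigma> as. P_elem R A (ext_cycle \<sigma>) (\<one>\<^bsub>A\<^esub> # as))"

lemma insert_unit:
  assumes A: "assoc_algebra R A"
  shows "insert_unit R A n \<in> module_hom R (P_chain R A n) (P_chain R A (Suc n))"
    and "\<sigma> \<in> U_class (n + 1) \<Longrightarrow> as \<in> tuples A (n + 1) \<Longrightarrow>
      insert_unit R A n (P_elem R A \<sigma> as) = P_elem R A (ext_cycle \<sigma>) (\<one>\<^bsub>A\<^esub> # as)"
proof -
  interpret A: assoc_algebra R A by fact
  have M: "module R A" by (rule A.module_axioms)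
  have "multilin R A (n + 1) (P_chain R A (Suc n)) (\<lambda>as. P_elem R A (ext_cycle \<sigma>) (\<one>\<^bsub>A\<^esub> # as))"
    if "\<sigma> \<in> U_class (n + 1)" for \<sigma>
    using multilin_Cons[OF M, of "n + 1" "P_chain R A (Suc n)" "P_elem R A (ext_cycle \<sigma>)" "\<one>\<^bsub>A\<^esub>"]
      multilin_P_elem[OF M, of "ext_cycle \<sigma>" "Suc n"] ext_cycle_U_class[OF that] by simp
  note l = P_lift[where \<mu> = "\<lambda>\<sigma> as. P_elem R A (ext_cycle \<sigma>) (\<one>\<^bsub>A\<^esub> # as)",
      OF M P_chain_module[OF M] this]
  show "insert_unit R A n \<in> module_hom R (P_chain R A n) (P_chain R A (Suc n))"
    unfolding insert_unit_def by (rule l(2))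
  show "\<sigma> \<in> U_class (n + 1) \<Longrightarrow> as \<in> tuples A (n + 1) \<Longrightarrow>
      insert_unit R A n (P_elem R A \<sigma> as) = P_elem R A (ext_cycle \<sigma>) (\<one>\<^bsub>A\<^esub> # as)"
    unfolding insert_unit_def by (rule l(1))
qed

lemma insert_unit_hoch_incl:
  assumes A: "assoc_algebra R A" and x: "x \<in> carrier (hoch_chain R A n)"
  shows "insert_unit R A n (hoch_incl R A n x) \<in> hoch_incl R A (Suc n) ` carrier (hoch_chain R A (Suc n))"
proof -
  interpret A: assoc_algebra R A by fact
  have M: "module R A" by (rule A.module_axioms)
  note s = insert_unit[OF A] and \<iota> = hoch_incl[OF M] and P = P_chain_module[OF M]
  have H: "module R (hoch_chain R A n)" for n unfolding hoch_chain_def by (rule tpow_module(1)[OF M])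
  let ?F = "hoch_incl R A (Suc n) ` carrier (hoch_chain R A (Suc n))"
  have F: "submodule ?F R (P_chain R A (Suc n))"
    by (rule submodule_image[OF H P \<iota>(1) module.carrier_is_submodule[OF H]])
  note S = submodule_vimage[OF H P module_hom_comp[OF \<iota>(1)[of n] s(1)] F]
  have "{x \<in> carrier (hoch_chain R A n). insert_unit R A n (hoch_incl R A n x) \<in> ?F} = carrier (tpow R A (n + 1))"
  proof (rule tpow_span[OF M])
    show "submodule {x \<in> carrier (hoch_chain R A n). insert_unit R A n (hoch_incl R A n x) \<in> ?F} R (tpow R A (n + 1))"
      using S by (simp add: hoch_chain_def)
    fix as assume as: "as \<in> tuples A (n + 1)"
    then have as': "\<one>\<^bsub>A\<^esub> # as \<in> tuples A (Suc n + 1)" by (auto simp: tuples_def)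
    have "insert_unit R A n (hoch_incl R A n (tpow_elem R A as)) = hoch_incl R A (Suc n) (tpow_elem R A (\<one>\<^bsub>A\<^esub> # as))"
      using \<iota>(2)[OF as] \<iota>(2)[OF as'] s(2)[OF std_cycle_U_class as] ext_cycle_std[of "n + 1"] by simp
    then show "tpow_elem R A as \<in> {x \<in> carrier (hoch_chain R A n). insert_unit R A n (hoch_incl R A n x) \<in> ?F}"
      using tpow_module(2)[OF M as] tpow_module(2)[OF M as'] by (simp add: hoch_chain_def)
  qed
  then show ?thesis using x by (auto simp: hoch_chain_def)
qed

lemma replace_delete_Cons:
  "1 \<le> p \<Longrightarrow> 1 \<le> q \<Longrightarrow> replace_delete (c # as) (Suc p) (Suc q) v = c # replace_delete as p q v"
  by (cases p; cases q) (simp_all add: replace_delete_def Let_def)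

definition P_filtration ::
    "('k, 'r) ring_scheme \<Rightarrow> ('k, 'a, 's) module_scheme \<Rightarrow> nat \<Rightarrow> nat
      \<Rightarrow> (((nat \<Rightarrow> nat) \<Rightarrow> 'k) \<times> ('a list \<Rightarrow> 'k) set \<Rightarrow> 'k) set set"
  where "P_filtration R A n k = submodule_span R (P_chain R A n)
    {P_elem R A \<sigma> as |\<sigma> as. \<sigma> \<in> U_class (n + 1) \<and> ascending k \<sigma> \<and> as \<in> tuples A (n + 1)}"

lemma P_filtration:
  assumes A: "module R A"
  shows "submodule (P_filtration R A n k) R (P_chain R A n)"
    and "\<sigma> \<in> U_class (n + 1) \<Longrightarrow> ascending k \<sigma> \<Longrightarrow> as \<in> tuples A (n + 1) \<Longrightarrow>
      P_elem R A \<sigma> as \<in> P_filtration R A n k"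
    and "module R Q \<Longrightarrow> f \<in> module_hom R (P_chain R A n) Q \<Longrightarrow> submodule N R Q \<Longrightarrow>
      (\<And>\<sigma> as. \<sigma> \<in> U_class (n + 1) \<Longrightarrow> ascending k \<sigma> \<Longrightarrow> as \<in> tuples A (n + 1) \<Longrightarrow> f (P_elem R A \<sigma> as) \<in> N) \<Longrightarrow>
      x \<in> P_filtration R A n k \<Longrightarrow> f x \<in> N"
proof -
  let ?S = "{P_elem R A \<sigma> as |\<sigma> as. \<sigma> \<in> U_class (n + 1) \<and> ascending k \<sigma> \<and> as \<in> tuples A (n + 1)}"
  note P = P_chain_module[OF A, of n]
  have S: "?S \<subseteq> carrier (P_chain R A n)" using P_elem_closed[OF A] by blast
  show "submodule (P_filtration R A n k) R (P_chain R A n)"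
    unfolding P_filtration_def by (rule submodule_span(1)[OF P S])
  show "P_elem R A \<sigma> as \<in> P_filtration R A n k"
    if "\<sigma> \<in> U_class (n + 1)" "ascending k \<sigma>" "as \<in> tuples A (n + 1)"
    unfolding P_filtration_def using subsetD[OF submodule_span(2)[OF P S]] that by blast
  show "f x \<in> N" if "module R Q" "f \<in> module_hom R (P_chain R A n) Q" "submodule N R Q"
    "\<And>\<sigma> as. \<sigma> \<in> U_class (n + 1) \<Longrightarrow> ascending k \<sigma> \<Longrightarrow> as \<in> tuples A (n + 1) \<Longrightarrow> f (P_elem R A \<sigma> as) \<in> N"
    "x \<in> P_filtration R A n k"
    by (rule submodule_span_hom[OF P that(1-3) S _ that(5)[unfolded P_filtration_def]]) (use that(4) in blast)
qed

lemma P_filtration_first: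
  assumes A: "module R A" shows "carrier (P_chain R A n) \<subseteq> P_filtration R A n (Suc 0)"
  using P_chain_span[OF A P_filtration(1)[OF A, of n "Suc 0"]] P_filtration(2)[OF A, of _ n "Suc 0"]
  by (auto simp: ascending_def)

text \<open>A long cycle whose initial stretch has full length is the standard one.\<close>

lemma P_filtration_last:
  assumes A: "module R A"
  shows "P_filtration R A n (Suc n) \<subseteq> hoch_incl R A n ` carrier (hoch_chain R A n)"
proof
  fix x assume x: "x \<in> P_filtration R A n (Suc n)"
  have H: "module R (hoch_chain R A n)" unfolding hoch_chain_def by (rule tpow_module(1)[OF A])
  note P = P_chain_module[OF A, of n]
  show "x \<in> hoch_incl R A n ` carrier (hoch_chain R A n)"
  proof (rule P_filtration(3)[OF A P module_hom_id _ _ x])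
    show "submodule (hoch_incl R A n ` carrier (hoch_chain R A n)) R (P_chain R A n)"
      by (rule submodule_image[OF H P hoch_incl(1)[OF A] module.carrier_is_submodule[OF H]])
    fix \<sigma> as assume \<sigma>: "\<sigma> \<in> U_class (n + 1)" "ascending (Suc n) \<sigma>" and as: "as \<in> tuples A (n + 1)"
    have "\<sigma> = std_cycle (n + 1)" using ascending_eq_std_cycle[OF \<sigma>(1)] \<sigma>(2) by simp
    then have "P_elem R A \<sigma> as = hoch_incl R A n (tpow_elem R A as)" using hoch_incl(2)[OF A as] by simp
    then show "P_elem R A \<sigma> as \<in> hoch_incl R A n ` carrier (hoch_chain R A n)"
      using tpow_module(2)[OF A as] by (simp add: hoch_chain_def)
  qed
qed

text \<open>Only the arrow into the label \<open>1\<close> contributes: the unit is adjacent to it, so contracting this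
  arrow before or after the insertion gives different letters.\<close>

lemma insert_unit_homotopy:
  assumes A: "assoc_algebra R A" and x: "x \<in> P_filtration R A (Suc n) k" and k: "k \<le> Suc n"
  shows "x \<ominus>\<^bsub>P_chain R A (Suc n)\<^esub> P_boundary R A (Suc n) (insert_unit R A (Suc n) x)
      \<ominus>\<^bsub>P_chain R A (Suc n)\<^esub> insert_unit R A n (P_boundary R A n x) \<in> P_filtration R A (Suc n) (Suc k)"
proof -
  interpret A: assoc_algebra R A by fact
  have M: "module R A" by (rule A.module_axioms)
  let ?Q = "P_chain R A (Suc n)" and ?G = "P_filtration R A (Suc n) (Suc k)" and ?m = "n + 2"
  note P = P_chain_module[OF M]
  note Q = P[of "Suc n"]
  interpret Q: module R ?Q by (rule Q)
  note s = insert_unit[OF A] and d = P_boundary(2)[OF A] and G = P_filtration(1)[OF M, of "Suc n" "Suc k"] P_filtration(2)[OF M, of _ "Suc n" "Suc k"]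
  note QE = Q.submoduleE[OF G(1)]
  have hom: "(\<lambda>x. x \<ominus>\<^bsub>?Q\<^esub> P_boundary R A (Suc n) (insert_unit R A (Suc n) x)
      \<ominus>\<^bsub>?Q\<^esub> insert_unit R A n (P_boundary R A n x)) \<in> module_hom R ?Q ?Q"
    by (rule module_hom_diff[OF Q module_hom_diff[OF Q module_hom_id module_hom_comp[OF s(1) d]] module_hom_comp[OF d s(1)]])
  show ?thesis
  proof (rule P_filtration(3)[OF M Q hom G(1) _ x])
    fix \<sigma> as assume "\<sigma> \<in> U_class (Suc n + 1)" and asc: "ascending k \<sigma>" and "as \<in> tuples A (Suc n + 1)"
    then have \<sigma>: "\<sigma> \<in> U_class ?m" and as: "as \<in> tuples A ?m" by simp_all
    let ?\<tau> = "ext_cycle \<sigma>" and ?bs = "\<one>\<^bsub>A\<^esub> # as"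
    have \<tau>: "?\<tau> \<in> U_class (Suc n + 2)" using ext_cycle_U_class[OF \<sigma>] by simp
    have bs: "?bs \<in> tuples A (Suc n + 2)" using as by (auto simp: tuples_def)
    have len: "length as = ?m" using as by (simp add: tuples_def)
    have perm: "\<sigma> permutes {1..?m}" by (rule U_class_permutes[OF \<sigma>])
    have inj: "inj \<sigma>" and \<sigma>0: "\<sigma> 0 = 0" using permutes_inj[OF perm] permutes_not_in[OF perm, of 0] by auto
    have y: "\<sigma> x \<in> {1..?m}" if "x \<in> {1..?m}" for x using permutes_in_image[OF perm] that by simp
    have nf: "\<sigma> x \<noteq> x" if "x \<in> {1..?m}" for x using U_class_no_fixpoint[OF \<sigma> _ that] by simp
    note cc = contract_closed[OF A \<sigma> as] and tc = P_term_closed[OF A \<sigma> as] and tc' = P_term_closed[OF A \<tau> bs]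
    let ?E = "P_elem R A \<sigma> as"
    have E: "?E \<in> carrier ?Q" using P_elem_closed[OF M, of \<sigma> "Suc n" as] \<sigma> as by simp
    let ?t = "\<lambda>x. P_term R A (Suc n) ?\<tau> ?bs (Suc x)" and ?u = "\<lambda>x. insert_unit R A n (P_term R A n \<sigma> as x)"
    have t: "?t \<in> {1..?m} \<rightarrow> carrier ?Q" using tc' by auto
    have u: "?u \<in> {1..?m} \<rightarrow> carrier ?Q" using module_homD(1)[OF s(1) tc] by auto
    have uE: "?u x = sign_smult R ?Q (edge_exp x (\<sigma> x))
        (P_elem R A (ext_cycle (contract_perm \<sigma> x)) (\<one>\<^bsub>A\<^esub> # contract_tuple A \<sigma> x as))" if x: "x \<in> {1..?m}" for x
      unfolding P_term_def sign_smult_hom[OF A.R.is_cring s(1) cc(3)[OF x]] s(2)[OF cc(1,2)[OF x]] ..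
    \<comment> \<open>The arrow out of the new point multiplies by the unit from the left.\<close>
    have first: "P_term R A (Suc n) ?\<tau> ?bs 1 = ?E"
    proof -
      have "?\<tau> 1 = 2" by (simp add: ext_cycle_def)
      moreover have "replace_delete ?bs 1 2 (\<one>\<^bsub>A\<^esub> \<otimes>\<^bsub>A\<^esub> as ! 0) = as"
        using tuples_nth[OF as, of 0] len by (cases as) (simp_all add: replace_delete_def)
      ultimately have "P_term R A (Suc n) ?\<tau> ?bs 1 = sign_smult R ?Q 2 ?E"
        using delete_ext_cycle_2[OF inj \<sigma>0]
        by (simp add: P_term_def edge_exp_def contract_perm_def contract_tuple_def numeral_2_eq_2)
      then show ?thesis using sign_smult_rules(2)[OF Q E, of 2] by simp
    qed
    have ext_perm: "contract_perm ?\<tau> (Suc x) = ext_cycle (contract_perm \<sigma> x)" if x: "x \<in> {1..?m}" for x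
    proof -
      have "max (Suc x) (?\<tau> (Suc x)) = max x (\<sigma> x) + 1"
        using x y[OF x] nf[OF x] by (auto simp: ext_cycle_def)
      moreover have "2 \<le> max x (\<sigma> x)" using x y[OF x] nf[OF x] by (auto simp: max_def)
      ultimately show ?thesis unfolding contract_perm_def using delete_ext_cycle[OF _ inj \<sigma>0] by simp
    qed
    have "?t x \<oplus>\<^bsub>?Q\<^esub> ?u x \<in> ?G" if x: "x \<in> {1..?m}" for x
    proof (cases "\<sigma> x = 1")
      \<comment> \<open>Any other arrow lies inside the old word and has opposite signs in \<open>d s\<close> and \<open>s d\<close>.\<close>
      case False
      have \<tau>x: "?\<tau> (Suc x) = Suc (\<sigma> x)" using False x by (simp add: ext_cycle_def)
      have "contract_tuple A ?\<tau> (Suc x) ?bs = \<one>\<^bsub>A\<^esub> # contract_tuple A \<sigma> x as"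
        unfolding contract_tuple_def \<tau>x using x y[OF x]
        by (simp add: replace_delete_Cons le_max_iff_disj nth_Cons' max_Suc_Suc min_Suc_Suc)
      moreover have "edge_exp (Suc x) (?\<tau> (Suc x)) = Suc (edge_exp x (\<sigma> x))"
        unfolding \<tau>x by (simp add: edge_exp_def)
      moreover have "P_elem R A (ext_cycle (contract_perm \<sigma> x)) (\<one>\<^bsub>A\<^esub> # contract_tuple A \<sigma> x as) \<in> carrier ?Q"
        using contract_closed(3)[OF A \<tau> bs, of "Suc x"] x ext_perm[OF x] calculation(1) by simp
      ultimately have "?t x = \<ominus>\<^bsub>?Q\<^esub> ?u x"
        unfolding uE[OF x] P_term_def[of R A "Suc n"] ext_perm[OF x]
        using sign_smult_parity(2)[OF Q, of _ "Suc (edge_exp x (\<sigma> x))" "edge_exp x (\<sigma> x)"] by simp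
      then have "?t x \<oplus>\<^bsub>?Q\<^esub> ?u x = \<zero>\<^bsub>?Q\<^esub>"
        using Q.l_neg[OF module_homD(1)[OF s(1) tc[OF x]]] by simp
      then show ?thesis using subgroup.one_closed[OF submodule.axioms(1)[OF G(1)]] by simp
    next
      case True
      have kx: "k < x" by (rule ascending_preimage_1[OF \<sigma> asc _ x True]) (use k in simp)
      have max: "max x (\<sigma> x) = x" using True x by simp
      have "ascending k (contract_perm \<sigma> x)"
        unfolding contract_perm_def max by (rule ascending_delete[OF asc kx])
      then have asc': "ascending (Suc k) (ext_cycle (contract_perm \<sigma> x))"
        using ascending_ext_cycle by fastforce
      have Sx: "Suc x \<in> {1..Suc n + 2}" using x by simp
      have c\<tau>: "ext_cycle (contract_perm \<sigma> x) \<in> U_class (Suc n + 1)"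
        using contract_closed(1)[OF A \<tau> bs Sx] ext_perm[OF x] by simp
      have sG: "sign_smult R ?Q i v \<in> ?G" if "v \<in> ?G" for i v
        unfolding sign_smult_def by (rule QE(4)[OF sign_closed[OF A.R.is_cring] that])
      have "?t x \<in> ?G"
        unfolding P_term_def ext_perm[OF x]
        by (rule sG[OF G(2)[OF c\<tau> asc' contract_closed(2)[OF A \<tau> bs Sx]]])
      moreover have "?u x \<in> ?G"
        unfolding uE[OF x] by (rule sG[OF G(2)[OF c\<tau> asc']]) (use cc(2)[OF x] in \<open>auto simp: tuples_def\<close>)
      ultimately show ?thesis by (rule QE(5))
    qed
    then have "(\<Oplus>\<^bsub>?Q\<^esub>x\<in>{1..?m}. ?t x \<oplus>\<^bsub>?Q\<^esub> ?u x) \<in> ?G" by (rule submodule_finsum[OF Q G(1)])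
    then have W: "finsum ?Q ?t {1..?m} \<oplus>\<^bsub>?Q\<^esub> finsum ?Q ?u {1..?m} \<in> ?G"
      using Q.finsum_addf[OF t u] by simp
    have ds: "P_boundary R A (Suc n) (insert_unit R A (Suc n) ?E) = ?E \<oplus>\<^bsub>?Q\<^esub> finsum ?Q ?t {1..?m}"
    proof -
      have "insert_unit R A (Suc n) ?E = P_elem R A ?\<tau> ?bs" using s(2)[of \<sigma> "Suc n" as] \<sigma> as by simp
      then have "P_boundary R A (Suc n) (insert_unit R A (Suc n) ?E) =
          finsum ?Q (P_term R A (Suc n) ?\<tau> ?bs) {1..Suc n + 2}"
        using P_boundary_P_elem[OF A \<tau> bs] by simp
      also have "{1..Suc n + 2} = insert 1 (Suc ` {1..?m})" unfolding image_Suc_atLeastAtMost by auto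
      also have "finsum ?Q (P_term R A (Suc n) ?\<tau> ?bs) (insert 1 (Suc ` {1..?m})) =
          P_term R A (Suc n) ?\<tau> ?bs 1 \<oplus>\<^bsub>?Q\<^esub> finsum ?Q (P_term R A (Suc n) ?\<tau> ?bs) (Suc ` {1..?m})"
        by (rule Q.finsum_insert) (use tc' in auto)
      also have "finsum ?Q (P_term R A (Suc n) ?\<tau> ?bs) (Suc ` {1..?m}) = finsum ?Q ?t {1..?m}"
        by (rule finsum_reindex_cong[OF Q.abelian_group_axioms _ t]) simp_all
      finally show ?thesis unfolding first .
    qed
    have sd: "insert_unit R A n (P_boundary R A n ?E) = finsum ?Q ?u {1..?m}"
      unfolding P_boundary_P_elem[OF A \<sigma> as]
      by (rule module_hom_finsum[OF P Q s(1)]) (use tc in auto)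
    have c: "finsum ?Q ?t {1..?m} \<in> carrier ?Q" "finsum ?Q ?u {1..?m} \<in> carrier ?Q"
      by (rule Q.finsum_closed[OF t], rule Q.finsum_closed[OF u])
    have "?E \<ominus>\<^bsub>?Q\<^esub> (?E \<oplus>\<^bsub>?Q\<^esub> finsum ?Q ?t {1..?m}) \<ominus>\<^bsub>?Q\<^esub> finsum ?Q ?u {1..?m} =
        \<ominus>\<^bsub>?Q\<^esub> (finsum ?Q ?t {1..?m} \<oplus>\<^bsub>?Q\<^esub> finsum ?Q ?u {1..?m})"
      using E c by (simp add: a_minus_def Q.minus_add Q.a_assoc[symmetric] Q.r_neg)
    then show "?E \<ominus>\<^bsub>?Q\<^esub> P_boundary R A (Suc n) (insert_unit R A (Suc n) ?E)
        \<ominus>\<^bsub>?Q\<^esub> insert_unit R A n (P_boundary R A n ?E) \<in> ?G"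
      unfolding ds sd using QE(3)[OF W] by simp
  qed
qed

theorem mainTheorem10:
  fixes k :: "('k, 'r) ring_scheme" and A :: "('k, 'a, 's) module_scheme"
  assumes "cring k" and "assoc_algebra k A"
  shows "\<forall>n. module_isomorphic k (homology (P_chain k A) (P_boundary k A) n) (HH k A n)"
proof
  fix n
  interpret A: assoc_algebra k A by fact
  have M: "module k A" by (rule A.module_axioms)
  note A = assms(2)
  show "module_isomorphic k (homology (P_chain k A) (P_boundary k A) n) (HH k A n)"
    unfolding HH_def
    by (rule filtered_homology_isomorphic[where \<iota> = "hoch_incl k A" and s = "insert_unit k A" and G = "P_filtration k A"])
      (rule hoch_complex[OF A] P_complex[OF A] hoch_incl(1)[OF M] hoch_incl_boundary[OF A] hoch_incl_inj[OF M]
        insert_unit(1)[OF A] insert_unit_hoch_incl[OF A] P_filtration_first[OF M] P_filtration_last[OF M]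
        insert_unit_homotopy[OF A]; assumption)+
qed


end
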